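(* Let $d\ge1$. The sequence of ideals $\{I_d(n)\}_{n\ge0}$ of tensor identities of $d\times d$ matrices is generated, as a $T$-ideal, by the $d+2$ elements $\mathfrak C_{k,d}(x)\in\mathcal T(X,d+1-k)$, $k=0,1,\dots,d+1$, and by $tr(1)=d$ (i.e. the element $tr(1)-d\in\mathcal T(X,0)$). In other words, every relation for equivariant tensor valued polynomial maps from $d\times d$ matrices to tensor products of $d\times d$ matrices can be deduced from these $d+2$ identities and $tr(1)=d$.
   Context: Work over $\mathbb Q$; $X=\{x_1,x_2,\dots\}$ is a set of variables indexed by $\mathbb N$, $x\in X$, and $\epsilon_\sigma=\pm1$ is the sign of $\sigma$. Free algebra with trace: an algebra with trace is an associative algebra $A$ with a linear map $tr:A\to A$ such that $tr(a)b=b\,tr(a)$, $tr(ab)=tr(ba)$, $tr(tr(a)b)=tr(a)tr(b)$. $T\langle X\rangle=\mathbb Q\langle X\rangle[tr(M)]$ is the free algebra with trace: the polynomial algebra over the free associative unital algebra $\mathbb Q\langle X\rangle$ in commuting central indeterminates $tr(M)$, one for each cyclic equivalence class of monomials $M$ (including $M=1$). Its trace algebra is $\mathbb Q[tr(M)]$. $T\langle X\rangle^{\otimes n}$ is the $n$-fold tensor product over $\mathbb Q[tr(M)]$ (equal to $\mathbb Q[tr(M)]$ for $n=0$). Twisted algebra: $\mathcal T(X,n):=T\langle X\rangle^{\otimes n}\ltimes\mathbb Q[S_n]$ is $T\langle X\rangle^{\otimes n}\otimes\mathbb Q[S_n]$ with commutation relations $\sigma\circ M_1\otimes\cdots\otimes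 M_n=M_{\sigma^{-1}(1)}\otimes\cdots\otimes M_{\sigma^{-1}(n)}\circ\sigma$. Tensor identities: each assignment $X\to M_d$ of $d\times d$ matrices induces an evaluation homomorphism $\mathcal T(X,n)\to M_d^{\otimes n}$, where formal traces go to traces and $\sigma\in S_n$ goes to the operator $v_1\otimes\cdots\otimes v_n\mapsto v_{\sigma^{-1}(1)}\otimes\cdots\otimes v_{\sigma^{-1}(n)}$. $I_d(n)\subset\mathcal T(X,n)$ is the two-sided ideal of elements vanishing under all evaluations. $T$-ideals: a sequence $\{J(n)\}_{n\ge0}$ of two-sided ideals $J(n)\subset\mathcal T(X,n)$ is a $T$-ideal if: (i) for every trace-compatible algebra endomorphism $g$ of $T\langle X\rangle$ (determined by an arbitrary substitution $X\to T\langle X\rangle$), the induced endomorphism $g^{\otimes n}\ltimes1$ of $\mathcal T(X,n)$ (identity on $S_n$) maps $J(n)$ into $J(n)$; (ii) $J(m)\otimes\mathcal T(X,n)+\mathcal T(X,m)\otimes J(n)\subset J(m+n)$ for all $m,n$, using the homomorphism $\mathcal T(X,m)\otimes\mathcal T(X,n)\to\mathcal T(X,m+n)$ coming from $S_m\times S_n\subset S_{m+n}$, $A\sigma\otimes B\tau\mapsto(A\otimes B)\sigma\tau$. (No stability under partial traces is required here.) The $T$-ideal generated by a subset of $\bigcup_n\mathcal T(X,n)$ is the smallest $T$-ideal containing it; its elements are said to be deduced from the subset. The elements $\mathfrak C_{k,d}(x)$: let $\sigma_r(x)=\frac1{r!}\sum_{\sigma\in S_r}\epsilon_\sigma t_\sigma(x)\in\mathbb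 Q[tr(M)]$, where $t_\sigma(x)=\prod_{j}tr(x^{\ell_j})$ with $\ell_j$ the lengths of the cycles of $\sigma$ (so $\sigma_r(x)$ is the $r$-th coefficient, up to sign, of the characteristic polynomial, written in terms of traces). For $n\ge1$, $i\ge0$ let $\mathfrak T_{i,n}(x)=\sum x^{h_1}\otimes\cdots\otimes x^{h_n}$, sum over all $(h_1,\dots,h_n)\in\mathbb Z_{\ge0}^n$ with $\sum h_j=i$. For $0\le k\le d$ and $n=d+1-k$, $$\mathfrak C_{k,d}(x):=\Big(\sum_{\tau\in S_n}\epsilon_\tau\tau\Big)\circ\Big[\mathfrak T_{k,n}(x)+\sum_{j=1}^k(-1)^j\sigma_j(x)\mathfrak T_{k-j,n}(x)\Big],$$ and for $k=d+1$ (so $n=0$), $\mathfrak C_{d+1,d}(x):=\frac{(-1)^{d+1}}{(d+1)!}\sum_{\sigma\in S_{d+1}}\epsilon_\sigma t_\sigma(x)=(-1)^{d+1}\sigma_{d+1}(x)$. *)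

theory Defs
  imports
    "HOL-Library.Poly_Mapping"
    "HOL-Library.Multiset"
    "HOL-Combinatorics.Permutations"
    "HOL-Combinatorics.Perm"
    "HOL-Algebra.Ideal"
    "Jordan_Normal_Form.Matrix"
begin

unbundle permutation_syntax

section \<open>The free algebra with trace\<close>

text \<open>
  The free monoid on \<open>X = {x\<^sub>0, x\<^sub>1, \<dots>}\<close>; the variable \<open>x\<^sub>i\<close> is represented by its index. It is
  written additively because the convolution product of \<^type>\<open>poly_mapping\<close> requires
  \<^class>\<open>monoid_add\<close>, which is not assumed to be commutative.
\<close>

datatype monomial = Mon (letters: "nat list")

instantiation monomial :: monoid_add
begin

definition zero_monomial :: monomial where
  "0 = Mon []"

definition plus_monomial :: "monomial \<Rightarrow> monomial \<Rightarrow> monomial" where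
  "M + N = Mon (letters M @ letters N)"

instance
  by standard (simp_all add: zero_monomial_def plus_monomial_def)

end

abbreviation var_power :: "nat \<Rightarrow> nat \<Rightarrow> monomial" where
  "var_power x h \<equiv> Mon (replicate h x)"

definition cyc_equiv :: "monomial \<Rightarrow> monomial \<Rightarrow> bool" where
  "cyc_equiv M N \<longleftrightarrow> (\<exists>P Q. M = P + Q \<and> N = Q + P)"

lemma cyc_equiv_rotate: "cyc_equiv M N \<longleftrightarrow> (\<exists>n. letters N = rotate n (letters M))"
proof
  assume "cyc_equiv M N"
  then obtain P Q where "M = P + Q" "N = Q + P"
    unfolding cyc_equiv_def by blast
  then have "letters N = rotate (length (letters P)) (letters M)"
    by (simp add: plus_monomial_def rotate_append)
  then show "\<exists>n. letters N = rotate n (letters M)" ..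
next
  assume "\<exists>n. letters N = rotate n (letters M)"
  then obtain n where n: "letters N = rotate n (letters M)" ..
  let ?k = "n mod length (letters M)"
  have "M = Mon (take ?k (letters M)) + Mon (drop ?k (letters M))"
    by (simp add: plus_monomial_def)
  moreover have "N = Mon (drop ?k (letters M)) + Mon (take ?k (letters M))"
    using n by (cases N) (simp add: plus_monomial_def rotate_drop_take)
  ultimately show "cyc_equiv M N"
    unfolding cyc_equiv_def by blast
qed

lemma equivp_cyc_equiv: "equivp cyc_equiv"
proof (rule equivpI)
  show "reflp cyc_equiv"
    by (rule reflpI) (auto simp: cyc_equiv_rotate intro: exI[of _ 0])
  show "symp cyc_equiv"
    by (rule sympI) (auto simp: cyc_equiv_def)
  show "transp cyc_equiv"
    by (rule transpI) (metis cyc_equiv_rotate rotate_rotate)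
qed

quotient_type cyc_monomial = monomial / cyc_equiv
  by (rule equivp_cyc_equiv)

text \<open>\<open>\<rat>[tr(M)]\<close>: the polynomial ring in the indeterminates \<open>tr(M)\<close>, one for each cyclic class.\<close>

type_synonym trace_ring = "cyc_monomial multiset \<Rightarrow>\<^sub>0 rat"

text \<open>
  \<open>T\<langle>X\<rangle>\<close>, as the free \<open>\<rat>[tr(M)]\<close>-module on the monomials with the convolution product.
\<close>

type_synonym free_trace_algebra = "monomial \<Rightarrow>\<^sub>0 trace_ring"

definition const_tr :: "rat \<Rightarrow> trace_ring" where
  "const_tr q = Poly_Mapping.single {#} q"

definition tr_monomial :: "monomial \<Rightarrow> trace_ring" where
  "tr_monomial M = Poly_Mapping.single {#abs_cyc_monomial M#} 1"

definition formal_trace :: "free_trace_algebra \<Rightarrow> free_trace_algebra" where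
  "formal_trace a = Poly_Mapping.single 0
     (\<Sum>M\<in>Poly_Mapping.keys a. Poly_Mapping.lookup a M * tr_monomial M)"

definition trace_endomorphism :: "(free_trace_algebra \<Rightarrow> free_trace_algebra) \<Rightarrow> bool" where
  "trace_endomorphism g \<longleftrightarrow>
     (\<forall>a b. g (a + b) = g a + g b) \<and>
     (\<forall>a b. g (a * b) = g a * g b) \<and>
     (\<forall>q. g (Poly_Mapping.single 0 (const_tr q)) = Poly_Mapping.single 0 (const_tr q)) \<and>
     (\<forall>a. g (formal_trace a) = formal_trace (g a))"


section \<open>The twisted algebras\<close>

text \<open>
  \<open>TMon u \<sigma>\<close> stands for \<open>u 0 \<otimes> u 1 \<otimes> \<dots> \<circ> \<sigma>\<close>. Tensor factors are numbered from \<open>0\<close>. All algebras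
  \<open>\<T>(X,n)\<close> live in one type, the element \<open>TMon u \<sigma>\<close> belonging to \<open>\<T>(X,n)\<close> if \<open>u i = 1\<close> for all
  \<open>i \<ge> n\<close> and \<open>\<sigma>\<close> moves only numbers below \<open>n\<close>. The product is the one dictated by
  \<open>\<sigma> \<circ> M\<^sub>1 \<otimes> \<dots> \<otimes> M\<^sub>n = M\<^bsub>\<sigma>\<^sup>-\<^sup>1(1)\<^esub> \<otimes> \<dots> \<otimes> M\<^bsub>\<sigma>\<^sup>-\<^sup>1(n)\<^esub> \<circ> \<sigma>\<close>.
\<close>

datatype tensor_monomial = TMon (factors: "nat \<Rightarrow> monomial") (permutation: "nat perm")

instantiation tensor_monomial :: monoid_add
begin

definition zero_tensor_monomial :: tensor_monomial where
  "0 = TMon (\<lambda>_. 0) 1"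

definition plus_tensor_monomial :: "tensor_monomial \<Rightarrow> tensor_monomial \<Rightarrow> tensor_monomial" where
  "s + t = TMon (\<lambda>i. factors s i + factors t (inverse (permutation s) \<langle>$\<rangle> i))
     (permutation s * permutation t)"

instance
  by standard
    (simp_all add: zero_tensor_monomial_def plus_tensor_monomial_def add.assoc mult.assoc
      apply_times tensor_monomial.expand)

end

text \<open>
  \<open>T\<langle>X\<rangle>\<^sup>\<otimes>\<^sup>n\<close>, the tensor power over \<open>\<rat>[tr(M)]\<close>, is free over \<open>\<rat>[tr(M)]\<close> on the \<open>n\<close>-tuples of monomials,
  so \<open>\<T>(X,n)\<close> is free over \<open>\<rat>[tr(M)]\<close> on the pairs of such a tuple and a permutation.
\<close>

type_synonym twisted_element = "tensor_monomial \<Rightarrow>\<^sub>0 trace_ring"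

definition sym_group :: "nat \<Rightarrow> nat perm set" where
  "sym_group n = {\<sigma>. affected \<sigma> \<subseteq> {..<n}}"

definition tensor_monomials :: "nat \<Rightarrow> tensor_monomial set" where
  "tensor_monomials n = {t. (\<forall>i\<ge>n. factors t i = 0) \<and> permutation t \<in> sym_group n}"

definition twisted_algebra :: "nat \<Rightarrow> twisted_element ring" where
  "twisted_algebra n =
     \<lparr>carrier = {a. Poly_Mapping.keys a \<subseteq> tensor_monomials n},
      monoid.mult = (*), one = 1, zero = 0, add = (+)\<rparr>"

definition coeff_elem :: "trace_ring \<Rightarrow> twisted_element" where
  "coeff_elem c = Poly_Mapping.single 0 c"

definition perm_elem :: "nat perm \<Rightarrow> twisted_element" where
  "perm_elem \<sigma> = Poly_Mapping.single (TMon (\<lambda>_. 0) \<sigma>) 1"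

definition tensor_elem :: "(nat \<Rightarrow> monomial) \<Rightarrow> twisted_element" where
  "tensor_elem u = Poly_Mapping.single (TMon u 1) 1"

lemma perm_elem_tensor_elem:
  "perm_elem \<sigma> * tensor_elem u = tensor_elem (\<lambda>i. u (inverse \<sigma> \<langle>$\<rangle> i)) * perm_elem \<sigma>"
  by (simp add: perm_elem_def tensor_elem_def mult_single plus_tensor_monomial_def)

lemma sym_group_one: "1 \<in> sym_group n"
  by (simp add: sym_group_def)

lemma sym_group_outside:
  assumes "\<sigma> \<in> sym_group n" "n \<le> i"
  shows "\<sigma> \<langle>$\<rangle> i = i"
  using assms by (auto simp: sym_group_def in_affected)

lemma sym_group_inverse: "\<sigma> \<in> sym_group n \<Longrightarrow> inverse \<sigma> \<in> sym_group n"
  by (simp add: sym_group_def)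

lemma sym_group_times: "\<sigma> \<in> sym_group n \<Longrightarrow> \<tau> \<in> sym_group n \<Longrightarrow> \<sigma> * \<tau> \<in> sym_group n"
  unfolding sym_group_def using affected_times[of \<sigma> \<tau>] by blast

lemma tensor_monomials_zero: "0 \<in> tensor_monomials n"
  by (simp add: tensor_monomials_def zero_tensor_monomial_def sym_group_one)

lemma tensor_monomials_plus:
  "s \<in> tensor_monomials n \<Longrightarrow> t \<in> tensor_monomials n \<Longrightarrow> s + t \<in> tensor_monomials n"
  by (auto simp: tensor_monomials_def plus_tensor_monomial_def sym_group_times
      sym_group_outside[OF sym_group_inverse])

lemma ring_twisted_algebra: "ring (twisted_algebra n)"
proof (rule ringI)
  show "abelian_group (twisted_algebra n)"
  proof (rule abelian_groupI)
    fix a assume "a \<in> carrier (twisted_algebra n)"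
    then show "\<exists>b\<in>carrier (twisted_algebra n). b \<oplus>\<^bsub>twisted_algebra n\<^esub> a = \<zero>\<^bsub>twisted_algebra n\<^esub>"
      by (intro bexI[of _ "- a"]) (auto simp: twisted_algebra_def)
  qed (auto simp: twisted_algebra_def add.assoc add.commute
      dest!: subsetD[OF Poly_Mapping.keys_add])
  show "Group.monoid (twisted_algebra n)"
  proof (rule monoidI)
    fix a b
    assume "a \<in> carrier (twisted_algebra n)" "b \<in> carrier (twisted_algebra n)"
    then show "a \<otimes>\<^bsub>twisted_algebra n\<^esub> b \<in> carrier (twisted_algebra n)"
      using keys_mult[of a b] by (fastforce simp: twisted_algebra_def intro: tensor_monomials_plus)
  qed (auto simp: twisted_algebra_def mult.assoc tensor_monomials_zero)
qed (auto simp: twisted_algebra_def distrib_left distrib_right)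


section \<open>T-ideals\<close>

definition factor_elem :: "nat \<Rightarrow> free_trace_algebra \<Rightarrow> twisted_element" where
  "factor_elem i a = (\<Sum>M\<in>Poly_Mapping.keys a.
     Poly_Mapping.single (TMon (\<lambda>j. if j = i then M else 0) 1) (Poly_Mapping.lookup a M))"

text \<open>
  The endomorphism \<open>g\<^sup>\<otimes>\<^sup>n \<ltimes> 1\<close>. A trace endomorphism \<open>g\<close> maps \<open>\<rat>[tr(M)]\<close> to itself, so in the first factor
  \<^const>\<open>factor_elem\<close> only carries an element of \<open>\<rat>[tr(M)]\<close> over, and the index \<open>0\<close> is immaterial.
\<close>

definition induced_endomorphism ::
    "nat \<Rightarrow> (free_trace_algebra \<Rightarrow> free_trace_algebra) \<Rightarrow> twisted_element \<Rightarrow> twisted_element" where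
  "induced_endomorphism n g a = (\<Sum>t\<in>Poly_Mapping.keys a.
     factor_elem 0 (g (Poly_Mapping.single 0 (Poly_Mapping.lookup a t)))
     * prod_list (map (\<lambda>i. factor_elem i (g (Poly_Mapping.single (factors t i) 1))) [0..<n])
     * perm_elem (permutation t))"

lift_definition shift_perm :: "nat \<Rightarrow> nat perm \<Rightarrow> nat perm"
  is "\<lambda>m f i. if i < m then i else f (i - m) + m"
proof -
  fix m :: nat and f :: "nat \<Rightarrow> nat"
  assume f: "bij f \<and> finite {a. f a \<noteq> a}"
  let ?s = "\<lambda>i. if i < m then i else f (i - m) + m"
  have "inj ?s"
  proof (rule injI)
    fix i j assume eq: "?s i = ?s j"
    show "i = j"
    proof (cases "i < m \<or> j < m")
      case True
      with eq show ?thesis by (auto split: if_splits)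
    next
      case False
      with eq have "f (i - m) = f (j - m)" by simp
      with f have "i - m = j - m" by (meson bij_is_inj injD)
      with False show ?thesis by linarith
    qed
  qed
  moreover have "surj ?s"
  proof (unfold surj_def eq_commute[of _ "?s _"], intro allI)
    fix j
    show "\<exists>i. ?s i = j"
    proof (cases "j < m")
      case True
      then show ?thesis by (intro exI[of _ j]) simp
    next
      case False
      from f obtain k where "f k = j - m" by (metis bij_pointE)
      with False show ?thesis by (intro exI[of _ "k + m"]) simp
    qed
  qed
  moreover have "{a. ?s a \<noteq> a} \<subseteq> (\<lambda>i. i + m) ` {a. f a \<noteq> a}"
  proof
    fix a assume "a \<in> {a. ?s a \<noteq> a}"
    then have "\<not> a < m" "f (a - m) \<noteq> a - m" by (auto split: if_splits)
    then show "a \<in> (\<lambda>i. i + m) ` {a. f a \<noteq> a}"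
      by (intro image_eqI[of _ _ "a - m"]) auto
  qed
  then have "finite {a. ?s a \<noteq> a}"
    using f by (meson finite_imageI finite_subset)
  ultimately show "bij ?s \<and> finite {a. ?s a \<noteq> a}"
    by (simp only: bij_def simp_thms)
qed

text \<open>The homomorphism \<open>\<T>(X,m) \<otimes> \<T>(X,n) \<rightarrow> \<T>(X,m+n)\<close>, \<open>A\<sigma> \<otimes> B\<tau> \<mapsto> (A \<otimes> B)\<sigma>\<tau>\<close>.\<close>

definition juxtapose :: "nat \<Rightarrow> tensor_monomial \<Rightarrow> tensor_monomial \<Rightarrow> tensor_monomial" where
  "juxtapose m s t = TMon (\<lambda>i. if i < m then factors s i else factors t (i - m))
     (permutation s * shift_perm m (permutation t))"

definition outer_product :: "nat \<Rightarrow> twisted_element \<Rightarrow> twisted_element \<Rightarrow> twisted_element" where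
  "outer_product m a b = (\<Sum>s\<in>Poly_Mapping.keys a. \<Sum>t\<in>Poly_Mapping.keys b.
     Poly_Mapping.single (juxtapose m s t) (Poly_Mapping.lookup a s * Poly_Mapping.lookup b t))"

lemma twisted_algebra_simps:
  "a \<in> carrier (twisted_algebra n) \<longleftrightarrow> Poly_Mapping.keys a \<subseteq> tensor_monomials n"
  "(\<otimes>\<^bsub>twisted_algebra n\<^esub>) = (*)" "(\<oplus>\<^bsub>twisted_algebra n\<^esub>) = (+)"
  "\<one>\<^bsub>twisted_algebra n\<^esub> = 1" "\<zero>\<^bsub>twisted_algebra n\<^esub> = 0"
  by (simp_all add: twisted_algebra_def)

lemma twisted_carrier_sum:
  "(\<And>s. s \<in> S \<Longrightarrow> f s \<in> carrier (twisted_algebra n)) \<Longrightarrow> sum f S \<in> carrier (twisted_algebra n)"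
  by (induction S rule: infinite_finite_induct)
    (auto simp: twisted_algebra_simps dest!: subsetD[OF Poly_Mapping.keys_add])

lemma twisted_carrier_mult:
  "a \<in> carrier (twisted_algebra n) \<Longrightarrow> b \<in> carrier (twisted_algebra n) \<Longrightarrow>
   a * b \<in> carrier (twisted_algebra n)"
  using keys_mult[of a b] by (fastforce simp: twisted_algebra_simps intro: tensor_monomials_plus)

lemma twisted_carrier_single:
  "t \<in> tensor_monomials n \<Longrightarrow> Poly_Mapping.single t c \<in> carrier (twisted_algebra n)"
  by (simp add: twisted_algebra_simps)

lemma twisted_carrier_prod_list:
  "(\<And>a. a \<in> set as \<Longrightarrow> a \<in> carrier (twisted_algebra n)) \<Longrightarrow>
   prod_list as \<in> carrier (twisted_algebra n)"
proof (induction as)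
  case Nil
  show ?case by (simp add: twisted_algebra_simps tensor_monomials_zero)
qed (simp add: twisted_carrier_mult)

lemma trace_endomorphism_trace_ring:
  assumes "trace_endomorphism g"
  shows "\<exists>c'. g (Poly_Mapping.single 0 c) = Poly_Mapping.single 0 c'"
proof -
  have add: "g (a + b) = g a + g b" and mult: "g (a * b) = g a * g b"
    and rat: "g (Poly_Mapping.single 0 (const_tr q)) = Poly_Mapping.single 0 (const_tr q)"
    and tr: "g (formal_trace a) = formal_trace (g a)" for a b q
    using assms by (auto simp: trace_endomorphism_def)
  have "\<exists>c'. g (Poly_Mapping.single 0 (Poly_Mapping.single m q)) = Poly_Mapping.single 0 c'" for m q
  proof (induction m)
    case empty
    show ?case using rat[of q] by (auto simp: const_tr_def)
  next
    case (add y m)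
    obtain M where y: "y = abs_cyc_monomial M"
      by (metis Quotient3_abs_rep[OF Quotient3_cyc_monomial])
    have "g (Poly_Mapping.single 0 (tr_monomial M)) = formal_trace (g (Poly_Mapping.single M 1))"
      using tr[of "Poly_Mapping.single M 1"] by (simp add: formal_trace_def)
    moreover have "Poly_Mapping.single 0 (Poly_Mapping.single (add_mset y m) q)
        = Poly_Mapping.single 0 (tr_monomial M) * Poly_Mapping.single (0::monomial) (Poly_Mapping.single m q)"
      by (simp add: tr_monomial_def mult_single y)
    moreover obtain c' where
      "g (Poly_Mapping.single 0 (Poly_Mapping.single m q)) = Poly_Mapping.single 0 c'"
      using add.IH by blast
    ultimately have "g (Poly_Mapping.single 0 (Poly_Mapping.single (add_mset y m) q))
        = formal_trace (g (Poly_Mapping.single M 1)) * Poly_Mapping.single 0 c'"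
      by (simp only: mult)
    then show ?case
      by (auto simp: mult_single formal_trace_def)
  qed
  note monomial_case = this
  show ?thesis
  proof (induction c rule: update_induct)
    case const
    show ?case using rat[of 0] by (auto simp: const_tr_def intro: exI[of _ 0])
  next
    case (update c m q)
    have "Poly_Mapping.update m q c = c + Poly_Mapping.single m q"
      using update.hyps
      by (intro poly_mapping_eqI) (auto simp: lookup_update lookup_add lookup_single in_keys_iff)
    then have "Poly_Mapping.single (0::monomial) (Poly_Mapping.update m q c)
        = Poly_Mapping.single 0 c + Poly_Mapping.single 0 (Poly_Mapping.single m q)"
      by (simp add: single_add)
    moreover obtain c1 c2 where "g (Poly_Mapping.single 0 c) = Poly_Mapping.single 0 c1"
      "g (Poly_Mapping.single 0 (Poly_Mapping.single m q)) = Poly_Mapping.single 0 c2"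
      using update(3) monomial_case[of m q] by blast
    ultimately have "g (Poly_Mapping.single 0 (Poly_Mapping.update m q c))
        = Poly_Mapping.single 0 (c1 + c2)"
      by (simp only: add single_add)
    then show ?case ..
  qed
qed

lemma induced_endomorphism_carrier:
  assumes g: "trace_endomorphism g" and a: "a \<in> carrier (twisted_algebra n)"
  shows "induced_endomorphism n g a \<in> carrier (twisted_algebra n)"
proof -
  have "factor_elem 0 (g (Poly_Mapping.single 0 c)) \<in> carrier (twisted_algebra n)" for c
  proof -
    obtain c' where "g (Poly_Mapping.single 0 c) = Poly_Mapping.single 0 c'"
      using trace_endomorphism_trace_ring[OF g] by blast
    then show ?thesis
      by (auto simp: factor_elem_def tensor_monomials_def sym_group_one twisted_algebra_simps
          intro!: twisted_carrier_sum twisted_carrier_single split: if_splits)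
  qed
  moreover have "factor_elem i b \<in> carrier (twisted_algebra n)" if "i < n" for i b
    using that by (auto simp: factor_elem_def tensor_monomials_def sym_group_one
        intro!: twisted_carrier_sum twisted_carrier_single)
  moreover have "perm_elem (permutation t) \<in> carrier (twisted_algebra n)"
    if "t \<in> Poly_Mapping.keys a" for t
    using that a by (auto simp: perm_elem_def tensor_monomials_def twisted_algebra_simps)
  ultimately show ?thesis
    unfolding induced_endomorphism_def
    by (intro twisted_carrier_sum twisted_carrier_mult twisted_carrier_prod_list) auto
qed

lemma shift_perm_sym_group: "\<tau> \<in> sym_group n \<Longrightarrow> shift_perm m \<tau> \<in> sym_group (m + n)"
proof -
  assume \<tau>: "\<tau> \<in> sym_group n"
  have "shift_perm m \<tau> \<langle>$\<rangle> i = i" if "m + n \<le> i" for i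
    using that sym_group_outside[OF \<tau>, of "i - m"] by (simp add: shift_perm.rep_eq)
  then show ?thesis
    by (force simp: sym_group_def in_affected not_le[symmetric])
qed

lemma outer_product_carrier:
  assumes "a \<in> carrier (twisted_algebra m)" "b \<in> carrier (twisted_algebra n)"
  shows "outer_product m a b \<in> carrier (twisted_algebra (m + n))"
proof -
  have "juxtapose m s t \<in> tensor_monomials (m + n)"
    if "s \<in> tensor_monomials m" "t \<in> tensor_monomials n" for s t
  proof -
    have "permutation s \<in> sym_group (m + n)"
      using that by (force simp: tensor_monomials_def sym_group_def)
    then show ?thesis
      using that
      by (auto simp: tensor_monomials_def juxtapose_def shift_perm_sym_group sym_group_times)
  qed
  then show ?thesis
    unfolding outer_product_def using assms
    by (intro twisted_carrier_sum twisted_carrier_single) (auto simp: twisted_algebra_simps)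
qed

definition T_ideal :: "(nat \<Rightarrow> twisted_element set) \<Rightarrow> bool" where
  "T_ideal J \<longleftrightarrow>
     (\<forall>n. ideal (J n) (twisted_algebra n)) \<and>
     (\<forall>g n. trace_endomorphism g \<longrightarrow> induced_endomorphism n g ` J n \<subseteq> J n) \<and>
     (\<forall>m n. \<forall>a\<in>J m. \<forall>b\<in>carrier (twisted_algebra n). outer_product m a b \<in> J (m + n)) \<and>
     (\<forall>m n. \<forall>a\<in>carrier (twisted_algebra m). \<forall>b\<in>J n. outer_product m a b \<in> J (m + n))"

text \<open>
  Subsets of the disjoint union of the \<open>\<T>(X,n)\<close> are families of subsets, ordered componentwise;
  the infimum is the componentwise intersection.
\<close>

definition T_ideal_generated :: "(nat \<Rightarrow> twisted_element set) \<Rightarrow> nat \<Rightarrow> twisted_element set" where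
  "T_ideal_generated G = Inf {J. T_ideal J \<and> G \<le> J}"

lemma T_ideal_carrier: "T_ideal (\<lambda>n. carrier (twisted_algebra n))"
  by (auto simp: T_ideal_def ring.oneideal ring_twisted_algebra induced_endomorphism_carrier
      outer_product_carrier)

lemma T_ideal_T_ideal_generated:
  assumes "\<And>n. G n \<subseteq> carrier (twisted_algebra n)"
  shows "T_ideal (T_ideal_generated G)"
proof -
  let ?S = "{J. T_ideal J \<and> G \<le> J}"
  have "(\<lambda>n. carrier (twisted_algebra n)) \<in> ?S"
    using assms by (simp add: T_ideal_carrier le_fun_def)
  then have "ideal (\<Inter>((\<lambda>J. J n) ` ?S)) (twisted_algebra n)" for n
    by (intro ring.i_Intersect[OF ring_twisted_algebra]) (auto simp: T_ideal_def)
  moreover have "T_ideal_generated G n = \<Inter>((\<lambda>J. J n) ` ?S)" for n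
    by (simp add: T_ideal_generated_def)
  ultimately show ?thesis
    unfolding T_ideal_def by (auto simp: T_ideal_def image_subset_iff)
qed


section \<open>Tensor identities of matrices\<close>

definition mat_trace :: "rat mat \<Rightarrow> rat" where
  "mat_trace B = (\<Sum>i<dim_row B. B $$ (i, i))"

definition eval_monomial :: "nat \<Rightarrow> (nat \<Rightarrow> rat mat) \<Rightarrow> monomial \<Rightarrow> rat mat" where
  "eval_monomial d A M = foldr (\<lambda>i B. A i * B) (letters M) (1\<^sub>m d)"

definition eval_cyc :: "nat \<Rightarrow> (nat \<Rightarrow> rat mat) \<Rightarrow> cyc_monomial \<Rightarrow> rat" where
  "eval_cyc d A c = mat_trace (eval_monomial d A (rep_cyc_monomial c))"

definition eval_trace_ring :: "nat \<Rightarrow> (nat \<Rightarrow> rat mat) \<Rightarrow> trace_ring \<Rightarrow> rat" where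
  "eval_trace_ring d A c = (\<Sum>m\<in>Poly_Mapping.keys c.
     Poly_Mapping.lookup c m * prod_mset (image_mset (eval_cyc d A) m))"

text \<open>
  \<open>M\<^sub>d\<^sup>\<otimes>\<^sup>n = End(V\<^sup>\<otimes>\<^sup>n)\<close>, \<open>V = \<rat>\<^sup>d\<close>, as matrices with respect to the basis
  \<open>e\<^sub>I = e\<^bsub>I 0\<^esub> \<otimes> \<dots> \<otimes> e\<^bsub>I (n-1)\<^esub>\<close> of \<open>V\<^sup>\<otimes>\<^sup>n\<close>; row index first.
\<close>

type_synonym tensor_operator = "(nat \<Rightarrow> nat) \<Rightarrow> (nat \<Rightarrow> nat) \<Rightarrow> rat"

definition multi_indices :: "nat \<Rightarrow> nat \<Rightarrow> (nat \<Rightarrow> nat) set" where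
  "multi_indices d n = {..<n} \<rightarrow>\<^sub>E {..<d}"

definition operator_mult ::
    "nat \<Rightarrow> nat \<Rightarrow> tensor_operator \<Rightarrow> tensor_operator \<Rightarrow> tensor_operator" where
  "operator_mult d n P Q = (\<lambda>I K. \<Sum>J\<in>multi_indices d n. P I J * Q J K)"

definition pure_tensor_operator :: "nat \<Rightarrow> (nat \<Rightarrow> rat mat) \<Rightarrow> tensor_operator" where
  "pure_tensor_operator n B = (\<lambda>I J. \<Prod>i<n. B i $$ (I i, J i))"

text \<open>
  On basis vectors \<open>v\<^sub>1 \<otimes> \<dots> \<otimes> v\<^sub>n \<mapsto> v\<^bsub>\<sigma>\<^sup>-\<^sup>1(1)\<^esub> \<otimes> \<dots> \<otimes> v\<^bsub>\<sigma>\<^sup>-\<^sup>1(n)\<^esub>\<close> is \<open>e\<^sub>J \<mapsto> e\<^bsub>J \<circ> \<sigma>\<^sup>-\<^sup>1\<^esub>\<close>.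
\<close>

definition perm_operator :: "nat perm \<Rightarrow> tensor_operator" where
  "perm_operator \<sigma> = (\<lambda>I J. if I = (\<lambda>i. J (inverse \<sigma> \<langle>$\<rangle> i)) then 1 else 0)"

definition evaluation :: "nat \<Rightarrow> nat \<Rightarrow> (nat \<Rightarrow> rat mat) \<Rightarrow> twisted_element \<Rightarrow> tensor_operator" where
  "evaluation d n A a = (\<lambda>I J. \<Sum>t\<in>Poly_Mapping.keys a.
     eval_trace_ring d A (Poly_Mapping.lookup a t)
     * operator_mult d n (pure_tensor_operator n (\<lambda>i. eval_monomial d A (factors t i)))
         (perm_operator (permutation t)) I J)"

definition tensor_identities :: "nat \<Rightarrow> nat \<Rightarrow> twisted_element set" where
  "tensor_identities d n = {a \<in> carrier (twisted_algebra n).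
     \<forall>A. (\<forall>i. A i \<in> carrier_mat d d) \<longrightarrow>
       (\<forall>I\<in>multi_indices d n. \<forall>J\<in>multi_indices d n. evaluation d n A a I J = 0)}"

lemma eval_monomial_carrier:
  assumes "\<And>i. A i \<in> carrier_mat d d"
  shows "eval_monomial d A M \<in> carrier_mat d d"
proof -
  have "foldr (\<lambda>i B. A i * B) w (1\<^sub>m d) \<in> carrier_mat d d" for w
    using assms by (induction w) (auto intro: mult_carrier_mat)
  then show ?thesis by (simp add: eval_monomial_def)
qed

lemma eval_monomial_plus:
  assumes A: "\<And>i. A i \<in> carrier_mat d d"
  shows "eval_monomial d A (M + N) = eval_monomial d A M * eval_monomial d A N"
proof -
  let ?f = "foldr (\<lambda>i B. A i * B)"
  have c: "?f w (1\<^sub>m d) \<in> carrier_mat d d" for w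
    using A by (induction w) (auto intro: mult_carrier_mat)
  have "?f (v @ w) (1\<^sub>m d) = ?f v (1\<^sub>m d) * ?f w (1\<^sub>m d)" for v w
  proof (induction v)
    case Nil
    show ?case using c[of w] by simp
  next
    case (Cons i v)
    then show ?case
      using assoc_mult_mat[OF A[of i] c[of v] c[of w]] by simp
  qed
  then show ?thesis by (simp add: eval_monomial_def plus_monomial_def)
qed

lemma mat_trace_commute:
  assumes "B \<in> carrier_mat d d" "C \<in> carrier_mat d d"
  shows "mat_trace (B * C) = mat_trace (C * B)"
proof -
  have "mat_trace (B * C) = (\<Sum>i<d. \<Sum>j<d. B $$ (i, j) * C $$ (j, i))"
    using assms by (auto simp: mat_trace_def scalar_prod_def atLeast0LessThan intro!: sum.cong)
  also have "\<dots> = (\<Sum>j<d. \<Sum>i<d. C $$ (j, i) * B $$ (i, j))"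
    by (subst sum.swap) (simp add: mult.commute)
  also have "\<dots> = mat_trace (C * B)"
    using assms by (auto simp: mat_trace_def scalar_prod_def atLeast0LessThan intro!: sum.cong)
  finally show ?thesis .
qed

lemma eval_cyc_abs:
  assumes "\<And>i. A i \<in> carrier_mat d d"
  shows "eval_cyc d A (abs_cyc_monomial M) = mat_trace (eval_monomial d A M)"
proof -
  have "cyc_equiv (rep_cyc_monomial (abs_cyc_monomial M)) M"
    using Quotient3_rep_abs[OF Quotient3_cyc_monomial, of M]
      equivp_reflp[OF equivp_cyc_equiv] by blast
  then show ?thesis
    using mat_trace_commute[OF eval_monomial_carrier[OF assms] eval_monomial_carrier[OF assms]]
    by (auto simp: eval_cyc_def cyc_equiv_def eval_monomial_plus[OF assms])
qed


section \<open>The generating identities\<close>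

definition perm_sign :: "nat perm \<Rightarrow> rat" where
  "perm_sign \<sigma> = of_int (sign (apply \<sigma>))"

text \<open>The cycles of an element of \<open>S\<^sub>r\<close>, fixed points included.\<close>

definition cycle_supports :: "nat \<Rightarrow> nat perm \<Rightarrow> nat set set" where
  "cycle_supports r \<sigma> = orbit \<sigma> ` {..<r}"

definition t_perm :: "nat \<Rightarrow> nat perm \<Rightarrow> nat \<Rightarrow> trace_ring" where
  "t_perm r \<sigma> x = (\<Prod>C\<in>cycle_supports r \<sigma>. tr_monomial (var_power x (card C)))"

definition sigma_coeff :: "nat \<Rightarrow> nat \<Rightarrow> trace_ring" where
  "sigma_coeff r x = const_tr (1 / fact r)
     * (\<Sum>\<sigma>\<in>sym_group r. const_tr (perm_sign \<sigma>) * t_perm r \<sigma> x)"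

definition exponents :: "nat \<Rightarrow> nat \<Rightarrow> (nat \<Rightarrow> nat) set" where
  "exponents i n = {h. (\<forall>j\<ge>n. h j = 0) \<and> (\<Sum>j<n. h j) = i}"

lemma finite_exponents: "finite (exponents i n)"
proof (rule finite_subset)
  show "exponents i n \<subseteq> {h. \<forall>j. (j \<in> {..<n} \<longrightarrow> h j \<in> {..i}) \<and> (j \<notin> {..<n} \<longrightarrow> h j = 0)}"
    by (auto simp: exponents_def intro: member_le_sum)
  show "finite {h :: nat \<Rightarrow> nat. \<forall>j. (j \<in> {..<n} \<longrightarrow> h j \<in> {..i}) \<and> (j \<notin> {..<n} \<longrightarrow> h j = 0)}"
    by (rule finite_set_of_finite_funs) auto
qed

lemma finite_sym_group: "finite (sym_group n)"
proof (rule finite_imageD)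
  have "\<exists>i. \<sigma> \<langle>$\<rangle> i = j" for \<sigma> :: "nat perm" and j
    using bij_is_surj[OF bij_apply, of \<sigma>] by (metis surjD)
  then have "apply ` sym_group n \<subseteq> {p. p permutes {..<n}}"
    by (auto simp: permutes_def sym_group_outside apply_inj)
  then show "finite (apply ` sym_group n)"
    by (rule finite_subset) (simp add: finite_permutations)
  show "inj_on apply (sym_group n)"
    by (simp add: inj_on_def apply_inject)
qed

definition complete_elem :: "nat \<Rightarrow> nat \<Rightarrow> nat \<Rightarrow> twisted_element" where
  "complete_elem i n x = (\<Sum>h\<in>exponents i n. tensor_elem (\<lambda>j. var_power x (h j)))"

definition antisymmetrizer :: "nat \<Rightarrow> twisted_element" where
  "antisymmetrizer n = (\<Sum>\<tau>\<in>sym_group n. coeff_elem (const_tr (perm_sign \<tau>)) * perm_elem \<tau>)"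

definition C_elem :: "nat \<Rightarrow> nat \<Rightarrow> nat \<Rightarrow> twisted_element" where
  "C_elem k d x =
     (if k \<le> d then
        antisymmetrizer (d + 1 - k) *
          (complete_elem k (d + 1 - k) x
           + (\<Sum>j = 1..k. (- 1) ^ j * coeff_elem (sigma_coeff j x) * complete_elem (k - j) (d + 1 - k) x))
      else (- 1) ^ (d + 1) * coeff_elem (sigma_coeff (d + 1) x))"

text \<open>The monomial \<open>1\<close> is the neutral element \<open>0\<close> of \<^type>\<open>monomial\<close>, so \<^term>\<open>tr_monomial 0\<close> is \<open>tr(1)\<close>.\<close>

definition generators :: "nat \<Rightarrow> nat \<Rightarrow> nat \<Rightarrow> twisted_element set" where
  "generators d x n =
     {C_elem k d x | k. k \<le> d + 1 \<and> n = d + 1 - k}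
     \<union> (if n = 0 then {coeff_elem (tr_monomial 0 - const_tr (of_nat d))} else {})"

lemma generators_carrier: "generators d x n \<subseteq> carrier (twisted_algebra n)"
proof -
  have coeff: "coeff_elem c \<in> carrier (twisted_algebra m)" for c m
    by (auto simp: coeff_elem_def intro: twisted_carrier_single tensor_monomials_zero)
  have sign: "(- 1) ^ j \<in> carrier (twisted_algebra m)" for j m
    by (cases "even j") (auto simp: twisted_algebra_simps tensor_monomials_zero)
  have antisym: "antisymmetrizer m \<in> carrier (twisted_algebra m)" for m
    unfolding antisymmetrizer_def perm_elem_def
    by (intro twisted_carrier_sum twisted_carrier_mult coeff twisted_carrier_single)
      (simp add: tensor_monomials_def)
  have complete: "complete_elem i m x \<in> carrier (twisted_algebra m)" for i m
    unfolding complete_elem_def tensor_elem_def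
    by (intro twisted_carrier_sum twisted_carrier_single)
      (simp add: tensor_monomials_def exponents_def sym_group_one zero_monomial_def)
  have plus: "a + b \<in> carrier (twisted_algebra m)"
    if "a \<in> carrier (twisted_algebra m)" "b \<in> carrier (twisted_algebra m)" for a b m
    using that keys_add[of a b] by (auto simp: twisted_algebra_simps)
  have C: "C_elem k d x \<in> carrier (twisted_algebra (d + 1 - k))" if "k \<le> d + 1" for k
    unfolding C_elem_def if_bool_eq_conj if_distrib[of "\<lambda>a. a \<in> _"]
    by (intro conjI impI twisted_carrier_mult plus twisted_carrier_sum antisym complete sign coeff)
  show ?thesis
    using C C[of "Suc d"] by (auto simp: generators_def coeff)
qed

end

theory Submission
  imports Defs "HOL-Library.Fun_Lexorder" "HOL-Computational_Algebra.Polynomial"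
begin

text \<open>
  Closing the last \<open>k\<close> strands of the antisymmetrizer on \<open>d + 1\<close> strands after multiplying them by
  \<open>a\<^sub>1, \<dots>, a\<^sub>k\<close> gives a multilinear symmetric element, whose value at \<open>a\<^sub>1 = \<dots> = a\<^sub>k = x\<close> is, by Newton's
  identities, a multiple of \<open>\<CC>\<^bsub>k,d\<^esub>(x)\<close>. Hence \<open>\<CC>\<^bsub>k,d\<^esub>(x)\<close> is a tensor identity, and polarizing its
  substitution instances puts all these elements into any T-ideal containing it. The ideals they generate
  together with \<open>tr(1) - d\<close> are closed under partial traces: a further strand either passes by the
  antisymmetrizer or, by antisymmetry, can be assumed to close its last strand.

  To see that these ideals contain every tensor identity \<open>a\<close>, cut \<open>a\<close> open at the occurrences of a variable
  \<open>x\<^sub>y\<close>. The result \<open>b\<^sub>y\<close> has one more strand and lower degree, and it is again an identity, because closing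
  it with a matrix \<open>C\<close> is the derivative of \<open>a\<close> in the direction \<open>C\<close>. Closing \<open>b\<^sub>y\<close> with \<open>x\<^sub>y\<close> and summing
  over \<open>y\<close> returns \<open>a\<close> multiplied by its degree, so by induction only degree zero remains. There \<open>a\<close> reduces
  to an element of the group algebra of \<open>S\<^sub>n\<close> acting as zero on \<open>V\<^sup>\<otimes>\<^sup>n\<close>, and these are combinations of
  antisymmetrizers on \<open>d + 1\<close> letters.
\<close>

section \<open>Additive spans and additive maps\<close>

text \<open>The obstacle is that a T-ideal need not be stable under partial traces, whereas the
  induction on degree recovers an identity only after closing a strand. The induction therefore runs
  inside the explicitly spanned \<open>core_ideal\<close> and not inside an arbitrary T-ideal.
  Stability is also the reason for having the whole family k = 0, ..., d + 1: closing one more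
  strand leads from k to k + 1, until no open strand is left.

  The generators contain a single variable, yet it suffices to substitute one arbitrary element a
  for all variables, since polarization separates the arguments afterwards. Characteristic zero
  enters three times: Newton's identities divide by k, polarization divides by the number of equal
  arguments, and the induction divides by the degree. Derivatives are taken without limits: along a
  line A + sC all matrix entries of an evaluation are polynomials in s, and a polynomial that
  vanishes at all rationals has linear coefficient 0.\<close>

inductive_set add_span :: "'a::comm_monoid_add set \<Rightarrow> 'a set" for S where
  zero: "0 \<in> add_span S"
| add: "x \<in> S \<Longrightarrow> y \<in> add_span S \<Longrightarrow> x + y \<in> add_span S"

lemma add_span_base: "x \<in> S \<Longrightarrow> x \<in> add_span S"
  using add_span.add[OF _ add_span.zero] by fastforce

lemma add_span_add: "x \<in> add_span S \<Longrightarrow> y \<in> add_span S \<Longrightarrow> x + y \<in> add_span S"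
  by (induction rule: add_span.induct) (auto simp: add.assoc intro: add_span.add)

lemma add_span_sum: "(\<And>i. i \<in> I \<Longrightarrow> f i \<in> add_span S) \<Longrightarrow> sum f I \<in> add_span S"
  by (induction I rule: infinite_finite_induct) (auto intro: add_span.zero add_span_add)

text \<open>Every finitely supported function is a sum of \<open>Poly_Mapping.single\<close> terms.
  The test on these terms is restricted to the keys of \<open>z\<close>, so that a hypothesis such
  as \<open>z \<in> TX n\<close> can be used in it.\<close>

lemma additive_eqI:
  fixes F G :: "('a \<Rightarrow>\<^sub>0 'b::comm_monoid_add) \<Rightarrow> 'c::cancel_comm_monoid_add"
  assumes F: "\<And>a b. F (a + b) = F a + F b" and G: "\<And>a b. G (a + b) = G a + G b"
    and single: "\<And>k v. k \<in> Poly_Mapping.keys z \<Longrightarrow> F (Poly_Mapping.single k v) = G (Poly_Mapping.single k v)"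
  shows "F z = G z"
proof -
  have 0: "F 0 = 0" "G 0 = 0"
    using F[of 0 0] G[of 0 0] by simp_all
  have sum: "F (sum h I) = (\<Sum>i\<in>I. F (h i))" "G (sum h I) = (\<Sum>i\<in>I. G (h i))"
    for h :: "'a \<Rightarrow> 'a \<Rightarrow>\<^sub>0 'b" and I
    by (induction I rule: infinite_finite_induct) (simp_all add: F G 0)
  have "z = (\<Sum>k\<in>Poly_Mapping.keys z. Poly_Mapping.single k (Poly_Mapping.lookup z k))"
    by (intro poly_mapping_eqI) (auto simp: lookup_sum lookup_single when_def in_keys_iff)
  then show ?thesis
    by (metis (mono_tags, lifting) single sum sum.cong)
qed

lemma poly_mapping_sum_singles:
  "(\<Sum>k\<in>Poly_Mapping.keys z. Poly_Mapping.single k (Poly_Mapping.lookup z k)) = z"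
  by (intro poly_mapping_eqI) (auto simp: lookup_sum lookup_single when_def in_keys_iff)


section \<open>Elements of the twisted algebras\<close>

abbreviation TX :: "nat \<Rightarrow> twisted_element set" where
  "TX n \<equiv> carrier (twisted_algebra n)"

lemma TX_iff: "a \<in> TX n \<longleftrightarrow> Poly_Mapping.keys a \<subseteq> tensor_monomials n"
  by (simp add: twisted_algebra_simps)

lemma TX_add: "a \<in> TX n \<Longrightarrow> b \<in> TX n \<Longrightarrow> a + b \<in> TX n"
  using keys_add[of a b] by (auto simp: TX_iff)

lemma TX_uminus: "a \<in> TX n \<Longrightarrow> - a \<in> TX n"
  by (simp add: TX_iff)

lemma TX_diff: "a \<in> TX n \<Longrightarrow> b \<in> TX n \<Longrightarrow> a - b \<in> TX n"
  using TX_add[of a n "- b"] TX_uminus[of b n] by simp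

lemma TX_zero [simp]: "0 \<in> TX n"
  and TX_one [simp]: "1 \<in> TX n"
  by (simp_all add: TX_iff tensor_monomials_zero)

lemma TX_of_nat: "of_nat m \<in> TX n"
  by (induction m) (auto intro: TX_add)

lemma coeff_elem_add: "coeff_elem (c + c') = coeff_elem c + coeff_elem c'"
  and coeff_elem_mult: "coeff_elem (c * c') = coeff_elem c * coeff_elem c'"
  and coeff_elem_diff: "coeff_elem (c - c') = coeff_elem c - coeff_elem c'"
  and coeff_elem_uminus: "coeff_elem (- c) = - coeff_elem c"
  and coeff_elem_zero [simp]: "coeff_elem 0 = 0"
  and coeff_elem_one [simp]: "coeff_elem 1 = 1"
  by (simp_all add: coeff_elem_def single_add mult_single single_diff single_uminus)

lemma coeff_elem_sum: "coeff_elem (sum f I) = (\<Sum>i\<in>I. coeff_elem (f i))"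
  by (induction I rule: infinite_finite_induct) (simp_all add: coeff_elem_add)

lemma coeff_elem_of_nat: "coeff_elem (of_nat k) = of_nat k"
  by (induction k) (simp_all add: coeff_elem_add)

lemma coeff_elem_inject: "coeff_elem c = coeff_elem c' \<longleftrightarrow> c = c'"
  by (metis coeff_elem_def lookup_single_eq)

lemma coeff_elem_TX [simp]: "coeff_elem c \<in> TX n"
  by (simp add: coeff_elem_def twisted_carrier_single tensor_monomials_zero)

lemma coeff_elem_commute: "coeff_elem c * z = z * coeff_elem c"
  by (rule additive_eqI[where F = "\<lambda>z. coeff_elem c * z" and G = "\<lambda>z. z * coeff_elem c"])
    (simp_all add: coeff_elem_def mult_single distrib_left distrib_right mult.commute)

lemma coeff_elem_left_commute: "z * (coeff_elem c * w) = coeff_elem c * (z * w)"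
  by (metis coeff_elem_commute mult.assoc)

lemma coeff_elem_mult_single: "coeff_elem c * Poly_Mapping.single t c' = Poly_Mapping.single t (c * c')"
  by (simp add: coeff_elem_def mult_single)

lemma const_tr_add: "const_tr (q + r) = const_tr q + const_tr r"
  and const_tr_mult: "const_tr (q * r) = const_tr q * const_tr r"
  and const_tr_uminus: "const_tr (- q) = - const_tr q"
  and const_tr_diff: "const_tr (q - r) = const_tr q - const_tr r"
  and const_tr_zero [simp]: "const_tr 0 = 0"
  and const_tr_one [simp]: "const_tr 1 = 1"
  by (simp_all add: const_tr_def single_add mult_single single_uminus single_diff)

lemma const_tr_of_nat: "const_tr (of_nat k) = of_nat k"
  by (induction k) (simp_all add: const_tr_add)

abbreviation rat_elem :: "rat \<Rightarrow> twisted_element" where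
  "rat_elem q \<equiv> coeff_elem (const_tr q)"

lemma rat_elem_of_nat: "rat_elem (of_nat k) = of_nat k"
  by (simp add: const_tr_of_nat coeff_elem_of_nat)

definition pos_monomial :: "nat \<Rightarrow> monomial \<Rightarrow> tensor_monomial" where
  "pos_monomial p M = TMon (\<lambda>j. if j = p then M else 0) 1"

lemma perm_elem_one [simp]: "perm_elem 1 = 1"
  by (simp add: perm_elem_def zero_tensor_monomial_def[symmetric])

lemma perm_elem_mult: "perm_elem (\<sigma> * \<tau>) = perm_elem \<sigma> * perm_elem \<tau>"
  by (simp add: perm_elem_def mult_single plus_tensor_monomial_def)

lemma perm_elem_inverse [simp]: "perm_elem \<sigma> * perm_elem (inverse \<sigma>) = 1" "perm_elem (inverse \<sigma>) * perm_elem \<sigma> = 1"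
  by (simp_all flip: perm_elem_mult)

lemma perm_elem_TX: "\<sigma> \<in> sym_group n \<Longrightarrow> perm_elem \<sigma> \<in> TX n"
  by (simp add: perm_elem_def twisted_carrier_single tensor_monomials_def)

lemma sym_group_iff: "\<sigma> \<in> sym_group n \<longleftrightarrow> (\<forall>i\<ge>n. \<sigma> \<langle>$\<rangle> i = i)"
  by (force simp: sym_group_def in_affected not_le[symmetric])

lemma sym_group_mono: "\<sigma> \<in> sym_group m \<Longrightarrow> m \<le> n \<Longrightarrow> \<sigma> \<in> sym_group n"
  by (auto simp: sym_group_iff)

lemma sym_group_less: "\<sigma> \<in> sym_group n \<Longrightarrow> i < n \<Longrightarrow> \<sigma> \<langle>$\<rangle> i < n"
  by (metis sym_group_iff apply_inj not_le)

lemma swap_sym_group: "a < n \<Longrightarrow> b < n \<Longrightarrow> \<langle>a \<leftrightarrow> b\<rangle> \<in> sym_group n"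
  by (simp add: sym_group_iff)

lemma apply_inverse_eq_iff: "inverse \<sigma> \<langle>$\<rangle> i = j \<longleftrightarrow> i = \<sigma> \<langle>$\<rangle> j"
  by (metis apply_one apply_sequence id_apply perm.left_inverse perm.right_inverse)

lemma apply_inverse_apply [simp]: "inverse \<sigma> \<langle>$\<rangle> (\<sigma> \<langle>$\<rangle> i) = i" "\<sigma> \<langle>$\<rangle> (inverse \<sigma> \<langle>$\<rangle> i) = i"
  by (simp_all add: apply_sequence)

lemma tensor_monomials_mono: "m \<le> n \<Longrightarrow> tensor_monomials m \<subseteq> tensor_monomials n"
  by (auto simp: tensor_monomials_def sym_group_iff)

lemma TX_mono: "m \<le> n \<Longrightarrow> a \<in> TX m \<Longrightarrow> a \<in> TX n"
  using tensor_monomials_mono by (force simp: TX_iff)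

section \<open>Elements that leave a strand idle\<close>

definition fixes_pos :: "nat \<Rightarrow> tensor_monomial \<Rightarrow> bool" where
  "fixes_pos p t \<longleftrightarrow> factors t p = 0 \<and> permutation t \<langle>$\<rangle> p = p"

text \<open>Membership in \<open>TX n\<close> means being idle at every strand from \<open>n\<close>
  on, so it can be checked strand by strand. The partial trace over \<open>p\<close> is linear over
  \<open>free_at p\<close> from both sides.\<close>

definition free_at :: "nat \<Rightarrow> twisted_element set" where
  "free_at p = {z. \<forall>t\<in>Poly_Mapping.keys z. fixes_pos p t}"

lemma tensor_monomials_iff: "t \<in> tensor_monomials n \<longleftrightarrow> (\<forall>p\<ge>n. fixes_pos p t)"
  by (auto simp: tensor_monomials_def sym_group_iff fixes_pos_def)

lemma TX_iff_free_at: "z \<in> TX n \<longleftrightarrow> (\<forall>p\<ge>n. z \<in> free_at p)"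
  by (auto simp: TX_iff free_at_def tensor_monomials_iff)

lemma fixes_pos_plus: "fixes_pos p s \<Longrightarrow> fixes_pos p t \<Longrightarrow> fixes_pos p (s + t)"
  by (auto simp: fixes_pos_def plus_tensor_monomial_def apply_times)
    (metis add.right_neutral apply_inverse_apply(1))

lemma free_at_mult: "a \<in> free_at p \<Longrightarrow> b \<in> free_at p \<Longrightarrow> a * b \<in> free_at p"
  using keys_mult[of a b] by (fastforce simp: free_at_def intro: fixes_pos_plus)

lemma free_at_add: "a \<in> free_at p \<Longrightarrow> b \<in> free_at p \<Longrightarrow> a + b \<in> free_at p"
  using keys_add[of a b] by (auto simp: free_at_def)

lemma free_at_zero: "0 \<in> free_at p"
  by (simp add: free_at_def)

lemma free_at_sum: "(\<And>i. i \<in> I \<Longrightarrow> f i \<in> free_at p) \<Longrightarrow> sum f I \<in> free_at p"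
  by (induction I rule: infinite_finite_induct) (simp_all add: free_at_add free_at_zero)

lemma free_at_single: "fixes_pos p t \<Longrightarrow> Poly_Mapping.single t c \<in> free_at p"
  by (simp add: free_at_def)

lemma free_at_perm: "\<sigma> \<langle>$\<rangle> p = p \<Longrightarrow> perm_elem \<sigma> \<in> free_at p"
  by (simp add: perm_elem_def free_at_single fixes_pos_def)

lemma free_at_coeff [simp]: "coeff_elem c \<in> free_at p"
  by (simp add: coeff_elem_def free_at_single fixes_pos_def zero_tensor_monomial_def)

definition pos_elem :: "nat \<Rightarrow> monomial \<Rightarrow> twisted_element" where
  "pos_elem p M = Poly_Mapping.single (pos_monomial p M) 1"

lemma free_at_pos: "p \<noteq> q \<Longrightarrow> pos_elem p M \<in> free_at q"
  by (simp add: pos_elem_def free_at_single fixes_pos_def pos_monomial_def)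

lemma pos_elem_TX: "p < n \<Longrightarrow> pos_elem p M \<in> TX n"
  by (simp add: TX_iff_free_at free_at_pos)

lemma pos_elem_plus: "pos_elem p (M + N) = pos_elem p M * pos_elem p N"
  by (auto simp: pos_elem_def pos_monomial_def mult_single plus_tensor_monomial_def
      intro!: arg_cong[where f = "\<lambda>u. Poly_Mapping.single (TMon u 1) 1"])

lemma pos_elem_zero [simp]: "pos_elem p 0 = 1"
  by (simp add: pos_elem_def pos_monomial_def zero_tensor_monomial_def[symmetric])

lemma perm_elem_pos_elem: "perm_elem \<sigma> * pos_elem p M = pos_elem (\<sigma> \<langle>$\<rangle> p) M * perm_elem \<sigma>"
  by (simp add: pos_elem_def pos_monomial_def perm_elem_def mult_single plus_tensor_monomial_def
      apply_inverse_eq_iff fun_eq_iff)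

lemma pos_elem_commute_free_at:
  assumes "z \<in> free_at p"
  shows "pos_elem p M * z = z * pos_elem p M"
proof (rule additive_eqI[where F = "\<lambda>z. pos_elem p M * z" and G = "\<lambda>z. z * pos_elem p M"])
  fix t c assume "t \<in> Poly_Mapping.keys z"
  then have t: "fixes_pos p t" using assms by (simp add: free_at_def)
  have "pos_monomial p M + t = t + pos_monomial p M"
    using t by (auto simp: pos_monomial_def plus_tensor_monomial_def fixes_pos_def
        apply_inverse_eq_iff fun_eq_iff)
  then show "pos_elem p M * Poly_Mapping.single t c = Poly_Mapping.single t c * pos_elem p M"
    by (simp add: pos_elem_def mult_single mult.commute)
qed (simp_all add: distrib_left distrib_right)

lemma factor_elem_add: "factor_elem i (a + b) = factor_elem i a + factor_elem i b"
  unfolding factor_elem_def by (rule setsum_keys_plus_distrib) (simp_all add: single_add)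

lemma factor_elem_single: "factor_elem i (Poly_Mapping.single M c) = coeff_elem c * pos_elem i M"
  by (simp add: factor_elem_def pos_elem_def pos_monomial_def coeff_elem_mult_single)

lemma factor_elem_coeff: "factor_elem i (Poly_Mapping.single 0 c) = coeff_elem c"
  by (simp add: factor_elem_single)

lemma factor_elem_zero [simp]: "factor_elem i 0 = 0"
  by (simp add: factor_elem_def)

lemma factor_elem_mult: "factor_elem i (a * b) = factor_elem i a * factor_elem i b"
proof -
  have *: "factor_elem i (Poly_Mapping.single M c * b) = factor_elem i (Poly_Mapping.single M c) * factor_elem i b"
    for M c
    by (rule additive_eqI[where F = "\<lambda>b. factor_elem i (Poly_Mapping.single M c * b)"])
      (simp_all add: factor_elem_add distrib_left mult_single factor_elem_single pos_elem_plus
        coeff_elem_mult mult.assoc coeff_elem_left_commute[of "pos_elem i M"])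
  show ?thesis
    by (rule additive_eqI[where F = "\<lambda>a. factor_elem i (a * b)" and G = "\<lambda>a. factor_elem i a * factor_elem i b"])
      (simp_all only: factor_elem_add distrib_right *)
qed

lemma factor_elem_one [simp]: "factor_elem i 1 = 1"
  using factor_elem_coeff[of i 1] by simp

lemma factor_elem_power: "factor_elem i (a ^ k) = factor_elem i a ^ k"
  by (induction k) (simp_all add: factor_elem_mult)

lemma factor_elem_commute_free_at:
  assumes "z \<in> free_at p"
  shows "factor_elem p a * z = z * factor_elem p a"
  by (rule additive_eqI[where F = "\<lambda>a. factor_elem p a * z"])
    (simp_all add: factor_elem_add factor_elem_single distrib_left distrib_right
      pos_elem_commute_free_at[OF assms] mult.assoc coeff_elem_left_commute[of z])

lemma free_at_factor: "p \<noteq> q \<Longrightarrow> factor_elem p a \<in> free_at q"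
  unfolding factor_elem_def
  by (intro free_at_sum free_at_single) (simp add: fixes_pos_def)

lemma factor_elem_TX: "p < n \<Longrightarrow> factor_elem p a \<in> TX n"
  by (simp add: TX_iff_free_at free_at_factor)

lemma perm_elem_factor_elem: "perm_elem \<sigma> * factor_elem p a = factor_elem (\<sigma> \<langle>$\<rangle> p) a * perm_elem \<sigma>"
  by (rule additive_eqI[where F = "\<lambda>a. perm_elem \<sigma> * factor_elem p a"])
    (simp_all add: factor_elem_add factor_elem_single distrib_left distrib_right
      coeff_elem_left_commute[of "perm_elem \<sigma>"] perm_elem_pos_elem mult.assoc)

section \<open>Partial traces\<close>

lemma tensor_monomial_eqI:
  "(\<And>i. factors s i = factors t i) \<Longrightarrow> (\<And>i. permutation s \<langle>$\<rangle> i = permutation t \<langle>$\<rangle> i) \<Longrightarrow> s = t"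
  by (simp add: tensor_monomial.expand perm_eq_iff fun_eq_iff)

lemma factors_plus: "factors (s + t) i = factors s i + factors t (inverse (permutation s) \<langle>$\<rangle> i)"
  and permutation_plus: "permutation (s + t) = permutation s * permutation t"
  by (simp_all add: plus_tensor_monomial_def)

lemma apply_swap: "\<langle>a \<leftrightarrow> b\<rangle> \<langle>$\<rangle> i = (if i = a then b else if i = b then a else i)"
  by (metis apply_swap_same apply_swap_simp)

text \<open>A strand fixed by the permutation closes to a loop and yields a trace; otherwise its two
  ends belong to a longer strand and no scalar arises.\<close>

definition ptr_coeff :: "nat \<Rightarrow> tensor_monomial \<Rightarrow> trace_ring" where
  "ptr_coeff p t = (if permutation t \<langle>$\<rangle> p = p then tr_monomial (factors t p) else 1)"

text \<open>
  Joining output and input of strand \<open>p\<close>: if \<open>\<sigma>\<close> moves \<open>p\<close>, the monomial on \<open>p\<close> is read after the one on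
  \<open>\<sigma>(p)\<close>; position \<open>p\<close> itself is left behind as an idle strand.
\<close>

definition ptr_mon :: "nat \<Rightarrow> tensor_monomial \<Rightarrow> tensor_monomial" where
  "ptr_mon p t = TMon
     (\<lambda>i. if i = p then 0 else if i = permutation t \<langle>$\<rangle> p then factors t i + factors t p else factors t i)
     (\<langle>p \<leftrightarrow> permutation t \<langle>$\<rangle> p\<rangle> * permutation t)"

definition partial_trace :: "nat \<Rightarrow> twisted_element \<Rightarrow> twisted_element" where
  "partial_trace p z = (\<Sum>t\<in>Poly_Mapping.keys z.
     Poly_Mapping.single (ptr_mon p t) (Poly_Mapping.lookup z t * ptr_coeff p t))"

lemma factors_ptr_mon: "factors (ptr_mon p t) i =
    (if i = p then 0 else if i = permutation t \<langle>$\<rangle> p then factors t i + factors t p else factors t i)"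
  by (simp add: ptr_mon_def)

lemma permutation_ptr_mon: "permutation (ptr_mon p t) \<langle>$\<rangle> i =
    (if i = p then p else if permutation t \<langle>$\<rangle> i = p then permutation t \<langle>$\<rangle> p else permutation t \<langle>$\<rangle> i)"
  by (auto simp: ptr_mon_def apply_times apply_swap apply_inj)

lemma inverse_permutation_ptr_mon: "inverse (permutation (ptr_mon p t)) \<langle>$\<rangle> i =
    (if i = p then p else if i = permutation t \<langle>$\<rangle> p then inverse (permutation t) \<langle>$\<rangle> p
     else inverse (permutation t) \<langle>$\<rangle> i)"
  by (auto simp: apply_inverse_eq_iff permutation_ptr_mon)

lemmas ptr_mon_simps = factors_ptr_mon permutation_ptr_mon inverse_permutation_ptr_mon

lemma tr_monomial_commute: "tr_monomial (M + N) = tr_monomial (N + M)"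
proof -
  have "cyc_equiv (M + N) (N + M)" by (auto simp: cyc_equiv_def)
  then have "abs_cyc_monomial (M + N) = abs_cyc_monomial (N + M)"
    by (simp only: cyc_monomial.abs_eq_iff)
  then show ?thesis by (simp add: tr_monomial_def)
qed

lemma partial_trace_add: "partial_trace p (a + b) = partial_trace p a + partial_trace p b"
  unfolding partial_trace_def
  by (rule setsum_keys_plus_distrib) (simp_all add: distrib_right single_add)

lemma partial_trace_zero [simp]: "partial_trace p 0 = 0"
  by (simp add: partial_trace_def)

lemma partial_trace_uminus: "partial_trace p (- a) = - partial_trace p a"
  using partial_trace_add[of p a "- a"] by (simp add: eq_neg_iff_add_eq_0 add.commute)

lemma partial_trace_diff: "partial_trace p (a - b) = partial_trace p a - partial_trace p b"
  using partial_trace_add[of p a "- b"] by (simp add: partial_trace_uminus)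

lemma partial_trace_sum: "partial_trace p (sum f I) = (\<Sum>i\<in>I. partial_trace p (f i))"
  by (induction I rule: infinite_finite_induct) (simp_all add: partial_trace_add)

lemma partial_trace_single: "partial_trace p (Poly_Mapping.single t c) =
    Poly_Mapping.single (ptr_mon p t) (c * ptr_coeff p t)"
  by (simp add: partial_trace_def)

lemma ptr_mon_left:
  assumes "fixes_pos p s"
  shows "ptr_mon p (s + t) = s + ptr_mon p t" "ptr_coeff p (s + t) = ptr_coeff p t"
proof -
  have s: "factors s p = 0" "permutation s \<langle>$\<rangle> p = p" "inverse (permutation s) \<langle>$\<rangle> p = p"
    using assms by (auto simp: fixes_pos_def apply_inverse_eq_iff)
  have eq: "permutation s \<langle>$\<rangle> i = p \<longleftrightarrow> i = p" for i
    using s(2) by (metis apply_inj)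
  show "ptr_mon p (s + t) = s + ptr_mon p t"
    by (rule tensor_monomial_eqI)
      (auto simp: ptr_mon_simps factors_plus permutation_plus apply_times s add.assoc
        apply_inverse_eq_iff apply_inj eq)
  show "ptr_coeff p (s + t) = ptr_coeff p t"
    by (auto simp: ptr_coeff_def factors_plus permutation_plus apply_times s eq)
qed

lemma ptr_mon_right:
  assumes "fixes_pos p t"
  shows "ptr_mon p (s + t) = ptr_mon p s + t" "ptr_coeff p (s + t) = ptr_coeff p s"
proof -
  have t: "factors t p = 0" "permutation t \<langle>$\<rangle> p = p"
    using assms by (auto simp: fixes_pos_def)
  have eq: "permutation t \<langle>$\<rangle> i = p \<longleftrightarrow> i = p" for i
    using t(2) by (metis apply_inj)
  have inv: "permutation s \<langle>$\<rangle> p = p \<Longrightarrow> inverse (permutation s) \<langle>$\<rangle> p = p"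
    by (simp add: apply_inverse_eq_iff)
  show "ptr_mon p (s + t) = ptr_mon p s + t"
    by (rule tensor_monomial_eqI)
      (auto simp: ptr_mon_simps factors_plus permutation_plus apply_times t add.assoc eq inv)
  show "ptr_coeff p (s + t) = ptr_coeff p s"
    by (auto simp: ptr_coeff_def factors_plus permutation_plus apply_times t inv)
qed

lemma partial_trace_left:
  assumes "a \<in> free_at p"
  shows "partial_trace p (a * b) = a * partial_trace p b"
proof -
  have *: "partial_trace p (Poly_Mapping.single s c * b) = Poly_Mapping.single s c * partial_trace p b"
    if "fixes_pos p s" for s c
    by (rule additive_eqI[where F = "\<lambda>b. partial_trace p (Poly_Mapping.single s c * b)"
          and G = "\<lambda>b. Poly_Mapping.single s c * partial_trace p b"])
      (simp_all add: partial_trace_add distrib_left mult_single partial_trace_single ptr_mon_left that mult.assoc)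
  show ?thesis
    by (rule additive_eqI[where F = "\<lambda>a. partial_trace p (a * b)" and G = "\<lambda>a. a * partial_trace p b"])
      (use assms in \<open>simp_all add: partial_trace_add distrib_right * free_at_def\<close>)
qed

lemma partial_trace_right:
  assumes "b \<in> free_at p"
  shows "partial_trace p (a * b) = partial_trace p a * b"
proof -
  have *: "partial_trace p (a * Poly_Mapping.single t c) = partial_trace p a * Poly_Mapping.single t c"
    if "fixes_pos p t" for t c
    by (rule additive_eqI[where F = "\<lambda>a. partial_trace p (a * Poly_Mapping.single t c)"
          and G = "\<lambda>a. partial_trace p a * Poly_Mapping.single t c"])
      (simp_all add: partial_trace_add distrib_right mult_single partial_trace_single ptr_mon_right that mult_ac)
  show ?thesis
    by (rule additive_eqI[where F = "\<lambda>b. partial_trace p (a * b)" and G = "\<lambda>b. partial_trace p a * b"])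
      (use assms in \<open>simp_all add: partial_trace_add distrib_left * free_at_def\<close>)
qed

lemma partial_trace_coeff: "partial_trace p (coeff_elem c * z) = coeff_elem c * partial_trace p z"
  by (simp add: partial_trace_left)

text \<open>If the permutation \<sigma> of a monomial moves \<open>p\<close>, both sides insert
  \<open>M\<close> between the monomials at \<sigma>(p) and at p. If it fixes \<open>p\<close>, the
  loop is read from two starting points, which is where cyclic equivalence of monomials is
  used.\<close>

lemma partial_trace_pos_commute: "partial_trace p (pos_elem p M * z) = partial_trace p (z * pos_elem p M)"
proof -
  have "ptr_mon p (pos_monomial p M + t) = ptr_mon p (t + pos_monomial p M)"
    "ptr_coeff p (pos_monomial p M + t) = ptr_coeff p (t + pos_monomial p M)" for t
  proof -
    have [simp]: "permutation (pos_monomial p M) = 1" "inverse (1 :: nat perm) = 1"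
      "factors (pos_monomial p M) i = (if i = p then M else 0)" for i
      by (simp_all add: pos_monomial_def)
    show "ptr_mon p (pos_monomial p M + t) = ptr_mon p (t + pos_monomial p M)"
      by (rule tensor_monomial_eqI)
        (auto simp: ptr_mon_simps factors_plus permutation_plus apply_times add.assoc apply_inverse_eq_iff)
    show "ptr_coeff p (pos_monomial p M + t) = ptr_coeff p (t + pos_monomial p M)"
      by (auto simp: ptr_coeff_def factors_plus permutation_plus apply_times apply_inverse_eq_iff
          tr_monomial_commute)
  qed
  note mon = this
  show ?thesis
    by (rule additive_eqI[where F = "\<lambda>z. partial_trace p (pos_elem p M * z)"
          and G = "\<lambda>z. partial_trace p (z * pos_elem p M)"])
      (simp_all add: mon partial_trace_add distrib_left distrib_right pos_elem_def mult_single partial_trace_single)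
qed

text \<open>Conjugation by \<open>\<pi>\<close> renames the strands, so that closing one strand can
  be traded for closing another.\<close>

lemma partial_trace_conjugate:
  "partial_trace (\<pi> \<langle>$\<rangle> p) (perm_elem \<pi> * z * perm_elem (inverse \<pi>)) =
   perm_elem \<pi> * partial_trace p z * perm_elem (inverse \<pi>)"
proof -
  let ?c = "\<lambda>t. TMon (\<lambda>_. 0) \<pi> + t + TMon (\<lambda>_. 0) (inverse \<pi>)"
  have mon: "ptr_mon (\<pi> \<langle>$\<rangle> p) (?c t) = ?c (ptr_mon p t)"
    and coeff: "ptr_coeff (\<pi> \<langle>$\<rangle> p) (?c t) = ptr_coeff p t" for t
  proof -
    have inv: "\<pi> \<langle>$\<rangle> (inverse \<pi> \<langle>$\<rangle> i) = i" for i by simp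
    have *: "inverse \<pi> \<langle>$\<rangle> i = j \<longleftrightarrow> i = \<pi> \<langle>$\<rangle> j" for i j by (rule apply_inverse_eq_iff)
    show "ptr_mon (\<pi> \<langle>$\<rangle> p) (?c t) = ?c (ptr_mon p t)"
    proof (rule tensor_monomial_eqI)
      fix i
      obtain j where i: "i = \<pi> \<langle>$\<rangle> j" using inv by metis
      show "factors (ptr_mon (\<pi> \<langle>$\<rangle> p) (?c t)) i = factors (?c (ptr_mon p t)) i"
        by (simp add: i ptr_mon_simps factors_plus permutation_plus apply_times apply_inj)
      show "permutation (ptr_mon (\<pi> \<langle>$\<rangle> p) (?c t)) \<langle>$\<rangle> i = permutation (?c (ptr_mon p t)) \<langle>$\<rangle> i"
        by (simp add: i ptr_mon_simps factors_plus permutation_plus apply_times apply_inj)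
    qed
    show "ptr_coeff (\<pi> \<langle>$\<rangle> p) (?c t) = ptr_coeff p t"
      by (simp add: ptr_coeff_def factors_plus permutation_plus apply_times apply_inj)
  qed
  show ?thesis
    by (rule additive_eqI[where F = "\<lambda>z. partial_trace (\<pi> \<langle>$\<rangle> p) (perm_elem \<pi> * z * perm_elem (inverse \<pi>))"
          and G = "\<lambda>z. perm_elem \<pi> * partial_trace p z * perm_elem (inverse \<pi>)"])
      (simp_all add: partial_trace_add distrib_left distrib_right perm_elem_def mult_single
        partial_trace_single mon coeff)
qed

text \<open>The delicate case is a permutation exchanging \<open>p\<close> and \<open>q\<close>:
  closing one of them leaves a loop at the other, and the two orders read this loop from different
  starting points.\<close>

lemma partial_trace_commute: "partial_trace p (partial_trace q z) = partial_trace q (partial_trace p z)"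
proof (cases "p = q")
  case False
  have mon: "ptr_mon p (ptr_mon q t) = ptr_mon q (ptr_mon p t)" for t
  proof (rule tensor_monomial_eqI)
    fix i
    show "factors (ptr_mon p (ptr_mon q t)) i = factors (ptr_mon q (ptr_mon p t)) i"
      using False by (simp add: ptr_mon_simps add.assoc) (metis apply_inj)
    show "permutation (ptr_mon p (ptr_mon q t)) \<langle>$\<rangle> i = permutation (ptr_mon q (ptr_mon p t)) \<langle>$\<rangle> i"
      using False by (simp add: ptr_mon_simps) (metis apply_inj)
  qed
  have coeff: "ptr_coeff q t * ptr_coeff p (ptr_mon q t) = ptr_coeff p t * ptr_coeff q (ptr_mon p t)" for t
    using False
    by (auto simp: ptr_coeff_def ptr_mon_simps tr_monomial_commute mult.commute apply_inj)
  show ?thesis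
    by (rule additive_eqI[where F = "\<lambda>z. partial_trace p (partial_trace q z)"
          and G = "\<lambda>z. partial_trace q (partial_trace p z)"])
      (simp_all add: partial_trace_add partial_trace_single mon mult.assoc coeff)
qed simp

lemma free_at_partial_trace:
  assumes "z \<in> free_at q \<or> p = q"
  shows "partial_trace p z \<in> free_at q"
  unfolding partial_trace_def
proof (intro free_at_sum free_at_single)
  fix t assume "t \<in> Poly_Mapping.keys z"
  with assms have "fixes_pos q t \<or> p = q" by (auto simp: free_at_def)
  then show "fixes_pos q (ptr_mon p t)"
    by (auto simp: fixes_pos_def ptr_mon_simps) (metis apply_inj)+
qed

lemma partial_trace_TX: "z \<in> TX (Suc n) \<Longrightarrow> partial_trace n z \<in> TX n"
  unfolding TX_iff_free_at by (metis free_at_partial_trace le_neq_implies_less less_eq_Suc_le)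

section \<open>Partial traces of elements on a single strand\<close>

definition trace_coeff :: "free_trace_algebra \<Rightarrow> trace_ring" where
  "trace_coeff a = (\<Sum>M\<in>Poly_Mapping.keys a. Poly_Mapping.lookup a M * tr_monomial M)"

lemma formal_trace_eq: "formal_trace a = Poly_Mapping.single 0 (trace_coeff a)"
  by (simp add: formal_trace_def trace_coeff_def)

lemma trace_coeff_add: "trace_coeff (a + b) = trace_coeff a + trace_coeff b"
  unfolding trace_coeff_def by (rule setsum_keys_plus_distrib) (simp_all add: distrib_right)

lemma trace_coeff_single: "trace_coeff (Poly_Mapping.single M c) = c * tr_monomial M"
  by (simp add: trace_coeff_def)

lemma partial_trace_pos_elem: "partial_trace p (pos_elem p M) = coeff_elem (tr_monomial M)"
proof -
  have "ptr_mon p (pos_monomial p M) = 0" "ptr_coeff p (pos_monomial p M) = tr_monomial M"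
    by (auto simp: pos_monomial_def ptr_mon_def ptr_coeff_def zero_tensor_monomial_def)
  then show ?thesis by (simp add: pos_elem_def partial_trace_single coeff_elem_def)
qed

lemma partial_trace_factor: "partial_trace p (factor_elem p a) = coeff_elem (trace_coeff a)"
  by (rule additive_eqI[where F = "\<lambda>a. partial_trace p (factor_elem p a)"])
    (simp_all add: factor_elem_add partial_trace_add trace_coeff_add coeff_elem_add factor_elem_single
      partial_trace_coeff partial_trace_pos_elem trace_coeff_single coeff_elem_mult)

text \<open>After the transposition, strand \<open>p\<close> is a detour of strand \<open>r\<close>,
  so closing it carries the monomial from \<open>p\<close> over to \<open>r\<close>.\<close>

lemma partial_trace_pos_swap:
  assumes "p \<noteq> r"
  shows "partial_trace p (pos_elem p M * perm_elem \<langle>r \<leftrightarrow> p\<rangle>) = pos_elem r M"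
proof -
  have "ptr_mon p (pos_monomial p M + TMon (\<lambda>_. 0) \<langle>r \<leftrightarrow> p\<rangle>) = pos_monomial r M"
    using assms
    by (intro tensor_monomial_eqI)
     (auto simp: pos_monomial_def ptr_mon_simps factors_plus permutation_plus apply_times apply_swap)
  moreover have "ptr_coeff p (pos_monomial p M + TMon (\<lambda>_. 0) \<langle>r \<leftrightarrow> p\<rangle>) = 1"
    using assms by (auto simp: pos_monomial_def ptr_coeff_def permutation_plus apply_times apply_swap)
  ultimately show ?thesis
    by (simp add: pos_elem_def perm_elem_def mult_single partial_trace_single)
qed

lemma partial_trace_factor_swap:
  assumes "p \<noteq> r"
  shows "partial_trace p (factor_elem p a * perm_elem \<langle>r \<leftrightarrow> p\<rangle>) = factor_elem r a"
  by (rule additive_eqI[where F = "\<lambda>a. partial_trace p (factor_elem p a * perm_elem \<langle>r \<leftrightarrow> p\<rangle>)"])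
    (simp_all add: factor_elem_add partial_trace_add factor_elem_single distrib_right mult.assoc
      partial_trace_coeff partial_trace_pos_swap[OF assms])

section \<open>Evaluations\<close>

definition assignment :: "nat \<Rightarrow> (nat \<Rightarrow> rat mat) \<Rightarrow> bool" where
  "assignment d A \<longleftrightarrow> (\<forall>i. A i \<in> carrier_mat d d)"

lemma eval_trace_ring_add: "eval_trace_ring d A (c + c') = eval_trace_ring d A c + eval_trace_ring d A c'"
  unfolding eval_trace_ring_def by (rule setsum_keys_plus_distrib) (simp_all add: distrib_right)

lemma eval_trace_ring_single:
  "eval_trace_ring d A (Poly_Mapping.single m q) = q * prod_mset (image_mset (eval_cyc d A) m)"
  by (simp add: eval_trace_ring_def)

lemma eval_trace_ring_zero [simp]: "eval_trace_ring d A 0 = 0"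
  by (simp add: eval_trace_ring_def)

lemma eval_const_tr [simp]: "eval_trace_ring d A (const_tr q) = q"
  by (simp add: const_tr_def eval_trace_ring_single)

lemma eval_trace_ring_one [simp]: "eval_trace_ring d A 1 = 1"
  using eval_const_tr[of d A 1] by simp

lemma eval_trace_ring_mult: "eval_trace_ring d A (c * c') = eval_trace_ring d A c * eval_trace_ring d A c'"
proof -
  have *: "eval_trace_ring d A (Poly_Mapping.single m q * c') =
      eval_trace_ring d A (Poly_Mapping.single m q) * eval_trace_ring d A c'" for m q
    by (rule additive_eqI[where F = "\<lambda>c'. eval_trace_ring d A (Poly_Mapping.single m q * c')"
          and G = "\<lambda>c'. eval_trace_ring d A (Poly_Mapping.single m q) * eval_trace_ring d A c'"])
      (simp_all add: eval_trace_ring_add distrib_left mult_single eval_trace_ring_single)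
  show ?thesis
    by (rule additive_eqI[where F = "\<lambda>c. eval_trace_ring d A (c * c')"
          and G = "\<lambda>c. eval_trace_ring d A c * eval_trace_ring d A c'"])
      (simp_all only: eval_trace_ring_add distrib_right *)
qed

lemma eval_trace_ring_uminus: "eval_trace_ring d A (- c) = - eval_trace_ring d A c"
  using eval_trace_ring_add[of d A c "- c"] by simp

lemma eval_tr_monomial:
  "assignment d A \<Longrightarrow> eval_trace_ring d A (tr_monomial M) = mat_trace (eval_monomial d A M)"
  by (simp add: tr_monomial_def eval_trace_ring_single eval_cyc_abs assignment_def)

lemma assignment_eval_carrier: "assignment d A \<Longrightarrow> eval_monomial d A M \<in> carrier_mat d d"
  by (simp add: assignment_def eval_monomial_carrier)

lemma assignment_eval_plus: "assignment d A \<Longrightarrow> eval_monomial d A (M + N) = eval_monomial d A M * eval_monomial d A N"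
  by (simp add: assignment_def eval_monomial_plus)

lemma eval_monomial_zero [simp]: "eval_monomial d A 0 = 1\<^sub>m d"
  by (simp add: eval_monomial_def zero_monomial_def)

lemma mat_mult_entry:
  "B \<in> carrier_mat d d \<Longrightarrow> C \<in> carrier_mat d d \<Longrightarrow> i < d \<Longrightarrow> j < d \<Longrightarrow>
   (B * C) $$ (i, j) = (\<Sum>k<d. B $$ (i, k) * (C $$ (k, j) :: rat))"
  by (auto simp: scalar_prod_def atLeast0LessThan intro!: sum.cong)

lemma eval_monomial_plus_entry:
  "assignment d A \<Longrightarrow> i < d \<Longrightarrow> j < d \<Longrightarrow>
   eval_monomial d A (M + N) $$ (i, j) = (\<Sum>k<d. eval_monomial d A M $$ (i, k) * eval_monomial d A N $$ (k, j))"
  by (simp add: assignment_eval_plus mat_mult_entry[OF assignment_eval_carrier assignment_eval_carrier])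

lemma mat_trace_carrier: "B \<in> carrier_mat d d \<Longrightarrow> mat_trace B = (\<Sum>i<d. B $$ (i, i))"
  by (auto simp: mat_trace_def)

text \<open>A matrix entry with the sum over the intermediate multi-index already carried out: the
  permutation operator leaves only the index J composed with \<sigma>^-1.\<close>

definition ev_mon :: "nat \<Rightarrow> nat \<Rightarrow> (nat \<Rightarrow> rat mat) \<Rightarrow> tensor_monomial \<Rightarrow> tensor_operator" where
  "ev_mon d n A t I J =
     (\<Prod>i<n. eval_monomial d A (factors t i) $$ (I i, J (inverse (permutation t) \<langle>$\<rangle> i)))"

definition ev :: "nat \<Rightarrow> nat \<Rightarrow> (nat \<Rightarrow> rat mat) \<Rightarrow> twisted_element \<Rightarrow> tensor_operator" where
  "ev d n A z I J =
     (\<Sum>t\<in>Poly_Mapping.keys z. eval_trace_ring d A (Poly_Mapping.lookup z t) * ev_mon d n A t I J)"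

lemma multi_indices_less: "I \<in> multi_indices d n \<Longrightarrow> i < n \<Longrightarrow> I i < d"
  by (auto simp: multi_indices_def)

lemma multi_indices_perm:
  assumes "J \<in> multi_indices d n" "\<sigma> \<in> sym_group n"
  shows "(\<lambda>i. J (\<sigma> \<langle>$\<rangle> i)) \<in> multi_indices d n"
  using assms sym_group_less[OF assms(2)]
  by (auto simp: multi_indices_def PiE_def extensional_def sym_group_iff)

lemma multi_indices_update:
  "I \<in> multi_indices d n \<Longrightarrow> k < d \<Longrightarrow> m < n \<Longrightarrow> I(m := k) \<in> multi_indices d n"
  by (auto simp: multi_indices_def PiE_def extensional_def)

lemma multi_indices_extend:
  "I \<in> multi_indices d n \<Longrightarrow> k < d \<Longrightarrow> I(n := k) \<in> multi_indices d (Suc n)"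
  by (auto simp: multi_indices_def PiE_def extensional_def less_Suc_eq)

lemma finite_multi_indices [simp]: "finite (multi_indices d n)"
  by (simp add: multi_indices_def finite_PiE)

lemma inverse_less: "t \<in> tensor_monomials n \<Longrightarrow> i < n \<Longrightarrow> inverse (permutation t) \<langle>$\<rangle> i < n"
  by (simp add: tensor_monomials_def sym_group_less sym_group_inverse)

lemma evaluation_eq_ev:
  assumes a: "a \<in> TX n" and I: "I \<in> multi_indices d n" and J: "J \<in> multi_indices d n"
  shows "evaluation d n A a I J = ev d n A a I J"
  unfolding evaluation_def ev_def
proof (rule sum.cong)
  fix t assume "t \<in> Poly_Mapping.keys a"
  with a have t: "inverse (permutation t) \<in> sym_group n"
    by (auto simp: TX_iff tensor_monomials_def sym_group_inverse)
  let ?J = "\<lambda>i. J (inverse (permutation t) \<langle>$\<rangle> i)"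
  have "operator_mult d n (pure_tensor_operator n (\<lambda>i. eval_monomial d A (factors t i)))
      (perm_operator (permutation t)) I J =
    (\<Sum>K\<in>multi_indices d n. if K = ?J then pure_tensor_operator n (\<lambda>i. eval_monomial d A (factors t i)) I K else 0)"
    unfolding operator_mult_def perm_operator_def by (intro sum.cong) auto
  also have "\<dots> = ev_mon d n A t I J"
    using multi_indices_perm[OF J t] by (simp add: ev_mon_def pure_tensor_operator_def)
  finally show "eval_trace_ring d A (Poly_Mapping.lookup a t) *
      operator_mult d n (pure_tensor_operator n (\<lambda>i. eval_monomial d A (factors t i)))
        (perm_operator (permutation t)) I J =
      eval_trace_ring d A (Poly_Mapping.lookup a t) * ev_mon d n A t I J"
    by simp
qed simp

lemma tensor_identities_iff:
  "a \<in> tensor_identities d n \<longleftrightarrow> a \<in> TX n \<and>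
     (\<forall>A I J. assignment d A \<longrightarrow> I \<in> multi_indices d n \<longrightarrow> J \<in> multi_indices d n \<longrightarrow> ev d n A a I J = 0)"
  unfolding tensor_identities_def assignment_def by (auto simp: evaluation_eq_ev)

lemma ev_add: "ev d n A (a + b) I J = ev d n A a I J + ev d n A b I J"
  unfolding ev_def by (rule setsum_keys_plus_distrib) (simp_all add: eval_trace_ring_add distrib_right)

lemma ev_zero [simp]: "ev d n A 0 I J = 0"
  by (simp add: ev_def)

lemma ev_uminus: "ev d n A (- a) I J = - ev d n A a I J"
  using ev_add[of d n A a "- a" I J] by simp

lemma ev_diff: "ev d n A (a - b) I J = ev d n A a I J - ev d n A b I J"
  using ev_add[of d n A a "- b" I J] by (simp add: ev_uminus)

lemma ev_sum: "ev d n A (sum f K) I J = (\<Sum>i\<in>K. ev d n A (f i) I J)"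
  by (induction K rule: infinite_finite_induct) (simp_all add: ev_add)

lemma ev_single: "ev d n A (Poly_Mapping.single t c) I J = eval_trace_ring d A c * ev_mon d n A t I J"
  by (simp add: ev_def)

lemma ev_coeff_mult: "ev d n A (coeff_elem c * z) I J = eval_trace_ring d A c * ev d n A z I J"
  by (rule additive_eqI[where F = "\<lambda>z. ev d n A (coeff_elem c * z) I J"])
    (simp_all add: ev_add distrib_left coeff_elem_mult_single ev_single eval_trace_ring_mult)

lemma ev_mon_plus:
  assumes A: "assignment d A" and s: "s \<in> tensor_monomials n" and t: "t \<in> tensor_monomials n"
    and I: "I \<in> multi_indices d n" and K: "K \<in> multi_indices d n"
  shows "ev_mon d n A (s + t) I K = (\<Sum>J\<in>multi_indices d n. ev_mon d n A s I J * ev_mon d n A t J K)"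
proof -
  let ?\<sigma> = "permutation s" and ?\<tau> = "permutation t"
  let ?E = "\<lambda>M. eval_monomial d A M"
  have \<sigma>: "?\<sigma> \<in> sym_group n" "inverse ?\<sigma> \<in> sym_group n"
    using s by (auto simp: tensor_monomials_def sym_group_inverse)
  have "ev_mon d n A (s + t) I K = (\<Prod>i<n. \<Sum>j<d. ?E (factors s i) $$ (I i, j) *
      ?E (factors t (inverse ?\<sigma> \<langle>$\<rangle> i)) $$ (j, K (inverse ?\<tau> \<langle>$\<rangle> (inverse ?\<sigma> \<langle>$\<rangle> i))))"
    unfolding ev_mon_def
    by (intro prod.cong)
      (auto simp: factors_plus permutation_plus apply_times multi_indices_less[OF I]
        intro!: eval_monomial_plus_entry[OF A] multi_indices_less[OF K] inverse_less[OF t] inverse_less[OF s])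
  also have "\<dots> = (\<Sum>J\<in>multi_indices d n. \<Prod>i<n. ?E (factors s i) $$ (I i, J i) *
      ?E (factors t (inverse ?\<sigma> \<langle>$\<rangle> i)) $$ (J i, K (inverse ?\<tau> \<langle>$\<rangle> (inverse ?\<sigma> \<langle>$\<rangle> i))))"
    unfolding multi_indices_def by (rule prod_sum_PiE) auto
  also have "\<dots> = (\<Sum>J\<in>multi_indices d n. ev_mon d n A s I J * ev_mon d n A t J K)"
  \<comment> \<open>The entry of \<open>s\<close> uses the value of the middle index at
    \<sigma>^-1(i) in position i, so the middle index has to be composed with \<sigma>.\<close>
  proof (rule sum.reindex_bij_witness[of _ "\<lambda>J i. J (inverse ?\<sigma> \<langle>$\<rangle> i)" "\<lambda>J i. J (?\<sigma> \<langle>$\<rangle> i)"])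
    fix J assume J: "J \<in> multi_indices d n"
    have "ev_mon d n A t (\<lambda>i. J (?\<sigma> \<langle>$\<rangle> i)) K =
      (\<Prod>i<n. ?E (factors t (inverse ?\<sigma> \<langle>$\<rangle> i)) $$ (J i, K (inverse ?\<tau> \<langle>$\<rangle> (inverse ?\<sigma> \<langle>$\<rangle> i))))"
      unfolding ev_mon_def
      by (rule prod.reindex_bij_witness[of _ "\<lambda>i. inverse ?\<sigma> \<langle>$\<rangle> i" "\<lambda>i. ?\<sigma> \<langle>$\<rangle> i"])
        (auto simp: sym_group_less[OF \<sigma>(1)] sym_group_less[OF \<sigma>(2)])
    then show "ev_mon d n A s I (\<lambda>i. J (?\<sigma> \<langle>$\<rangle> i)) * ev_mon d n A t (\<lambda>i. J (?\<sigma> \<langle>$\<rangle> i)) K =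
      (\<Prod>i<n. ?E (factors s i) $$ (I i, J i) *
        ?E (factors t (inverse ?\<sigma> \<langle>$\<rangle> i)) $$ (J i, K (inverse ?\<tau> \<langle>$\<rangle> (inverse ?\<sigma> \<langle>$\<rangle> i))))"
      by (simp add: ev_mon_def[of d n A s] prod.distrib)
  qed (simp_all add: multi_indices_perm[OF _ \<sigma>(1)] multi_indices_perm[OF _ \<sigma>(2)])
  finally show ?thesis .
qed

lemma ev_mult:
  assumes A: "assignment d A" and a: "a \<in> TX n" and b: "b \<in> TX n"
    and I: "I \<in> multi_indices d n" and K: "K \<in> multi_indices d n"
  shows "ev d n A (a * b) I K = (\<Sum>J\<in>multi_indices d n. ev d n A a I J * ev d n A b J K)"
proof -
  have *: "ev d n A (Poly_Mapping.single s c * b) I K =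
      (\<Sum>J\<in>multi_indices d n. ev d n A (Poly_Mapping.single s c) I J * ev d n A b J K)"
    if s: "s \<in> tensor_monomials n" for s c
    by (rule additive_eqI[where F = "\<lambda>b. ev d n A (Poly_Mapping.single s c * b) I K"
          and G = "\<lambda>b. (\<Sum>J\<in>multi_indices d n. ev d n A (Poly_Mapping.single s c) I J * ev d n A b J K)"])
      (use b in \<open>auto simp: TX_iff ev_add distrib_left sum.distrib mult_single ev_single eval_trace_ring_mult
        ev_mon_plus[OF A s _ I K] sum_distrib_left mult_ac\<close>)
  show ?thesis
    by (rule additive_eqI[where F = "\<lambda>a. ev d n A (a * b) I K"
          and G = "\<lambda>a. (\<Sum>J\<in>multi_indices d n. ev d n A a I J * ev d n A b J K)"])
      (use a in \<open>auto simp: TX_iff ev_add distrib_right sum.distrib *\<close>)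
qed

lemma ev_mult_perm: "ev d n A (z * perm_elem \<sigma>) I J = ev d n A z I (\<lambda>i. J (inverse \<sigma> \<langle>$\<rangle> i))"
proof (rule additive_eqI[where F = "\<lambda>z. ev d n A (z * perm_elem \<sigma>) I J"])
  fix t c
  have "ev_mon d n A (t + TMon (\<lambda>_. 0) \<sigma>) I J = ev_mon d n A t I (\<lambda>i. J (inverse \<sigma> \<langle>$\<rangle> i))"
    by (simp add: ev_mon_def plus_tensor_monomial_def apply_times)
  then show "ev d n A (Poly_Mapping.single t c * perm_elem \<sigma>) I J =
      ev d n A (Poly_Mapping.single t c) I (\<lambda>i. J (inverse \<sigma> \<langle>$\<rangle> i))"
    by (simp add: perm_elem_def mult_single ev_single)
qed (simp_all add: ev_add distrib_right)

lemma ev_one: "ev d n A 1 I J = (\<Prod>i<n. 1\<^sub>m d $$ (I i, J i))"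
proof -
  have "ev d n A (Poly_Mapping.single 0 1) I J = (\<Prod>i<n. 1\<^sub>m d $$ (I i, J i))"
    unfolding ev_single by (simp add: ev_mon_def zero_tensor_monomial_def)
  then show ?thesis by simp
qed

text \<open>Closing strand \<open>n\<close> is the contraction of the last pair of indices. A fixed
  strand contributes the trace of its matrix; otherwise the sum over \<open>k\<close> is the matrix
  product of the factors at \<sigma>(n) and at n.\<close>

lemma ev_partial_trace:
  assumes A: "assignment d A" and z: "z \<in> TX (Suc n)"
    and I: "I \<in> multi_indices d n" and J: "J \<in> multi_indices d n"
  shows "ev d n A (partial_trace n z) I J = (\<Sum>k<d. ev d (Suc n) A z (I(n := k)) (J(n := k)))"
proof (rule additive_eqI[where F = "\<lambda>z. ev d n A (partial_trace n z) I J"])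
  fix t c assume "t \<in> Poly_Mapping.keys z"
  with z have t: "t \<in> tensor_monomials (Suc n)" by (auto simp: TX_iff)
  let ?E = "\<lambda>M. eval_monomial d A M" and ?\<sigma> = "permutation t"
  have \<sigma>: "?\<sigma> \<in> sym_group (Suc n)" using t by (simp add: tensor_monomials_def)
  have ne: "inverse ?\<sigma> \<langle>$\<rangle> i \<noteq> n" if "i \<noteq> ?\<sigma> \<langle>$\<rangle> n" for i
    using that by (simp add: apply_inverse_eq_iff)
  have less: "inverse ?\<sigma> \<langle>$\<rangle> i < n" if "i < Suc n" "i \<noteq> ?\<sigma> \<langle>$\<rangle> n" for i
    using inverse_less[OF t that(1)] ne[OF that(2)] by simp
  have "eval_trace_ring d A (ptr_coeff n t) * ev_mon d n A (ptr_mon n t) I J =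
      (\<Sum>k<d. ev_mon d (Suc n) A t (I(n := k)) (J(n := k)))"
  proof (cases "?\<sigma> \<langle>$\<rangle> n = n")
    case True
    have "ev_mon d (Suc n) A t (I(n := k)) (J(n := k)) =
        ev_mon d n A (ptr_mon n t) I J * ?E (factors t n) $$ (k, k)" for k
    proof -
      have "(\<Prod>i<n. ?E (factors t i) $$ ((I(n := k)) i, (J(n := k)) (inverse ?\<sigma> \<langle>$\<rangle> i))) =
          ev_mon d n A (ptr_mon n t) I J"
        unfolding ev_mon_def by (rule prod.cong) (auto simp: ptr_mon_simps True ne)
      moreover have "inverse ?\<sigma> \<langle>$\<rangle> n = n" using True by (simp add: apply_inverse_eq_iff)
      ultimately show ?thesis by (simp add: ev_mon_def)
    qed
    then show ?thesis
      by (simp add: ptr_coeff_def True eval_tr_monomial[OF A] mat_trace_carrier[OF assignment_eval_carrier[OF A]]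
          sum_distrib_left mult.commute)
  next
    case False
    define r where "r = ?\<sigma> \<langle>$\<rangle> n"
    define s where "s = inverse ?\<sigma> \<langle>$\<rangle> n"
    have r: "r < n" using sym_group_less[OF \<sigma>, of n] False by (simp add: r_def)
    have s: "s < n" using less[of n] False by (simp add: s_def)
    have rs: "inverse ?\<sigma> \<langle>$\<rangle> r = n" by (simp add: r_def)
    let ?P = "\<Prod>i\<in>{..<n} - {r}. ?E (factors t i) $$ (I i, J (inverse ?\<sigma> \<langle>$\<rangle> i))"
    have "ev_mon d (Suc n) A t (I(n := k)) (J(n := k)) =
        ?P * (?E (factors t r) $$ (I r, k) * ?E (factors t n) $$ (k, J s))" for k
    proof -
      have "(\<Prod>i\<in>{..<n} - {r}. ?E (factors t i) $$ ((I(n := k)) i, (J(n := k)) (inverse ?\<sigma> \<langle>$\<rangle> i))) = ?P"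
        by (rule prod.cong) (auto simp: ne r_def)
      then show ?thesis
        using r s by (simp add: ev_mon_def prod.remove[of "{..<n}" r] rs s_def[symmetric])
    qed
    moreover have "ev_mon d n A (ptr_mon n t) I J = ?P * ?E (factors t r + factors t n) $$ (I r, J s)"
    proof -
      have "(\<Prod>i\<in>{..<n} - {r}. ?E (factors (ptr_mon n t) i) $$
          (I i, J (inverse (permutation (ptr_mon n t)) \<langle>$\<rangle> i))) = ?P"
        by (rule prod.cong) (auto simp: ptr_mon_simps r_def)
      then show ?thesis
        using r by (simp add: ev_mon_def prod.remove[of "{..<n}" r] ptr_mon_simps
            r_def[symmetric] s_def[symmetric])
    qed
    ultimately show ?thesis
      using multi_indices_less[OF I r] multi_indices_less[OF J s]
      by (simp add: ptr_coeff_def False eval_monomial_plus_entry[OF A] sum_distrib_left)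
  qed
  then show "ev d n A (partial_trace n (Poly_Mapping.single t c)) I J =
      (\<Sum>k<d. ev d (Suc n) A (Poly_Mapping.single t c) (I(n := k)) (J(n := k)))"
    by (simp add: partial_trace_single ev_single eval_trace_ring_mult mult.assoc flip: sum_distrib_left)
qed (simp_all add: partial_trace_add ev_add sum.distrib)

lemma tensor_identities_partial_trace:
  "z \<in> tensor_identities d (Suc n) \<Longrightarrow> partial_trace n z \<in> tensor_identities d n"
  by (simp add: tensor_identities_iff partial_trace_TX ev_partial_trace multi_indices_extend)

lemma tensor_identities_mult_left:
  "z \<in> tensor_identities d n \<Longrightarrow> a \<in> TX n \<Longrightarrow> a * z \<in> tensor_identities d n"
  by (simp add: tensor_identities_iff twisted_carrier_mult ev_mult)

lemma tensor_identities_mult_right: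
  "z \<in> tensor_identities d n \<Longrightarrow> a \<in> TX n \<Longrightarrow> z * a \<in> tensor_identities d n"
  by (simp add: tensor_identities_iff twisted_carrier_mult ev_mult)

lemma tensor_identities_add:
  "z \<in> tensor_identities d n \<Longrightarrow> w \<in> tensor_identities d n \<Longrightarrow> z + w \<in> tensor_identities d n"
  by (simp add: tensor_identities_iff TX_add ev_add)

lemma tensor_identities_uminus:
  "z \<in> tensor_identities d n \<Longrightarrow> - z \<in> tensor_identities d n"
  by (simp add: tensor_identities_iff TX_uminus ev_uminus)

lemma tensor_identities_diff:
  "z \<in> tensor_identities d n \<Longrightarrow> w \<in> tensor_identities d n \<Longrightarrow> z - w \<in> tensor_identities d n"
  by (simp add: tensor_identities_iff TX_diff ev_diff)

lemma tensor_identities_zero: "0 \<in> tensor_identities d n"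
  by (simp add: tensor_identities_iff)

lemma twisted_a_inv:
  assumes "a \<in> TX n" shows "\<ominus>\<^bsub>twisted_algebra n\<^esub> a = - a"
proof -
  interpret ring "twisted_algebra n" by (rule ring_twisted_algebra)
  show ?thesis
    by (rule minus_equality) (use assms TX_uminus[OF assms] in \<open>simp_all add: twisted_algebra_simps(2-)\<close>)
qed

lemma ideal_twistedI:
  assumes "S \<subseteq> TX n" "0 \<in> S" "\<And>a b. a \<in> S \<Longrightarrow> b \<in> S \<Longrightarrow> a + b \<in> S" "\<And>a. a \<in> S \<Longrightarrow> - a \<in> S"
    "\<And>a z. a \<in> S \<Longrightarrow> z \<in> TX n \<Longrightarrow> z * a \<in> S" "\<And>a z. a \<in> S \<Longrightarrow> z \<in> TX n \<Longrightarrow> a * z \<in> S"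
  shows "ideal S (twisted_algebra n)"
proof (rule idealI)
  show "ring (twisted_algebra n)" by (rule ring_twisted_algebra)
  show "subgroup S (add_monoid (twisted_algebra n))"
  proof (rule subgroup.intro)
    fix a assume "a \<in> S"
    then show "inv\<^bsub>add_monoid (twisted_algebra n)\<^esub> a \<in> S"
      using assms(1,4) twisted_a_inv[of a n] by (auto simp: a_inv_def)
  qed (use assms in \<open>auto simp: twisted_algebra_simps(2-)\<close>)
qed (use assms in \<open>auto simp: twisted_algebra_simps(2-)\<close>)

lemma ideal_tensor_identities: "ideal (tensor_identities d n) (twisted_algebra n)"
  by (rule ideal_twistedI)
    (auto simp: tensor_identities_add tensor_identities_uminus tensor_identities_zero
      tensor_identities_mult_left tensor_identities_mult_right, simp add: tensor_identities_iff)

section \<open>Tensor identities form a T-ideal\<close>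

definition eval_free :: "nat \<Rightarrow> (nat \<Rightarrow> rat mat) \<Rightarrow> free_trace_algebra \<Rightarrow> rat mat" where
  "eval_free d A f = mat d d (\<lambda>(i, j). \<Sum>M\<in>Poly_Mapping.keys f.
     eval_trace_ring d A (Poly_Mapping.lookup f M) * eval_monomial d A M $$ (i, j))"

lemma eval_free_carrier [simp]: "eval_free d A f \<in> carrier_mat d d"
  and eval_free_dim [simp]: "dim_row (eval_free d A f) = d" "dim_col (eval_free d A f) = d"
  by (simp_all add: eval_free_def)

lemma eval_free_entry_add: "i < d \<Longrightarrow> j < d \<Longrightarrow>
    eval_free d A (f + g) $$ (i, j) = eval_free d A f $$ (i, j) + eval_free d A g $$ (i, j)"
  unfolding eval_free_def
  by (simp add: setsum_keys_plus_distrib[where f = "\<lambda>M c. eval_trace_ring d A c * eval_monomial d A M $$ (i, j)"]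
      eval_trace_ring_add distrib_right)

lemma eval_free_entry_single: "i < d \<Longrightarrow> j < d \<Longrightarrow>
    eval_free d A (Poly_Mapping.single M c) $$ (i, j) = eval_trace_ring d A c * eval_monomial d A M $$ (i, j)"
  by (simp add: eval_free_def)

lemma eval_free_single_one: "assignment d A \<Longrightarrow> eval_free d A (Poly_Mapping.single M 1) = eval_monomial d A M"
  using assignment_eval_carrier[of d A M] by (intro eq_matI) (auto simp: eval_free_entry_single)

lemma eval_free_mult:
  assumes A: "assignment d A"
  shows "eval_free d A (f * g) = eval_free d A f * eval_free d A g"
proof (rule eq_matI)
  fix i j assume "i < dim_row (eval_free d A f * eval_free d A g)" "j < dim_col (eval_free d A f * eval_free d A g)"
  then have ij: "i < d" "j < d" by (auto simp: eval_free_def)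
  have *: "eval_free d A (Poly_Mapping.single M c * g) $$ (i, j) =
      (\<Sum>k<d. eval_free d A (Poly_Mapping.single M c) $$ (i, k) * eval_free d A g $$ (k, j))" for M c
    by (rule additive_eqI[where F = "\<lambda>g. eval_free d A (Poly_Mapping.single M c * g) $$ (i, j)"
          and G = "\<lambda>g. (\<Sum>k<d. eval_free d A (Poly_Mapping.single M c) $$ (i, k) * eval_free d A g $$ (k, j))"])
      (simp_all add: ij eval_free_entry_add distrib_left sum.distrib mult_single eval_free_entry_single
        eval_trace_ring_mult eval_monomial_plus_entry[OF A] sum_distrib_left mult_ac)
  have "eval_free d A (f * g) $$ (i, j) = (\<Sum>k<d. eval_free d A f $$ (i, k) * eval_free d A g $$ (k, j))"
    by (rule additive_eqI[where F = "\<lambda>f. eval_free d A (f * g) $$ (i, j)"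
          and G = "\<lambda>f. (\<Sum>k<d. eval_free d A f $$ (i, k) * eval_free d A g $$ (k, j))"])
      (simp_all add: ij eval_free_entry_add distrib_right sum.distrib *)
  then show "eval_free d A (f * g) $$ (i, j) = (eval_free d A f * eval_free d A g) $$ (i, j)"
    by (simp add: mat_mult_entry[OF eval_free_carrier eval_free_carrier ij])
qed (simp_all add: eval_free_def)

lemma eval_trace_coeff:
  assumes A: "assignment d A"
  shows "eval_trace_ring d A (trace_coeff f) = mat_trace (eval_free d A f)"
proof -
  have "eval_trace_ring d A (trace_coeff f) = (\<Sum>i<d. eval_free d A f $$ (i, i))"
    by (rule additive_eqI[where F = "\<lambda>f. eval_trace_ring d A (trace_coeff f)"])
      (simp_all add: trace_coeff_add eval_trace_ring_add eval_free_entry_add sum.distrib trace_coeff_single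
        eval_trace_ring_mult eval_tr_monomial[OF A] eval_free_entry_single sum_distrib_left
        mat_trace_carrier[OF assignment_eval_carrier[OF A]])
  then show ?thesis by (simp add: mat_trace_def)
qed

lemma ev_mult_factor:
  assumes A: "assignment d A" and z: "z \<in> TX n" and m: "m < n"
    and I: "I \<in> multi_indices d n" and J: "J \<in> multi_indices d n"
  shows "ev d n A (z * factor_elem m f) I J = (\<Sum>k<d. ev d n A z I (J(m := k)) * eval_free d A f $$ (k, J m))"
proof -
  have Jm: "J m < d" using multi_indices_less[OF J m] .
  have mon: "ev_mon d n A (t + pos_monomial m M) I J =
      (\<Sum>k<d. ev_mon d n A t I (J(m := k)) * eval_monomial d A M $$ (k, J m))"
    if t: "t \<in> tensor_monomials n" for t M
  proof -
    let ?\<sigma> = "permutation t"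
    define r where "r = ?\<sigma> \<langle>$\<rangle> m"
    have r: "r < n" using t m by (simp add: r_def tensor_monomials_def sym_group_less)
    have inv: "inverse ?\<sigma> \<langle>$\<rangle> r = m" by (simp add: r_def)
    have ne: "inverse ?\<sigma> \<langle>$\<rangle> i \<noteq> m" if "i \<noteq> r" for i
      using that by (simp add: apply_inverse_eq_iff r_def)
    let ?P = "\<Prod>i\<in>{..<n} - {r}. eval_monomial d A (factors t i) $$ (I i, J (inverse ?\<sigma> \<langle>$\<rangle> i))"
    have "(\<Prod>i\<in>{..<n} - {r}. eval_monomial d A (factors (t + pos_monomial m M) i) $$
        (I i, J (inverse (permutation (t + pos_monomial m M)) \<langle>$\<rangle> i))) = ?P"
      by (rule prod.cong) (auto simp: factors_plus permutation_plus pos_monomial_def ne)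
    then have "ev_mon d n A (t + pos_monomial m M) I J =
        ?P * eval_monomial d A (factors t r + M) $$ (I r, J m)"
      using r by (simp add: ev_mon_def prod.remove[of "{..<n}" r] factors_plus permutation_plus pos_monomial_def inv)
    moreover have "ev_mon d n A t I (J(m := k)) = ?P * eval_monomial d A (factors t r) $$ (I r, k)" for k
    proof -
      have "(\<Prod>i\<in>{..<n} - {r}. eval_monomial d A (factors t i) $$ (I i, (J(m := k)) (inverse ?\<sigma> \<langle>$\<rangle> i))) = ?P"
        by (rule prod.cong) (auto simp: ne)
      then show ?thesis
        using r by (simp add: ev_mon_def prod.remove[of "{..<n}" r] inv)
    qed
    ultimately show ?thesis
      by (simp add: eval_monomial_plus_entry[OF A multi_indices_less[OF I r] Jm] sum_distrib_left mult.assoc)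
  qed
  have *: "ev d n A (Poly_Mapping.single t c * factor_elem m f) I J =
      (\<Sum>k<d. ev d n A (Poly_Mapping.single t c) I (J(m := k)) * eval_free d A f $$ (k, J m))"
    if t: "t \<in> tensor_monomials n" for t c
    by (rule additive_eqI[where F = "\<lambda>f. ev d n A (Poly_Mapping.single t c * factor_elem m f) I J"
          and G = "\<lambda>f. (\<Sum>k<d. ev d n A (Poly_Mapping.single t c) I (J(m := k)) * eval_free d A f $$ (k, J m))"])
      (simp_all add: factor_elem_add distrib_left ev_add eval_free_entry_add[OF _ Jm] sum.distrib
        factor_elem_single pos_elem_def coeff_elem_mult_single mult_single ev_single eval_trace_ring_mult
        mon[OF t] eval_free_entry_single[OF _ Jm] sum_distrib_left mult_ac)
  show ?thesis
    by (rule additive_eqI[where F = "\<lambda>z. ev d n A (z * factor_elem m f) I J"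
          and G = "\<lambda>z. (\<Sum>k<d. ev d n A z I (J(m := k)) * eval_free d A f $$ (k, J m))"])
      (use z in \<open>auto simp: TX_iff distrib_right ev_add sum.distrib *\<close>)
qed

lemma factor_product_TX:
  "m \<le> n \<Longrightarrow> prod_list (map (\<lambda>i. factor_elem i (f i)) [0..<m]) \<in> TX n"
  by (auto intro!: twisted_carrier_prod_list factor_elem_TX)

text \<open>The factors are multiplied in one at a time, with \<open>n\<close> fixed and identity
  matrices at the positions not yet reached. Each step changes the column index at \<open>m\<close>,
  hence the induction over arbitrary \<open>J\<close>.\<close>

lemma ev_factor_product:
  assumes A: "assignment d A" and m: "m \<le> n"
    and I: "I \<in> multi_indices d n" and J: "J \<in> multi_indices d n"
  shows "ev d n A (prod_list (map (\<lambda>i. factor_elem i (f i)) [0..<m])) I J =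
    (\<Prod>i<n. (if i < m then eval_free d A (f i) else 1\<^sub>m d) $$ (I i, J i))"
  using m J
proof (induction m arbitrary: J)
  case 0
  then show ?case by (simp add: ev_one)
next
  case (Suc m)
  let ?F = "\<lambda>m i. if i < m then eval_free d A (f i) else 1\<^sub>m d"
  let ?P = "\<Prod>i\<in>{..<n} - {m}. ?F m i $$ (I i, J i)"
  have mn: "m < n" using Suc.prems by simp
  have "ev d n A (prod_list (map (\<lambda>i. factor_elem i (f i)) [0..<m])) I (J(m := k)) =
      ?P * (if I m = k then 1 else 0)" if "k < d" for k
  proof -
    have "ev d n A (prod_list (map (\<lambda>i. factor_elem i (f i)) [0..<m])) I (J(m := k)) =
        (\<Prod>i<n. ?F m i $$ (I i, (J(m := k)) i))"
      using mn by (intro Suc.IH multi_indices_update Suc.prems that) simp_all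
    also have "\<dots> = (\<Prod>i\<in>{..<n} - {m}. ?F m i $$ (I i, (J(m := k)) i)) * (if I m = k then 1 else 0)"
      using mn that multi_indices_less[OF I mn] by (simp add: prod.remove[of "{..<n}" m])
    also have "(\<Prod>i\<in>{..<n} - {m}. ?F m i $$ (I i, (J(m := k)) i)) = ?P"
      by (rule prod.cong) auto
    finally show ?thesis .
  qed
  note ev_m = this
  have "ev d n A (prod_list (map (\<lambda>i. factor_elem i (f i)) [0..<Suc m])) I J =
      (\<Sum>k<d. ev d n A (prod_list (map (\<lambda>i. factor_elem i (f i)) [0..<m])) I (J(m := k)) *
        eval_free d A (f m) $$ (k, J m))"
    using ev_mult_factor[OF A factor_product_TX[OF less_imp_le[OF mn]] mn I Suc.prems(2)] by simp
  also have "\<dots> = (\<Sum>k<d. if I m = k then ?P * eval_free d A (f m) $$ (k, J m) else 0)"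
  proof (intro sum.cong refl)
    fix k assume "k \<in> {..<d}"
    then have k: "k < d" by simp
    show "ev d n A (prod_list (map (\<lambda>i. factor_elem i (f i)) [0..<m])) I (J(m := k)) * eval_free d A (f m) $$ (k, J m) =
        (if I m = k then ?P * eval_free d A (f m) $$ (k, J m) else 0)"
      by (simp only: ev_m[OF k]) (cases "I m = k", simp_all)
  qed
  also have "\<dots> = ?P * eval_free d A (f m) $$ (I m, J m)"
    using multi_indices_less[OF I mn] by simp
  also have "?P = (\<Prod>i\<in>{..<n} - {m}. ?F (Suc m) i $$ (I i, J i))"
    by (rule prod.cong) (auto simp: less_Suc_eq)
  also have "\<dots> * eval_free d A (f m) $$ (I m, J m) = (\<Prod>i<n. ?F (Suc m) i $$ (I i, J i))"
    using mn by (simp add: prod.remove[of "{..<n}" m])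
  finally show ?case .
qed

text \<open>Applying \<open>g\<close> and evaluating at \<open>A\<close> is again an evaluation: it
  respects products and traces, so it is determined by the matrices \<open>A'\<close> assigned to
  the variables.\<close>

lemma eval_trace_endomorphism:
  assumes g: "trace_endomorphism g" and A: "assignment d A"
  defines "A' \<equiv> \<lambda>i. eval_free d A (g (Poly_Mapping.single (Mon [i]) 1))"
  shows "assignment d A'"
    and "eval_free d A (g (Poly_Mapping.single M 1)) = eval_monomial d A' M"
    and "eval_trace_ring d A (Poly_Mapping.lookup (g (Poly_Mapping.single 0 c)) 0) = eval_trace_ring d A' c"
proof -
  have add: "g (a + b) = g a + g b" and mult: "g (a * b) = g a * g b"
    and rat: "g (Poly_Mapping.single 0 (const_tr q)) = Poly_Mapping.single 0 (const_tr q)"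
    and tr: "g (formal_trace a) = formal_trace (g a)" for a b q
    using g by (auto simp: trace_endomorphism_def)
  have one: "g 1 = 1" using rat[of 1] by simp
  show A': "assignment d A'" by (simp add: assignment_def A'_def)
  show M: "eval_free d A (g (Poly_Mapping.single M 1)) = eval_monomial d A' M" for M
  proof (cases M)
    case (Mon w)
    have "eval_free d A (g (Poly_Mapping.single (Mon w) 1)) = eval_monomial d A' (Mon w)"
    proof (induction w)
      case Nil
      have "eval_free d A 1 = 1\<^sub>m d"
        using eval_free_single_one[OF A, of 0] by simp
      then show ?case by (simp add: one flip: zero_monomial_def)
    next
      case (Cons i w)
      have "Poly_Mapping.single (Mon (i # w)) 1 = Poly_Mapping.single (Mon [i]) (1 :: trace_ring) * Poly_Mapping.single (Mon w) 1"
        by (simp add: mult_single plus_monomial_def)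
      then show ?case
        by (simp add: mult eval_free_mult[OF A] Cons.IH) (simp add: A'_def eval_monomial_def)
    qed
    then show ?thesis by (simp add: Mon)
  qed
  \<comment> \<open>By \<open>trace_endomorphism_trace_ring\<close> the image is concentrated at the
    empty monomial, so this coefficient is the whole action of \<open>g\<close> on the trace
    ring.\<close>
  let ?H = "\<lambda>c. Poly_Mapping.lookup (g (Poly_Mapping.single 0 c)) 0"
  have H_mult: "?H (c * c') = ?H c * ?H c'" for c c'
  proof -
    obtain x y where "g (Poly_Mapping.single 0 c) = Poly_Mapping.single 0 x"
      "g (Poly_Mapping.single 0 c') = Poly_Mapping.single 0 y"
      using trace_endomorphism_trace_ring[OF g] by metis
    then show ?thesis
      using mult[of "Poly_Mapping.single 0 c" "Poly_Mapping.single 0 c'"] by (simp add: mult_single)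
  qed
  have mon: "eval_trace_ring d A (?H (Poly_Mapping.single m q)) = eval_trace_ring d A' (Poly_Mapping.single m q)" for m q
  proof (induction m)
    case empty
    show ?case using rat[of q] by (simp add: const_tr_def eval_trace_ring_single)
  next
    case (add y m)
    obtain M where y: "y = abs_cyc_monomial M"
      by (metis Quotient3_abs_rep[OF Quotient3_cyc_monomial])
    have eq: "Poly_Mapping.single (add_mset y m) q = tr_monomial M * Poly_Mapping.single m q"
      by (simp add: tr_monomial_def mult_single y)
    have "?H (tr_monomial M) = trace_coeff (g (Poly_Mapping.single M 1))"
      using tr[of "Poly_Mapping.single M 1"] by (simp add: formal_trace_eq trace_coeff_single)
    then show ?case
      by (simp add: eq H_mult eval_trace_ring_mult add.IH eval_trace_coeff[OF A] M eval_tr_monomial[OF A'])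
  qed
  show "eval_trace_ring d A (?H c) = eval_trace_ring d A' c"
    by (rule additive_eqI[where F = "\<lambda>c. eval_trace_ring d A (?H c)"])
      (simp_all add: single_add add lookup_add eval_trace_ring_add mon)
qed

lemma trace_endomorphism_zero: "trace_endomorphism g \<Longrightarrow> g 0 = 0"
  unfolding trace_endomorphism_def by (metis (no_types) add.right_neutral add_left_cancel)

lemma induced_endomorphism_add:
  assumes "trace_endomorphism g"
  shows "induced_endomorphism n g (a + b) = induced_endomorphism n g a + induced_endomorphism n g b"
proof -
  have [simp]: "g (a + b) = g a + g b" for a b using assms by (simp add: trace_endomorphism_def)
  note [simp] = trace_endomorphism_zero[OF assms]
  show ?thesis
    unfolding induced_endomorphism_def
    by (rule setsum_keys_plus_distrib) (simp_all add: single_add factor_elem_add distrib_right)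
qed

lemma ev_induced_endomorphism:
  assumes g: "trace_endomorphism g" and A: "assignment d A" and z: "z \<in> TX n"
    and I: "I \<in> multi_indices d n" and J: "J \<in> multi_indices d n"
  defines "A' \<equiv> \<lambda>i. eval_free d A (g (Poly_Mapping.single (Mon [i]) 1))"
  shows "ev d n A (induced_endomorphism n g z) I J = ev d n A' z I J"
proof (rule additive_eqI[where F = "\<lambda>z. ev d n A (induced_endomorphism n g z) I J"])
  note sub = eval_trace_endomorphism[OF g A, folded A'_def]
  fix t c assume "t \<in> Poly_Mapping.keys z"
  with z have t: "t \<in> tensor_monomials n" by (auto simp: TX_iff)
  have J': "(\<lambda>i. J (inverse (permutation t) \<langle>$\<rangle> i)) \<in> multi_indices d n"
    using t J by (simp add: multi_indices_perm tensor_monomials_def sym_group_inverse)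
  have g0: "g 0 = 0"
    by (rule trace_endomorphism_zero[OF g])
  have ind: "induced_endomorphism n g (Poly_Mapping.single t c) =
     factor_elem 0 (g (Poly_Mapping.single 0 c))
     * prod_list (map (\<lambda>i. factor_elem i (g (Poly_Mapping.single (factors t i) 1))) [0..<n])
     * perm_elem (permutation t)"
    by (cases "c = 0") (simp_all add: induced_endomorphism_def g0)
  obtain c' where c': "g (Poly_Mapping.single 0 c) = Poly_Mapping.single 0 c'"
    using trace_endomorphism_trace_ring[OF g] by blast
  show "ev d n A (induced_endomorphism n g (Poly_Mapping.single t c)) I J = ev d n A' (Poly_Mapping.single t c) I J"
    using sub(3)[of c]
    by (simp add: ind c' factor_elem_coeff ev_coeff_mult mult.assoc ev_mult_perm ev_factor_product[OF A _ I J']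
        sub(2) ev_single ev_mon_def)
qed (simp_all add: induced_endomorphism_add[OF g] ev_add)

lemma outer_product_add_left: "outer_product m (a + a') b = outer_product m a b + outer_product m a' b"
  unfolding outer_product_def
  by (rule setsum_keys_plus_distrib) (simp_all add: distrib_right single_add sum.distrib)

lemma outer_product_add_right: "outer_product m a (b + b') = outer_product m a b + outer_product m a b'"
  unfolding outer_product_def sum.distrib[symmetric]
  by (intro sum.cong refl setsum_keys_plus_distrib) (simp_all add: distrib_left single_add)

lemma outer_product_single:
  "outer_product m (Poly_Mapping.single s c) (Poly_Mapping.single t c') = Poly_Mapping.single (juxtapose m s t) (c * c')"
  by (simp add: outer_product_def)

lemma prod_lessThan_add: "(\<Prod>i<m + n. f i) = (\<Prod>i<m. f i) * (\<Prod>i<n. f (m + i) :: 'a::comm_monoid_mult)" for m n :: nat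
  by (induction n) (simp_all add: mult.assoc)

lemma ev_mon_juxtapose:
  assumes s: "s \<in> tensor_monomials m" and t: "t \<in> tensor_monomials n"
  shows "ev_mon d (m + n) A (juxtapose m s t) I J =
    ev_mon d m A s (\<lambda>i\<in>{..<m}. I i) (\<lambda>i\<in>{..<m}. J i) *
    ev_mon d n A t (\<lambda>i\<in>{..<n}. I (m + i)) (\<lambda>i\<in>{..<n}. J (m + i))"
proof -
  let ?\<sigma> = "permutation s" and ?\<tau> = "permutation t"
  have s': "inverse ?\<sigma> \<langle>$\<rangle> i = i" if "i \<ge> m" for i
    using s that sym_group_inverse[of ?\<sigma> m] sym_group_outside[of "inverse ?\<sigma>" m i]
    by (simp add: tensor_monomials_def)
  have inv1: "inverse (permutation (juxtapose m s t)) \<langle>$\<rangle> i = inverse ?\<sigma> \<langle>$\<rangle> i" if "i < m" for i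
    using inverse_less[OF s that]
    by (simp add: apply_inverse_eq_iff juxtapose_def apply_times shift_perm.rep_eq)
  have inv2: "inverse (permutation (juxtapose m s t)) \<langle>$\<rangle> (m + i) = m + inverse ?\<tau> \<langle>$\<rangle> i" for i
    using s'[of "m + i"]
    by (simp add: apply_inverse_eq_iff juxtapose_def apply_times shift_perm.rep_eq add.commute)
  show ?thesis
    unfolding ev_mon_def prod_lessThan_add
    by (intro arg_cong2[where f = "(*)"] prod.cong)
      (auto simp: inv1 inv2 inverse_less[OF s] inverse_less[OF t], auto simp: juxtapose_def)
qed

lemma multi_indices_left: "I \<in> multi_indices d (m + n) \<Longrightarrow> (\<lambda>i\<in>{..<m}. I i) \<in> multi_indices d m"
  by (simp add: multi_indices_def PiE_iff)

lemma multi_indices_right: "I \<in> multi_indices d (m + n) \<Longrightarrow> (\<lambda>i\<in>{..<n}. I (m + i)) \<in> multi_indices d n"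
  by (simp add: multi_indices_def PiE_iff)

lemma ev_outer_product:
  assumes a: "a \<in> TX m" and b: "b \<in> TX n"
  shows "ev d (m + n) A (outer_product m a b) I J =
    ev d m A a (\<lambda>i\<in>{..<m}. I i) (\<lambda>i\<in>{..<m}. J i) *
    ev d n A b (\<lambda>i\<in>{..<n}. I (m + i)) (\<lambda>i\<in>{..<n}. J (m + i))"
proof -
  have *: "ev d (m + n) A (outer_product m (Poly_Mapping.single s c) b) I J =
      ev d m A (Poly_Mapping.single s c) (\<lambda>i\<in>{..<m}. I i) (\<lambda>i\<in>{..<m}. J i) *
      ev d n A b (\<lambda>i\<in>{..<n}. I (m + i)) (\<lambda>i\<in>{..<n}. J (m + i))"
    if s: "s \<in> tensor_monomials m" for s c
    by (rule additive_eqI[where F = "\<lambda>b. ev d (m + n) A (outer_product m (Poly_Mapping.single s c) b) I J"])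
      (use b in \<open>auto simp: TX_iff outer_product_add_right ev_add distrib_left outer_product_single ev_single
        eval_trace_ring_mult ev_mon_juxtapose[OF s] simp del: restrict_apply\<close>)
  show ?thesis
    by (rule additive_eqI[where F = "\<lambda>a. ev d (m + n) A (outer_product m a b) I J"])
      (use a in \<open>auto simp: TX_iff outer_product_add_left ev_add distrib_right * simp del: restrict_apply\<close>)
qed

text \<open>Besides giving one inclusion of the theorem, this makes \<open>core_ideal_subset\<close>
  applicable to the tensor identities themselves and so shows that \<open>core_ideal\<close>
  consists of identities.\<close>

lemma T_ideal_tensor_identities: "T_ideal (tensor_identities d)"
  unfolding T_ideal_def
proof (intro conjI allI impI ballI)
  fix n show "ideal (tensor_identities d n) (twisted_algebra n)" by (rule ideal_tensor_identities)
next
  fix g n assume g: "trace_endomorphism g"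
  show "induced_endomorphism n g ` tensor_identities d n \<subseteq> tensor_identities d n"
    using eval_trace_endomorphism(1)[OF g]
    by (auto simp: tensor_identities_iff induced_endomorphism_carrier[OF g] ev_induced_endomorphism[OF g])
next
  fix m n a b assume "a \<in> tensor_identities d m" "b \<in> TX n"
  then show "outer_product m a b \<in> tensor_identities d (m + n)"
    by (simp add: tensor_identities_iff outer_product_carrier ev_outer_product multi_indices_left)
next
  fix m n a b assume "a \<in> TX m" "b \<in> tensor_identities d n"
  then show "outer_product m a b \<in> tensor_identities d (m + n)"
    by (simp add: tensor_identities_iff outer_product_carrier ev_outer_product multi_indices_right)
qed

section \<open>Partial traces of antisymmetrizers\<close>

lemma perm_sign_mult: "perm_sign (\<sigma> * \<tau>) = perm_sign \<sigma> * perm_sign \<tau>"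
proof -
  have "Permutations.permutation (apply \<rho>)" for \<rho> :: "nat perm"
    using "apply"[of \<rho>] by (simp add: Permutations.permutation)
  then show ?thesis
    by (simp add: perm_sign_def apply_times sign_compose)
qed

lemma perm_sign_one [simp]: "perm_sign 1 = 1"
  by (simp add: perm_sign_def)

lemma perm_sign_swap: "a \<noteq> b \<Longrightarrow> perm_sign \<langle>a \<leftrightarrow> b\<rangle> = - 1"
  by (simp add: perm_sign_def swap.rep_eq sign_swap_id)

lemma perm_sign_square [simp]: "perm_sign \<sigma> * perm_sign \<sigma> = 1"
  by (simp add: perm_sign_def sign_def)

lemma rat_elem_sign_cancel: "rat_elem (perm_sign \<sigma>) * (rat_elem (perm_sign \<sigma>) * z) = z"
  by (simp flip: mult.assoc coeff_elem_mult const_tr_mult)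

lemma antisymmetrizer_left:
  assumes "\<pi> \<in> sym_group n"
  shows "perm_elem \<pi> * antisymmetrizer n = rat_elem (perm_sign \<pi>) * antisymmetrizer n"
proof -
  have "(\<Sum>\<tau>\<in>sym_group n. rat_elem (perm_sign \<tau>) * perm_elem (\<pi> * \<tau>)) =
      (\<Sum>\<tau>\<in>sym_group n. rat_elem (perm_sign \<pi> * perm_sign \<tau>) * perm_elem \<tau>)"
    using assms
    by (intro sum.reindex_bij_witness[of _ "\<lambda>\<tau>. inverse \<pi> * \<tau>" "\<lambda>\<tau>. \<pi> * \<tau>"])
      (auto simp: mult.assoc[symmetric] perm_sign_mult intro: sym_group_times sym_group_inverse)
  then show ?thesis
    by (simp add: antisymmetrizer_def sum_distrib_left coeff_elem_left_commute[of "perm_elem \<pi>"]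
        perm_elem_mult const_tr_mult coeff_elem_mult mult.assoc)
qed

lemma antisymmetrizer_right:
  assumes "\<pi> \<in> sym_group n"
  shows "antisymmetrizer n * perm_elem \<pi> = rat_elem (perm_sign \<pi>) * antisymmetrizer n"
proof -
  have "(\<Sum>\<tau>\<in>sym_group n. rat_elem (perm_sign \<tau>) * perm_elem (\<tau> * \<pi>)) =
      (\<Sum>\<tau>\<in>sym_group n. rat_elem (perm_sign \<pi> * perm_sign \<tau>) * perm_elem \<tau>)"
    using assms
    by (intro sum.reindex_bij_witness[of _ "\<lambda>\<tau>. \<tau> * inverse \<pi>" "\<lambda>\<tau>. \<tau> * \<pi>"])
      (auto simp: mult.assoc perm_sign_mult mult.left_commute intro: sym_group_times sym_group_inverse)
  then show ?thesis
    by (simp add: antisymmetrizer_def sum_distrib_left sum_distrib_right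
        perm_elem_mult const_tr_mult coeff_elem_mult mult.assoc)
qed

lemma antisymmetrizer_TX: "antisymmetrizer n \<in> TX n"
  unfolding antisymmetrizer_def
  by (intro twisted_carrier_sum twisted_carrier_mult coeff_elem_TX perm_elem_TX)

lemma sym_group_0: "sym_group 0 = {1}"
  by (simp add: sym_group_def)

lemma antisymmetrizer_0 [simp]: "antisymmetrizer 0 = 1"
  by (simp add: antisymmetrizer_def sym_group_0)

text \<open>Coset decomposition: a permutation \<sigma> of n + 1 letters is the transposition of
  \<sigma>(n) and n times a permutation of n letters. Only the first factor touches strand
  \<open>n\<close>, which makes closing this strand computable.\<close>

lemma antisymmetrizer_Suc:
  "antisymmetrizer (Suc n) = (1 - (\<Sum>r<n. perm_elem \<langle>r \<leftrightarrow> n\<rangle>)) * antisymmetrizer n"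
proof -
  let ?f = "\<lambda>r. rat_elem (perm_sign \<langle>r \<leftrightarrow> n\<rangle>) * perm_elem \<langle>r \<leftrightarrow> n\<rangle>"
  have "antisymmetrizer (Suc n) = (\<Sum>(r, \<tau>)\<in>{..n} \<times> sym_group n.
      rat_elem (perm_sign (\<langle>r \<leftrightarrow> n\<rangle> * \<tau>)) * perm_elem (\<langle>r \<leftrightarrow> n\<rangle> * \<tau>))"
    unfolding antisymmetrizer_def
  proof (rule sum.reindex_bij_witness[of _ "\<lambda>(r, \<tau>). \<langle>r \<leftrightarrow> n\<rangle> * \<tau>"
        "\<lambda>\<sigma>. (\<sigma> \<langle>$\<rangle> n, \<langle>\<sigma> \<langle>$\<rangle> n \<leftrightarrow> n\<rangle> * \<sigma>)"])
    fix \<sigma> assume \<sigma>: "\<sigma> \<in> sym_group (Suc n)"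
    then have "\<sigma> \<langle>$\<rangle> n \<le> n" using sym_group_less[OF \<sigma>, of n] by simp
    moreover have "\<langle>\<sigma> \<langle>$\<rangle> n \<leftrightarrow> n\<rangle> * \<sigma> \<in> sym_group n"
      unfolding sym_group_iff
    proof (intro allI impI)
      fix i assume "n \<le> i"
      show "(\<langle>\<sigma> \<langle>$\<rangle> n \<leftrightarrow> n\<rangle> * \<sigma>) \<langle>$\<rangle> i = i"
      proof (cases "i = n")
        case False
        with \<open>n \<le> i\<close> have "\<sigma> \<langle>$\<rangle> i = i" using \<sigma> by (simp add: sym_group_iff)
        moreover have "i \<noteq> \<sigma> \<langle>$\<rangle> n" using False calculation by (metis apply_inj)
        ultimately show ?thesis using False by (simp add: apply_times apply_swap)
      qed (simp add: apply_times)
    qed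
    ultimately show "(\<sigma> \<langle>$\<rangle> n, \<langle>\<sigma> \<langle>$\<rangle> n \<leftrightarrow> n\<rangle> * \<sigma>) \<in> {..n} \<times> sym_group n" by simp
  qed (auto simp: mult.assoc[symmetric] sym_group_iff apply_times apply_swap)
  also have "\<dots> = (\<Sum>r\<le>n. \<Sum>\<tau>\<in>sym_group n. ?f r * (rat_elem (perm_sign \<tau>) * perm_elem \<tau>))"
    by (simp add: sum.cartesian_product perm_sign_mult perm_elem_mult const_tr_mult coeff_elem_mult mult.assoc
        coeff_elem_left_commute[of "perm_elem _"])
  also have "\<dots> = (\<Sum>r\<le>n. ?f r) * antisymmetrizer n"
    by (simp only: antisymmetrizer_def sum_product)
  also have "(\<Sum>r\<le>n. ?f r) = 1 - (\<Sum>r<n. perm_elem \<langle>r \<leftrightarrow> n\<rangle>)"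
  proof -
    have "(\<Sum>r<n. ?f r) = (\<Sum>r<n. - perm_elem \<langle>r \<leftrightarrow> n\<rangle>)"
      by (rule sum.cong) (simp_all add: perm_sign_swap const_tr_uminus coeff_elem_uminus)
    then show ?thesis by (simp add: atMost_Suc lessThan_Suc_atMost[symmetric] sum_negf)
  qed
  finally show ?thesis .
qed

text \<open>
  \<open>trace_antisym q [a\<^sub>k, \<dots>, a\<^sub>1]\<close> is the antisymmetrizer on \<open>q\<close> strands with the last \<open>k\<close> strands closed up
  after multiplication by the \<open>a\<^sub>i\<close>; it is a polarized form of \<open>\<CC>\<^bsub>k,q-1\<^esub>\<close>.
\<close>

fun trace_antisym :: "nat \<Rightarrow> free_trace_algebra list \<Rightarrow> twisted_element" where
  "trace_antisym q [] = antisymmetrizer q"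
| "trace_antisym q (a # l) = partial_trace (q - Suc (length l))
     (factor_elem (q - Suc (length l)) a * trace_antisym q l)"

lemma trace_antisym_TX: "length l \<le> q \<Longrightarrow> trace_antisym q l \<in> TX (q - length l)"
proof (induction l)
  case (Cons a l)
  then have eq: "q - length l = Suc (q - Suc (length l))" by simp
  show ?case
    using Cons by (simp add: eq partial_trace_TX twisted_carrier_mult factor_elem_TX)
qed (simp add: antisymmetrizer_TX)

text \<open>A permutation of the open strands is idle on the closed ones, so it passes through the
  partial traces and reaches the antisymmetrizer.\<close>

lemma trace_antisym_left:
  assumes "length l \<le> q" "\<pi> \<in> sym_group (q - length l)"
  shows "perm_elem \<pi> * trace_antisym q l = rat_elem (perm_sign \<pi>) * trace_antisym q l"
  using assms
proof (induction l)
  case (Cons a l)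
  define m where "m = q - Suc (length l)"
  have m: "q - length l = Suc m" using Cons.prems by (simp add: m_def)
  have \<pi>: "\<pi> \<langle>$\<rangle> m = m" "perm_elem \<pi> \<in> free_at m" "\<pi> \<in> sym_group (q - length l)"
    using Cons.prems by (auto simp: m_def sym_group_iff free_at_perm)
  have "perm_elem \<pi> * trace_antisym q (a # l) =
      partial_trace m (perm_elem \<pi> * (factor_elem m a * trace_antisym q l))"
    using \<pi>(2) by (simp add: partial_trace_left m_def)
  also have "perm_elem \<pi> * (factor_elem m a * trace_antisym q l) =
      factor_elem m a * (perm_elem \<pi> * trace_antisym q l)"
    by (simp add: perm_elem_factor_elem \<pi>(1) flip: mult.assoc)
  also have "\<dots> = rat_elem (perm_sign \<pi>) * (factor_elem m a * trace_antisym q l)"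
    using Cons \<pi> by (simp add: coeff_elem_left_commute[of "factor_elem m a"])
  finally show ?case by (simp add: partial_trace_coeff m_def)
qed (simp add: antisymmetrizer_left)

lemma trace_antisym_right:
  assumes "length l \<le> q" "\<pi> \<in> sym_group (q - length l)"
  shows "trace_antisym q l * perm_elem \<pi> = rat_elem (perm_sign \<pi>) * trace_antisym q l"
  using assms
proof (induction l)
  case (Cons a l)
  define m where "m = q - Suc (length l)"
  have \<pi>: "perm_elem \<pi> \<in> free_at m" "\<pi> \<in> sym_group (q - length l)"
    using Cons.prems by (auto simp: m_def sym_group_iff free_at_perm)
  have "trace_antisym q (a # l) * perm_elem \<pi> =
      partial_trace m (factor_elem m a * trace_antisym q l * perm_elem \<pi>)"
    using \<pi>(1) by (simp add: partial_trace_right m_def)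
  also have "factor_elem m a * trace_antisym q l * perm_elem \<pi> =
      rat_elem (perm_sign \<pi>) * (factor_elem m a * trace_antisym q l)"
    using Cons \<pi> by (simp add: coeff_elem_left_commute[of "factor_elem m a"] mult.assoc)
  finally show ?case by (simp add: partial_trace_coeff m_def)
qed (simp add: antisymmetrizer_right)

text \<open>The complete homogeneous symmetric polynomial of degree \<open>i\<close> in
  \<open>c 0, ..., c (n - 1)\<close>. The last argument is split off because the last strand is the
  next one to be closed; its powers stand on the right since the ring need not be
  commutative.\<close>

fun hsum :: "(nat \<Rightarrow> 'a::ring_1) \<Rightarrow> nat \<Rightarrow> nat \<Rightarrow> 'a" where
  "hsum c i 0 = (if i = 0 then 1 else 0)"
| "hsum c i (Suc n) = (\<Sum>f\<le>i. hsum c (i - f) n * c n ^ f)"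

text \<open>Newton's identity between power sums and complete symmetric polynomials. In the
  induction step, the term with the factor \<open>c n ^ f\<close> gets weight \<open>m - f\<close>
  from the summands with \<open>r < n\<close> and weight \<open>f\<close> from those with
  \<open>r = n\<close>.\<close>

lemma hsum_power_sum:
  fixes c :: "nat \<Rightarrow> 'a::ring_1"
  assumes comm: "\<And>r s. c r * c s = c s * c r"
  shows "(\<Sum>r<n. \<Sum>e\<in>{1..m}. hsum c (m - e) n * c r ^ e) = of_nat m * hsum c m n"
proof (induction n arbitrary: m)
  case 0
  show ?case by simp
next
  case (Suc n)
  have pow: "c n ^ f * c r ^ e = c r ^ e * c n ^ f" for f r e
    by (intro power_commuting_commutes[symmetric] power_commuting_commutes comm)
  have "(\<Sum>r<n. \<Sum>e\<in>{1..m}. hsum c (m - e) (Suc n) * c r ^ e) =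
      (\<Sum>r<n. \<Sum>e\<in>{1..m}. \<Sum>f\<le>m - e. hsum c (m - f - e) n * c r ^ e * c n ^ f)"
    by (intro sum.cong refl) (auto simp: sum_distrib_right mult.assoc pow add.commute intro!: sum.cong)
  also have "\<dots> = (\<Sum>r<n. \<Sum>f\<le>m. \<Sum>e\<in>{1..m - f}. hsum c (m - f - e) n * c r ^ e * c n ^ f)"
    unfolding sum.Sigma[OF finite_atLeastAtMost ballI[OF finite_atMost]] sum.Sigma[OF finite_atMost ballI[OF finite_atLeastAtMost]]
    by (intro sum.cong refl sum.reindex_bij_witness[of _ "\<lambda>(e, f). (f, e)" "\<lambda>(e, f). (f, e)"]) auto
  also have "\<dots> = (\<Sum>f\<le>m. (\<Sum>r<n. \<Sum>e\<in>{1..m - f}. hsum c (m - f - e) n * c r ^ e) * c n ^ f)"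
    by (subst sum.swap) (simp add: sum_distrib_right)
  also have "\<dots> = (\<Sum>f\<le>m. of_nat (m - f) * hsum c (m - f) n * c n ^ f)"
    by (simp only: Suc.IH)
  finally have 1: "(\<Sum>r<n. \<Sum>e\<in>{1..m}. hsum c (m - e) (Suc n) * c r ^ e) = \<dots>" .
  have "(\<Sum>e\<in>{1..m}. hsum c (m - e) (Suc n) * c n ^ e) =
      (\<Sum>e\<in>{1..m}. \<Sum>f\<le>m - e. hsum c (m - (e + f)) n * c n ^ (e + f))"
    by (intro sum.cong refl) (auto simp: sum_distrib_right mult.assoc power_add[symmetric] add.commute intro!: sum.cong)
  also have "\<dots> = (\<Sum>g\<le>m. \<Sum>e\<in>{1..g}. hsum c (m - g) n * c n ^ g)"
    unfolding sum.Sigma[OF finite_atLeastAtMost ballI[OF finite_atMost]] sum.Sigma[OF finite_atMost ballI[OF finite_atLeastAtMost]]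
    by (rule sum.reindex_bij_witness[of _ "\<lambda>(g, e). (e, g - e)" "\<lambda>(e, f). (e + f, e)"]) auto
  also have "\<dots> = (\<Sum>g\<le>m. of_nat g * hsum c (m - g) n * c n ^ g)"
    by (simp add: mult.assoc)
  finally have 2: "(\<Sum>e\<in>{1..m}. hsum c (m - e) (Suc n) * c n ^ e) = \<dots>" .
  have "(\<Sum>r<Suc n. \<Sum>e\<in>{1..m}. hsum c (m - e) (Suc n) * c r ^ e) =
      (\<Sum>f\<le>m. of_nat m * (hsum c (m - f) n * c n ^ f))"
    unfolding sum.lessThan_Suc 1 2 sum.distrib[symmetric]
    by (intro sum.cong refl) (auto simp: of_nat_diff mult.assoc simp flip: distrib_right)
  then show ?case by (simp add: sum_distrib_left)
qed

text \<open>The elementary symmetric functions expressed in the power sums \<open>p\<close>, with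
  Newton's identities taken as their definition.\<close>

fun esym :: "(nat \<Rightarrow> trace_ring) \<Rightarrow> nat \<Rightarrow> trace_ring" where
  "esym p 0 = 1"
| "esym p (Suc k) = const_tr (1 / of_nat (Suc k)) * (\<Sum>i\<le>k. (- 1) ^ i * esym p (k - i) * p (Suc i))"

lemma newton: "of_nat (Suc k) * esym p (Suc k) = (\<Sum>i\<le>k. (- 1) ^ i * esym p (k - i) * p (Suc i))"
proof -
  have "of_nat (Suc k) * const_tr (1 / of_nat (Suc k)) = 1"
    by (simp only: const_tr_of_nat[symmetric] const_tr_mult[symmetric]) simp
  then show ?thesis
    by (simp only: esym.simps mult.assoc[symmetric]) simp
qed

text \<open>The bracket in \<open>C_elem\<close> with an arbitrary element \<open>a\<close> for the
  variable and Newton's recursion for the sum over permutations. The two descriptions are matched by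
  \<open>sigma_coeff_eq_esym\<close> and \<open>complete_elem_eq_hsum\<close>.\<close>

definition char_elem :: "free_trace_algebra \<Rightarrow> nat \<Rightarrow> nat \<Rightarrow> twisted_element" where
  "char_elem a k n = (\<Sum>r\<le>k. coeff_elem ((- 1) ^ r * esym (\<lambda>i. trace_coeff (a ^ i)) r)
     * hsum (\<lambda>i. factor_elem i a) (k - r) n)"

lemma factor_elem_commute: "factor_elem i a * factor_elem j a = factor_elem j a * factor_elem i a"
  by (cases "i = j") (auto intro!: factor_elem_commute_free_at free_at_factor)

lemma hsum_factor_free: "n \<le> p \<Longrightarrow> hsum (\<lambda>i. factor_elem i a) k n \<in> free_at p"
proof (induction n arbitrary: k)
  case 0
  then show ?case by (simp add: free_at_zero) (metis coeff_elem_one free_at_coeff)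
next
  case (Suc n)
  have "factor_elem n a ^ f \<in> free_at p" for f
    using Suc.prems free_at_factor[of n p "a ^ f"] by (simp add: factor_elem_power)
  then show ?case using Suc by (auto intro!: free_at_sum free_at_mult)
qed

text \<open>In the factor 1 - \<Sum> (r n) of the antisymmetrizer, the identity closes
  \<open>a ^ Suc e\<close> on strand \<open>n\<close> to its trace, while the transposition with
  \<open>r\<close> moves it to strand \<open>r\<close>. The latter terms add up by
  \<open>hsum_power_sum\<close>.\<close>

lemma partial_trace_hsum_antisymmetrizer:
  fixes a :: free_trace_algebra
  defines "h \<equiv> hsum (\<lambda>i. factor_elem i a)"
  shows "partial_trace n (factor_elem n a * (h i (Suc n) * antisymmetrizer (Suc n))) =
    ((\<Sum>e\<le>i. coeff_elem (trace_coeff (a ^ Suc e)) * h (i - e) n) - of_nat (Suc i) * h (Suc i) n) * antisymmetrizer n"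
proof -
  let ?c = "\<lambda>i. factor_elem i a"
  let ?S = "1 - (\<Sum>r<n. perm_elem \<langle>r \<leftrightarrow> n\<rangle>)"
  have h_free: "h k n \<in> free_at n" for k by (simp add: h_def hsum_factor_free)
  have A_free: "antisymmetrizer n \<in> free_at n"
    using antisymmetrizer_TX[of n] by (simp add: TX_iff_free_at)
  have "factor_elem n a * (h i (Suc n) * antisymmetrizer (Suc n)) =
      (\<Sum>e\<le>i. h (i - e) n * (factor_elem n (a ^ Suc e) * ?S) * antisymmetrizer n)"
  proof -
    have "factor_elem n a * (h (i - e) n * ?c n ^ e) = h (i - e) n * factor_elem n (a ^ Suc e)" for e
      using factor_elem_commute_free_at[OF h_free[of "i - e"], of a]
      by (simp add: factor_elem_power mult.assoc[symmetric] factor_elem_mult)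
    then show ?thesis
      unfolding antisymmetrizer_Suc
      by (simp add: h_def sum_distrib_left sum_distrib_right mult.assoc[symmetric])
  qed
  moreover have "partial_trace n (factor_elem n b * ?S) = coeff_elem (trace_coeff b) - (\<Sum>r<n. factor_elem r b)" for b
    by (simp add: right_diff_distrib partial_trace_diff sum_distrib_left partial_trace_sum
        partial_trace_factor partial_trace_factor_swap)
  ultimately have "partial_trace n (factor_elem n a * (h i (Suc n) * antisymmetrizer (Suc n))) =
      (\<Sum>e\<le>i. h (i - e) n * (coeff_elem (trace_coeff (a ^ Suc e)) - (\<Sum>r<n. factor_elem r (a ^ Suc e))))
        * antisymmetrizer n"
    by (simp add: partial_trace_sum partial_trace_right[OF A_free] partial_trace_left[OF h_free] sum_distrib_right)
  also have "(\<Sum>e\<le>i. h (i - e) n * (coeff_elem (trace_coeff (a ^ Suc e)) - (\<Sum>r<n. factor_elem r (a ^ Suc e)))) =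
      (\<Sum>e\<le>i. coeff_elem (trace_coeff (a ^ Suc e)) * h (i - e) n)
        - (\<Sum>e\<le>i. \<Sum>r<n. h (i - e) n * ?c r ^ Suc e)"
    by (simp only: right_diff_distrib sum_subtractf sum_distrib_left factor_elem_power coeff_elem_commute)
  also have "(\<Sum>e\<le>i. \<Sum>r<n. h (i - e) n * ?c r ^ Suc e) = (\<Sum>r<n. \<Sum>e\<le>i. h (i - e) n * ?c r ^ Suc e)"
    by (rule sum.swap)
  also have "\<dots> = (\<Sum>r<n. \<Sum>e\<in>{1..Suc i}. h (Suc i - e) n * ?c r ^ e)"
    by (intro sum.cong[OF refl] sum.reindex_bij_witness[of _ "\<lambda>e. e - 1" Suc]) auto
  also have "\<dots> = of_nat (Suc i) * h (Suc i) n"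
    unfolding h_def by (rule hsum_power_sum) (rule factor_elem_commute)
  finally show ?thesis .
qed

lemma sum_triangle:
  "(\<Sum>r\<le>j. \<Sum>e\<le>j - r. g r e) = (\<Sum>u\<le>j. \<Sum>e\<le>u. g (u - e) e :: 'a::comm_monoid_add)" for j :: nat
  unfolding sum.Sigma[OF finite_atMost ballI[OF finite_atMost]]
  by (rule sum.reindex_bij_witness[of _ "\<lambda>(u, e). (u - e, e)" "\<lambda>(r, e). (r + e, e)"]) auto

text \<open>Closing produces two sums over the summands of \<open>char_elem a (Suc j) n\<close>: the
  traces combine by Newton's identities to weight -u on the u-th summand, and the complete symmetric
  polynomials contribute -(j + 1 - u). Together this is -(j + 1) for every u.\<close>

lemma partial_trace_char_elem:
  "partial_trace n (factor_elem n a * (char_elem a j (Suc n) * antisymmetrizer (Suc n))) =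
   - of_nat (Suc j) * char_elem a (Suc j) n * antisymmetrizer n"
proof -
  define h where "h = hsum (\<lambda>i. factor_elem i a)"
  define p where "p = (\<lambda>i. trace_coeff (a ^ i))"
  define s where "s = (\<lambda>r. (- 1) ^ r * esym p r)"
  let ?C = coeff_elem
  have char: "char_elem a k m = (\<Sum>r\<le>k. ?C (s r) * h (k - r) m)" for k m
    by (simp add: char_elem_def s_def h_def p_def)
  have "partial_trace n (factor_elem n a * (char_elem a j (Suc n) * antisymmetrizer (Suc n))) =
      (\<Sum>r\<le>j. ?C (s r) * partial_trace n (factor_elem n a * (h (j - r) (Suc n) * antisymmetrizer (Suc n))))"
    by (simp add: char sum_distrib_right sum_distrib_left partial_trace_sum mult.assoc
        coeff_elem_left_commute[of "factor_elem n a"] partial_trace_coeff)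
  also have "\<dots> = (\<Sum>r\<le>j. ?C (s r) * ((\<Sum>e\<le>j - r. ?C (p (Suc e)) * h (j - r - e) n)
      - of_nat (Suc (j - r)) * h (Suc (j - r)) n)) * antisymmetrizer n"
    unfolding h_def partial_trace_hsum_antisymmetrizer p_def by (simp only: sum_distrib_right mult.assoc)
  also have "(\<Sum>r\<le>j. ?C (s r) * ((\<Sum>e\<le>j - r. ?C (p (Suc e)) * h (j - r - e) n)
      - of_nat (Suc (j - r)) * h (Suc (j - r)) n)) =
     (\<Sum>r\<le>j. \<Sum>e\<le>j - r. ?C (s r * p (Suc e)) * h (j - (r + e)) n)
     - (\<Sum>r\<le>j. of_nat (Suc j - r) * (?C (s r) * h (Suc j - r) n))"
    unfolding sum_subtractf[symmetric]
  proof (intro sum.cong refl)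
    fix r assume r: "r \<in> {..j}"
    have "?C (s r) * (\<Sum>e\<le>j - r. ?C (p (Suc e)) * h (j - r - e) n) =
        (\<Sum>e\<le>j - r. ?C (s r * p (Suc e)) * h (j - (r + e)) n)"
      by (simp add: sum_distrib_left coeff_elem_mult mult.assoc)
    moreover have "?C (s r) * (of_nat (Suc (j - r)) * h (Suc (j - r)) n) =
        of_nat (Suc j - r) * (?C (s r) * h (Suc j - r) n)"
      using r coeff_elem_left_commute[of "?C (s r)" "of_nat (Suc (j - r))" "h (Suc (j - r)) n"]
      by (simp only: coeff_elem_of_nat atMost_iff Suc_diff_le)
    ultimately show "?C (s r) * ((\<Sum>e\<le>j - r. ?C (p (Suc e)) * h (j - r - e) n)
        - of_nat (Suc (j - r)) * h (Suc (j - r)) n) =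
        (\<Sum>e\<le>j - r. ?C (s r * p (Suc e)) * h (j - (r + e)) n) - of_nat (Suc j - r) * (?C (s r) * h (Suc j - r) n)"
      by (simp only: right_diff_distrib)
  qed
  also have "(\<Sum>r\<le>j. \<Sum>e\<le>j - r. ?C (s r * p (Suc e)) * h (j - (r + e)) n) =
      (\<Sum>u\<le>j. ?C (\<Sum>e\<le>u. s (u - e) * p (Suc e)) * h (j - u) n)"
    unfolding coeff_elem_sum sum_distrib_right sum_triangle by (intro sum.cong refl) simp
  also have "\<dots> = (\<Sum>u\<le>j. - of_nat (Suc u) * (?C (s (Suc u)) * h (j - u) n))"
  proof (intro sum.cong refl)
    fix u
    have "(\<Sum>e\<le>u. s (u - e) * p (Suc e)) = (- 1) ^ u * (\<Sum>e\<le>u. (- 1) ^ e * esym p (u - e) * p (Suc e))"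
      unfolding sum_distrib_left s_def
    proof (intro sum.cong refl)
      fix e assume "e \<in> {..u}"
      then have "u = (u - e) + e" by simp
      then have "(- 1 :: trace_ring) ^ u * (- 1) ^ e = (- 1) ^ (u - e) * (- 1) ^ e * (- 1) ^ e"
        by (metis power_add)
      then have "(- 1 :: trace_ring) ^ u * (- 1) ^ e = (- 1) ^ (u - e)"
        by (simp add: mult.assoc)
      then show "(- 1) ^ (u - e) * esym p (u - e) * p (Suc e) = (- 1) ^ u * ((- 1) ^ e * esym p (u - e) * p (Suc e))"
        by (simp add: mult.assoc[symmetric])
    qed
    also have "\<dots> = - of_nat (Suc u) * s (Suc u)"
    proof -
      have "(- 1) ^ u * (x * y) = - x * ((- 1) ^ Suc u * y)" for x y :: trace_ring
        by (simp add: mult_ac)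
      then show ?thesis unfolding newton[symmetric] s_def .
    qed
    finally show "?C (\<Sum>e\<le>u. s (u - e) * p (Suc e)) * h (j - u) n = - of_nat (Suc u) * (?C (s (Suc u)) * h (j - u) n)"
      by (simp only: coeff_elem_mult coeff_elem_uminus coeff_elem_of_nat mult.assoc)
  qed
  \<comment> \<open>Both sums can be taken over all u \<le> j + 1: the missing summand, u = 0 here
    and u = j + 1 in the other sum, has weight 0.\<close>
  also have "\<dots> = (\<Sum>u\<le>Suc j. - of_nat u * (?C (s u) * h (Suc j - u) n))"
    by (simp only: sum.atMost_Suc_shift) simp
  also have "(\<Sum>r\<le>j. of_nat (Suc j - r) * (?C (s r) * h (Suc j - r) n)) =
      (\<Sum>r\<le>Suc j. of_nat (Suc j - r) * (?C (s r) * h (Suc j - r) n))"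
    by simp
  also have "(\<Sum>u\<le>Suc j. - of_nat u * (?C (s u) * h (Suc j - u) n)) - \<dots> =
      - of_nat (Suc j) * char_elem a (Suc j) n"
    unfolding char sum_distrib_left sum_subtractf[symmetric]
    by (intro sum.cong refl) (auto simp: of_nat_diff algebra_simps)
  finally show ?thesis .
qed

text \<open>Closing a strand when j strands are already closed contributes the factor -(j + 1);
  these factors multiply to (-1)^k k!.\<close>

lemma trace_antisym_replicate:
  "k \<le> q \<Longrightarrow> trace_antisym q (replicate k a) =
    rat_elem ((- 1) ^ k * fact k) * (char_elem a k (q - k) * antisymmetrizer (q - k))"
proof (induction k)
  case 0
  have "hsum (\<lambda>i. factor_elem i a) 0 n = 1" for n
    by (induction n) simp_all
  then show ?case by (simp add: char_elem_def)
next
  case (Suc k)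
  define n where "n = q - Suc k"
  have n: "q - k = Suc n" using Suc.prems by (simp add: n_def)
  have "trace_antisym q (replicate (Suc k) a) = partial_trace n (factor_elem n a * trace_antisym q (replicate k a))"
    by (simp add: n_def)
  also have "\<dots> = rat_elem ((- 1) ^ k * fact k) *
      partial_trace n (factor_elem n a * (char_elem a k (Suc n) * antisymmetrizer (Suc n)))"
    using Suc by (simp add: n coeff_elem_left_commute[of "factor_elem n a"] partial_trace_coeff)
  also have "\<dots> = rat_elem ((- 1) ^ k * fact k) * rat_elem (- of_nat (Suc k)) * (char_elem a (Suc k) n * antisymmetrizer n)"
    by (simp only: partial_trace_char_elem const_tr_uminus coeff_elem_uminus rat_elem_of_nat mult.assoc)
  also have "rat_elem ((- 1) ^ k * fact k) * rat_elem (- of_nat (Suc k)) = rat_elem ((- 1) ^ Suc k * fact (Suc k))"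
    by (simp add: algebra_simps flip: coeff_elem_mult const_tr_mult)
  finally show ?case by (simp add: n_def)
qed

section \<open>The generating identities as closed antisymmetrizers\<close>

lemma apply_bypass: "(\<langle>r \<leftrightarrow> \<sigma> \<langle>$\<rangle> r\<rangle> * \<sigma>) \<langle>$\<rangle> j =
    (if j = r then r else if \<sigma> \<langle>$\<rangle> j = r then \<sigma> \<langle>$\<rangle> r else \<sigma> \<langle>$\<rangle> j)"
  by (auto simp: apply_times apply_swap apply_inj)

lemma orbit_closed: "j \<in> orbit \<sigma> i \<Longrightarrow> \<sigma> \<langle>$\<rangle> j \<in> orbit \<sigma> i"
  by (metis apply_self_in_orbit orbit_equiv)

text \<open>The new permutation jumps over \<open>r\<close> and otherwise follows
  \<open>\<sigma>\<close>, so a cycle can only lose the point \<open>r\<close>.\<close>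

lemma orbit_bypass:
  assumes "i \<noteq> r"
  shows "orbit (\<langle>r \<leftrightarrow> \<sigma> \<langle>$\<rangle> r\<rangle> * \<sigma>) i = orbit \<sigma> i - {r}"
proof -
  define \<sigma>' where "\<sigma>' = \<langle>r \<leftrightarrow> \<sigma> \<langle>$\<rangle> r\<rangle> * \<sigma>"
  have \<sigma>': "\<sigma>' \<langle>$\<rangle> j = (if j = r then r else if \<sigma> \<langle>$\<rangle> j = r then \<sigma> \<langle>$\<rangle> r else \<sigma> \<langle>$\<rangle> j)" for j
    unfolding \<sigma>'_def by (rule apply_bypass)
  have "(\<sigma>' ^ n) \<langle>$\<rangle> i \<in> orbit \<sigma> i - {r}" for n
  proof (induction n)
    case 0
    show ?case using assms by simp
  next
    case (Suc n)
    let ?y = "(\<sigma>' ^ n) \<langle>$\<rangle> i"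
    have "(\<sigma>' ^ Suc n) \<langle>$\<rangle> i = \<sigma>' \<langle>$\<rangle> ?y" by (simp add: apply_times)
    moreover have "\<sigma> \<langle>$\<rangle> ?y \<in> orbit \<sigma> i" using Suc by (auto intro: orbit_closed)
    moreover have "\<sigma> \<langle>$\<rangle> ?y = r \<Longrightarrow> \<sigma> \<langle>$\<rangle> r \<in> orbit \<sigma> i - {r}"
      using Suc calculation(2) by (auto intro: orbit_closed) (metis apply_inj)
    ultimately show ?case using Suc by (auto simp: \<sigma>')
  qed
  then have 1: "orbit \<sigma>' i \<subseteq> orbit \<sigma> i - {r}" unfolding orbit_def[of \<sigma>'] by blast
  \<comment> \<open>While the walk along \<open>\<sigma>\<close> stands at \<open>r\<close>, the
    bypassing walk is one step ahead; the invariant therefore records \<sigma>(r) at that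
    moment.\<close>
  have "(if (\<sigma> ^ n) \<langle>$\<rangle> i = r then \<sigma> \<langle>$\<rangle> r else (\<sigma> ^ n) \<langle>$\<rangle> i) \<in> orbit \<sigma>' i" for n
  proof (induction n)
    case 0
    show ?case using assms by simp
  next
    case (Suc n)
    let ?y = "(\<sigma> ^ n) \<langle>$\<rangle> i"
    have y: "(\<sigma> ^ Suc n) \<langle>$\<rangle> i = \<sigma> \<langle>$\<rangle> ?y" by (simp add: apply_times)
    show ?case
    proof (cases "?y = r")
      case True
      then show ?thesis using Suc y by auto
    next
      case False
      then have "?y \<in> orbit \<sigma>' i" using Suc by simp
      then have "\<sigma>' \<langle>$\<rangle> ?y \<in> orbit \<sigma>' i" by (rule orbit_closed)
      then show ?thesis using False y by (auto simp: \<sigma>')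
    qed
  qed
  then have "(\<sigma> ^ n) \<langle>$\<rangle> i \<noteq> r \<Longrightarrow> (\<sigma> ^ n) \<langle>$\<rangle> i \<in> orbit \<sigma>' i" for n
    by presburger
  then have 2: "orbit \<sigma> i - {r} \<subseteq> orbit \<sigma>' i" unfolding orbit_def[of \<sigma>] by blast
  from 1 2 show ?thesis unfolding \<sigma>'_def by blast
qed

fun closure_trace :: "nat \<Rightarrow> twisted_element \<Rightarrow> twisted_element" where
  "closure_trace 0 z = z"
| "closure_trace (Suc r) z = closure_trace r (partial_trace r z)"

lemma closure_trace_add: "closure_trace r (a + b) = closure_trace r a + closure_trace r b"
  by (induction r arbitrary: a b) (simp_all add: partial_trace_add)

lemma closure_trace_zero [simp]: "closure_trace r 0 = 0"
  by (induction r) simp_all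

lemma closure_trace_sum: "closure_trace r (sum f I) = (\<Sum>i\<in>I. closure_trace r (f i))"
  by (induction I rule: infinite_finite_induct) (simp_all add: closure_trace_add)

lemma orbit_sym_group: "\<sigma> \<in> sym_group r \<Longrightarrow> i < r \<Longrightarrow> orbit \<sigma> i \<subseteq> {..<r}"
proof -
  assume \<sigma>: "\<sigma> \<in> sym_group r" and i: "i < r"
  have "(\<sigma> ^ n) \<langle>$\<rangle> i < r" for n
    by (induction n) (simp_all add: i apply_times sym_group_less[OF \<sigma>])
  then show ?thesis by (auto simp: orbit_def)
qed

text \<open>Closing strand \<open>r\<close> removes \<open>r\<close> from its cycle and hands its
  exponent to \<open>k\<close>, which lies in the same cycle, so exponent sums over cycles are kept.
  Only a fixed point \<open>r\<close> is split off as a factor of its own.\<close>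

lemma prod_cycle_supports_bypass:
  fixes h :: "nat \<Rightarrow> nat" and f :: "nat \<Rightarrow> 'a::comm_monoid_mult"
  assumes \<sigma>: "\<sigma> \<in> sym_group (Suc r)"
  defines "k \<equiv> \<sigma> \<langle>$\<rangle> r"
  defines "\<sigma>' \<equiv> \<langle>r \<leftrightarrow> k\<rangle> * \<sigma>"
  defines "h' \<equiv> \<lambda>j. if j = r then 0 else if j = k then h j + h r else h j"
  shows "(\<Prod>C\<in>cycle_supports (Suc r) \<sigma>. f (\<Sum>j\<in>C. h j)) =
    (if k = r then f (h r) else 1) * (\<Prod>C\<in>cycle_supports r \<sigma>'. f (\<Sum>j\<in>C. h' j ))"
proof (cases "k = r")
  case True
  have orb: "orbit \<sigma> r = {r}"
    using True by (simp add: k_def in_affected flip: not_in_affected_iff_orbit_eq_singleton)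
  have notin: "r \<notin> C" if "C \<in> cycle_supports r \<sigma>" for C
  proof
    assume "r \<in> C"
    with that obtain i where i: "i < r" "r \<in> orbit \<sigma> i" by (auto simp: cycle_supports_def)
    then have "orbit \<sigma> i = {r}" using orbit_equiv orb by metis
    then show False using i(1) in_orbit_self[of i \<sigma>] by simp
  qed
  have cs: "cycle_supports (Suc r) \<sigma> = insert {r} (cycle_supports r \<sigma>)"
    by (simp add: cycle_supports_def lessThan_Suc orb)
  have "{r} \<notin> cycle_supports r \<sigma>" using notin by blast
  moreover have "finite (cycle_supports r \<sigma>)" by (simp add: cycle_supports_def)
  moreover have "(\<Sum>j\<in>C. h j) = (\<Sum>j\<in>C. h' j)" if "C \<in> cycle_supports r \<sigma>" for C
    using notin[OF that] True by (intro sum.cong) (auto simp: h'_def)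
  moreover have "\<sigma>' = \<sigma>" using True by (simp add: \<sigma>'_def)
  ultimately show ?thesis using True by (simp add: cs)
next
  case False
  have kr: "k < r" using sym_group_less[OF \<sigma>, of r] False by (simp add: k_def)
  have "orbit \<sigma> r = orbit \<sigma> k" by (simp add: k_def)
  then have cs: "cycle_supports (Suc r) \<sigma> = orbit \<sigma> ` {..<r}"
    using kr by (auto simp: cycle_supports_def lessThan_Suc)
  have cs': "cycle_supports r \<sigma>' = (\<lambda>C. C - {r}) ` cycle_supports (Suc r) \<sigma>"
    unfolding cs unfolding cycle_supports_def image_image \<sigma>'_def k_def
    by (intro image_cong refl orbit_bypass) simp
  have rk: "r \<in> C \<longleftrightarrow> k \<in> C" if C_in: "C \<in> cycle_supports (Suc r) \<sigma>" for C
  proof -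
    obtain i where C: "C = orbit \<sigma> i" using C_in by (auto simp: cycle_supports_def)
    show ?thesis
      unfolding C by (metis C apply_inverse_self_in_orbit apply_inverse_apply(1) k_def orbit_closed orbit_equiv)
  qed
  have inj: "inj_on (\<lambda>C. C - {r}) (cycle_supports (Suc r) \<sigma>)"
  proof (rule inj_onI)
    fix C D assume C: "C \<in> cycle_supports (Suc r) \<sigma>" and D: "D \<in> cycle_supports (Suc r) \<sigma>"
      and eq: "C - {r} = D - {r}"
    obtain i where i: "C = orbit \<sigma> i" "i < r" using C by (auto simp: cs)
    then have "i \<in> C - {r}" by simp
    then have "i \<in> D" using eq by blast
    moreover obtain j where "D = orbit \<sigma> j" using D by (auto simp: cs)
    ultimately show "C = D" using i orbit_equiv by metis
  qed
  have sum: "(\<Sum>j\<in>C - {r}. h' j) = (\<Sum>j\<in>C. h j)" if C: "C \<in> cycle_supports (Suc r) \<sigma>" for C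
  proof -
    have fin: "finite C" using C by (auto simp: cycle_supports_def)
    show ?thesis
    proof (cases "r \<in> C")
      case True
      then have k: "k \<in> C - {r}" using rk[OF C] False by simp
      have "(\<Sum>j\<in>C - {r}. h' j) = h' k + (\<Sum>j\<in>C - {r} - {k}. h' j)"
        using fin k by (intro sum.remove) auto
      also have "(\<Sum>j\<in>C - {r} - {k}. h' j) = (\<Sum>j\<in>C - {r} - {k}. h j)"
        by (rule sum.cong) (auto simp: h'_def)
      also have "h' k + \<dots> = h r + (h k + \<dots>)" using False by (simp add: h'_def)
      also have "h k + (\<Sum>j\<in>C - {r} - {k}. h j) = (\<Sum>j\<in>C - {r}. h j)"
        using fin k by (intro sum.remove[symmetric]) auto
      also have "h r + \<dots> = (\<Sum>j\<in>C. h j)"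
        using fin True by (intro sum.remove[symmetric])
      finally show ?thesis .
    next
      case r: False
      then have "k \<notin> C" using rk[OF C] by simp
      with r show ?thesis by (intro sum.cong) (auto simp: h'_def)
    qed
  qed
  have "(\<Prod>C\<in>cycle_supports r \<sigma>'. f (\<Sum>j\<in>C. h' j)) =
      (\<Prod>C\<in>cycle_supports (Suc r) \<sigma>. f (\<Sum>j\<in>C - {r}. h' j))"
    unfolding cs' by (simp add: prod.reindex[OF inj])
  then show ?thesis using False by (simp add: sum)
qed

text \<open>Powers of one variable commute, so a cycle closes to the trace of the power given by its
  total exponent.\<close>

lemma closure_trace_single:
  "\<sigma> \<in> sym_group r \<Longrightarrow> (\<And>j. r \<le> j \<Longrightarrow> h j = 0) \<Longrightarrow>
   closure_trace r (Poly_Mapping.single (TMon (\<lambda>j. var_power x (h j)) \<sigma>) c) =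
   coeff_elem (c * (\<Prod>C\<in>cycle_supports r \<sigma>. tr_monomial (var_power x (\<Sum>j\<in>C. h j))))"
proof (induction r arbitrary: \<sigma> h c)
  case 0
  then have "TMon (\<lambda>j. var_power x (h j)) \<sigma> = 0"
    by (auto simp: sym_group_0 zero_tensor_monomial_def zero_monomial_def)
  then show ?case by (simp add: cycle_supports_def coeff_elem_def)
next
  case (Suc r)
  define k where "k = \<sigma> \<langle>$\<rangle> r"
  define h' where "h' = (\<lambda>j. if j = r then 0 else if j = k then h j + h r else h j)"
  let ?t = "TMon (\<lambda>j. var_power x (h j)) \<sigma>"
  have mon: "ptr_mon r ?t = TMon (\<lambda>j. var_power x (h' j)) (\<langle>r \<leftrightarrow> k\<rangle> * \<sigma>)"
    by (auto simp: ptr_mon_def k_def h'_def plus_monomial_def zero_monomial_def replicate_add)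
  have coeff: "ptr_coeff r ?t = (if k = r then tr_monomial (var_power x (h r)) else 1)"
    by (simp add: ptr_coeff_def k_def)
  have \<sigma>': "\<langle>r \<leftrightarrow> k\<rangle> * \<sigma> \<in> sym_group r"
    unfolding sym_group_iff
  proof (intro allI impI)
    fix i assume "r \<le> i"
    show "(\<langle>r \<leftrightarrow> k\<rangle> * \<sigma>) \<langle>$\<rangle> i = i"
      using Suc.prems(1) \<open>r \<le> i\<close> unfolding k_def apply_bypass
      by (cases "i = r") (auto simp: sym_group_iff)
  qed
  have h': "h' j = 0" if "r \<le> j" for j
    using that Suc.prems(2)[of j] sym_group_less[OF Suc.prems(1), of r]
    by (cases "j = r") (auto simp: h'_def k_def)
  show ?case
    by (simp add: partial_trace_single mon coeff Suc.IH[OF \<sigma>' h'] mult.assoc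
        prod_cycle_supports_bypass[OF Suc.prems(1), where f = "\<lambda>i. tr_monomial (var_power x i)" and h = h,
          folded k_def, folded h'_def])
qed

section \<open>Characteristic coefficients as elementary symmetric functions\<close>

abbreviation var :: "nat \<Rightarrow> free_trace_algebra" where
  "var x \<equiv> Poly_Mapping.single (Mon [x]) 1"

lemma factor_elem_var: "factor_elem p (var x) = pos_elem p (Mon [x])"
  by (simp add: factor_elem_single)

lemma var_power: "var x ^ k = Poly_Mapping.single (var_power x k) 1"
proof (induction k)
  case 0
  have "Mon [] = 0" by (simp add: zero_monomial_def)
  then show ?case by simp
qed (simp add: mult_single plus_monomial_def)

lemma trace_coeff_var_power: "trace_coeff (var x ^ k) = tr_monomial (var_power x k)"
  by (simp add: var_power trace_coeff_single)

lemma tensor_elem_Suc: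
  assumes "\<And>j. n \<le> j \<Longrightarrow> u j = 0"
  shows "tensor_elem (u(n := M)) = tensor_elem u * pos_elem n M"
  using assms
  by (auto simp: tensor_elem_def pos_elem_def pos_monomial_def mult_single plus_tensor_monomial_def
      intro!: arg_cong[where f = "\<lambda>u. Poly_Mapping.single (TMon u 1) 1"])

text \<open>The full closure of the antisymmetrizer on r strands, each carrying x, is computed in
  two ways. Permutation by permutation it is the sum over cycle types, that is r! times
  \<open>sigma_coeff r x\<close>. Strand by strand it is (-1)^r r! times
  \<open>char_elem (var x) r 0\<close>, whose only nonzero summand is (-1)^r times the Newton
  expression.\<close>

lemma sigma_coeff_eq_esym: "sigma_coeff r x = esym (\<lambda>i. tr_monomial (var_power x i)) r"
proof -
  define X where "X m = tensor_elem (\<lambda>j. var_power x (if j < m then 1 else 0))" for m :: nat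
  have X_Suc: "X (Suc m) = X m * pos_elem m (Mon [x])" for m
  proof -
    have "(\<lambda>j. var_power x (if j < Suc m then 1 else 0)) =
        (\<lambda>j. var_power x (if j < m then 1 else 0))(m := Mon [x])"
      by auto
    then show ?thesis
      unfolding X_def by (simp only:) (rule tensor_elem_Suc, simp add: zero_monomial_def)
  qed
  have X_free: "X m \<in> free_at m" for m
    by (simp add: X_def tensor_elem_def free_at_single fixes_pos_def zero_monomial_def)
  have closing: "k \<le> r \<Longrightarrow> closure_trace r (X r * antisymmetrizer r) =
      closure_trace (r - k) (X (r - k) * trace_antisym r (replicate k (var x)))" for k
  proof (induction k)
    case (Suc k)
    define m where "m = r - Suc k"
    have m: "r - k = Suc m" using Suc.prems by (simp add: m_def)
    have "closure_trace (Suc m) (X (Suc m) * trace_antisym r (replicate k (var x))) =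
        closure_trace m (X m * trace_antisym r (replicate (Suc k) (var x)))"
      by (simp add: X_Suc mult.assoc partial_trace_left[OF X_free] m_def[symmetric] factor_elem_var)
    then show ?case using Suc by (simp add: m m_def)
  qed simp
  have "rat_elem (fact r) * coeff_elem (sigma_coeff r x) =
      coeff_elem (\<Sum>\<sigma>\<in>sym_group r. const_tr (perm_sign \<sigma>) * t_perm r \<sigma> x)"
    by (simp add: sigma_coeff_def const_tr_mult[symmetric] mult.assoc[symmetric] flip: coeff_elem_mult)
  also have "\<dots> = closure_trace r (X r * antisymmetrizer r)"
  proof -
    have "closure_trace r (X r * (rat_elem (perm_sign \<sigma>) * perm_elem \<sigma>)) =
        coeff_elem (const_tr (perm_sign \<sigma>) * t_perm r \<sigma> x)" if \<sigma>: "\<sigma> \<in> sym_group r" for \<sigma>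
    proof -
      have "(\<Sum>j\<in>C. if j < r then 1 else 0 :: nat) = card C" if "C \<in> cycle_supports r \<sigma>" for C
      proof -
        have "C \<subseteq> {..<r}" using that orbit_sym_group[OF \<sigma>] by (force simp: cycle_supports_def)
        then have "(\<Sum>j\<in>C. if j < r then 1 else 0 :: nat) = (\<Sum>j\<in>C. 1)" by (intro sum.cong) auto
        then show ?thesis by simp
      qed
      moreover have "X r * (rat_elem (perm_sign \<sigma>) * perm_elem \<sigma>) = Poly_Mapping.single
          (TMon (\<lambda>j. var_power x (if j < r then 1 else 0)) \<sigma>) (const_tr (perm_sign \<sigma>))"
        by (simp add: X_def tensor_elem_def perm_elem_def coeff_elem_mult_single mult_single plus_tensor_monomial_def
            flip: zero_monomial_def)
      ultimately show ?thesis
        using closure_trace_single[OF \<sigma>, of "\<lambda>j. if j < r then 1 else 0" x "const_tr (perm_sign \<sigma>)"]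
        by (simp add: t_perm_def)
    qed
    then show ?thesis
      by (simp add: antisymmetrizer_def sum_distrib_left closure_trace_sum coeff_elem_sum)
  qed
  also have "\<dots> = trace_antisym r (replicate r (var x))"
    using closing[of r] by (simp add: X_def tensor_elem_def flip: zero_monomial_def zero_tensor_monomial_def)
  also have "\<dots> = rat_elem ((- 1) ^ r * fact r) * char_elem (var x) r 0"
    by (simp add: trace_antisym_replicate)
  also have "char_elem (var x) r 0 = (\<Sum>j\<le>r. if j = r
      then coeff_elem ((- 1) ^ r * esym (\<lambda>i. tr_monomial (var_power x i)) r) else 0)"
    unfolding char_elem_def trace_coeff_var_power by (intro sum.cong) auto
  also have "\<dots> = rat_elem ((- 1) ^ r) * coeff_elem (esym (\<lambda>i. tr_monomial (var_power x i)) r)"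
    by (cases "even r") (simp_all add: const_tr_uminus coeff_elem_uminus)
  finally have eq: "rat_elem (fact r) * coeff_elem (sigma_coeff r x) = rat_elem ((- 1) ^ r * fact r) *
      (rat_elem ((- 1) ^ r) * coeff_elem (esym (\<lambda>i. tr_monomial (var_power x i)) r))" .
  have "rat_elem (fact r) * coeff_elem (sigma_coeff r x) =
      rat_elem (fact r) * coeff_elem (esym (\<lambda>i. tr_monomial (var_power x i)) r)"
  proof -
    have "(- 1) ^ r * fact r * (- 1) ^ r = (fact r :: rat)" by (cases "even r") simp_all
    then show ?thesis
      using eq by (simp only: mult.assoc[symmetric] coeff_elem_mult[symmetric] const_tr_mult[symmetric])
  qed
  then have "rat_elem (1 / fact r) * (rat_elem (fact r) * coeff_elem (sigma_coeff r x)) =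
      rat_elem (1 / fact r) * (rat_elem (fact r) * coeff_elem (esym (\<lambda>i. tr_monomial (var_power x i)) r))"
    by simp
  then show ?thesis
    by (simp add: mult.assoc[symmetric] coeff_elem_inject flip: coeff_elem_mult const_tr_mult)
qed

lemma exponents_0: "exponents i 0 = (if i = 0 then {\<lambda>_. 0} else {})"
  by (auto simp: exponents_def)

lemma sum_exponents_Suc:
  "(\<Sum>h\<in>exponents i (Suc n). f h) = (\<Sum>e\<le>i. \<Sum>h\<in>exponents (i - e) n. f (h(n := e)) :: 'a::comm_monoid_add)"
  unfolding sum.Sigma[OF finite_atMost ballI[OF finite_exponents]]
  by (rule sum.reindex_bij_witness[of _ "\<lambda>(e, h). h(n := e)" "\<lambda>h. (h n, h(n := 0))"])
    (auto simp: exponents_def fun_eq_iff)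

lemma hsum_exponents: "hsum c i n = (\<Sum>h\<in>exponents i n. prod_list (map (\<lambda>j. c j ^ h j) [0..<n]))"
proof (induction n arbitrary: i)
  case (Suc n)
  have *: "map (\<lambda>j. c j ^ (h(n := e)) j) [0..<n] = map (\<lambda>j. c j ^ h j) [0..<n]" for h e
    by simp
  show ?case by (simp add: sum_exponents_Suc Suc.IH sum_distrib_right * del: fun_upd_apply) simp
qed (simp add: exponents_0)

lemma complete_elem_eq_hsum: "complete_elem i n x = hsum (\<lambda>j. factor_elem j (var x)) i n"
proof (induction n arbitrary: i)
  case 0
  have "tensor_elem (\<lambda>j. Mon []) = 1"
    by (simp add: tensor_elem_def flip: zero_monomial_def zero_tensor_monomial_def)
  then show ?case by (simp add: complete_elem_def exponents_0)
next
  case (Suc n)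
  have "tensor_elem (\<lambda>j. var_power x ((h(n := e)) j)) = tensor_elem (\<lambda>j. var_power x (h j)) * factor_elem n (var x) ^ e"
    if "h \<in> exponents k n" for h k e
  proof -
    have "(\<lambda>j. var_power x ((h(n := e)) j)) = (\<lambda>j. var_power x (h j))(n := var_power x e)" by auto
    moreover have "factor_elem n (var x) ^ e = pos_elem n (var_power x e)"
      unfolding factor_elem_power[symmetric] var_power by (simp add: factor_elem_single)
    ultimately show ?thesis
      using that by (simp only:) (rule tensor_elem_Suc, simp add: exponents_def zero_monomial_def)
  qed
  then show ?case
    by (simp add: complete_elem_def sum_exponents_Suc Suc.IH[symmetric] sum_distrib_right del: fun_upd_apply)
qed

lemma complete_elem_commute_perm:
  assumes \<tau>: "\<tau> \<in> sym_group n"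
  shows "perm_elem \<tau> * complete_elem i n x = complete_elem i n x * perm_elem \<tau>"
proof -
  have *: "(\<lambda>j. h (\<rho> \<langle>$\<rangle> j)) \<in> exponents i n" if h: "h \<in> exponents i n" and \<rho>: "\<rho> \<in> sym_group n" for h \<rho>
  proof -
    have "(\<Sum>j<n. h (\<rho> \<langle>$\<rangle> j)) = (\<Sum>j<n. h j)"
      using \<rho> sym_group_inverse[OF \<rho>]
      by (intro sum.reindex_bij_witness[of _ "\<lambda>j. inverse \<rho> \<langle>$\<rangle> j" "\<lambda>j. \<rho> \<langle>$\<rangle> j"])
        (auto simp: sym_group_less)
    then show ?thesis using h \<rho> by (auto simp: exponents_def sym_group_iff)
  qed
  have "perm_elem \<tau> * complete_elem i n x =
      (\<Sum>h\<in>exponents i n. tensor_elem (\<lambda>j. var_power x (h (inverse \<tau> \<langle>$\<rangle> j)))) * perm_elem \<tau>"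
    by (simp add: complete_elem_def sum_distrib_left sum_distrib_right perm_elem_tensor_elem)
  also have "(\<Sum>h\<in>exponents i n. tensor_elem (\<lambda>j. var_power x (h (inverse \<tau> \<langle>$\<rangle> j)))) = complete_elem i n x"
    unfolding complete_elem_def
    by (rule sum.reindex_bij_witness[of _ "\<lambda>h j. h (\<tau> \<langle>$\<rangle> j)" "\<lambda>h j. h (inverse \<tau> \<langle>$\<rangle> j)"])
      (auto simp: * \<tau> sym_group_inverse)
  finally show ?thesis .
qed

text \<open>The antisymmetrizer stands on the left in \<open>C_elem\<close>, but commutes with the
  bracket, which is symmetric in the strands. For k = d + 1 no strand is left, and
  \<open>hsum\<close> on zero strands keeps only the summand with the full characteristic
  coefficient.\<close>

lemma C_elem_eq_char_elem:
  assumes "k \<le> d + 1"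
  shows "C_elem k d x = char_elem (var x) k (d + 1 - k) * antisymmetrizer (d + 1 - k)"
proof -
  let ?n = "d + 1 - k"
  have minus_power: "coeff_elem ((- 1) ^ j * c) = (- 1) ^ j * coeff_elem c" for j c
    by (cases "even j") (simp_all add: coeff_elem_uminus)
  have char: "char_elem (var x) k n =
      (\<Sum>j\<le>k. (- 1) ^ j * coeff_elem (sigma_coeff j x) * complete_elem (k - j) n x)" for n
    by (simp add: char_elem_def trace_coeff_var_power sigma_coeff_eq_esym complete_elem_eq_hsum minus_power)
  show ?thesis
  proof (cases "k \<le> d")
    case True
    have comm: "antisymmetrizer n * char_elem (var x) k n = char_elem (var x) k n * antisymmetrizer n" for n
    proof -
      have "perm_elem \<tau> * char_elem (var x) k n = char_elem (var x) k n * perm_elem \<tau>" if "\<tau> \<in> sym_group n" for \<tau>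
        unfolding char_elem_def complete_elem_eq_hsum[symmetric] sum_distrib_left sum_distrib_right
        by (intro sum.cong refl)
          (simp only: coeff_elem_left_commute[of "perm_elem \<tau>"] complete_elem_commute_perm[OF that] mult.assoc)
      then show ?thesis
        by (simp add: antisymmetrizer_def sum_distrib_left sum_distrib_right mult.assoc
            coeff_elem_left_commute[of "char_elem (var x) k n"])
    qed
    have eq: "char_elem (var x) k ?n = complete_elem k ?n x
        + (\<Sum>j = 1..k. (- 1) ^ j * coeff_elem (sigma_coeff j x) * complete_elem (k - j) ?n x)"
      unfolding char by (simp add: sigma_coeff_eq_esym atMost_atLeast0 sum.atLeast_Suc_atMost)
    show ?thesis
      using comm[of ?n] by (simp only: C_elem_def True if_True eq[symmetric])
  next
    case False
    then have k: "k = d + 1" using assms by simp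
    have "char_elem (var x) k 0 = (\<Sum>j\<le>k. if j = k then (- 1) ^ k * coeff_elem (sigma_coeff k x) else 0)"
      unfolding char complete_elem_eq_hsum by (intro sum.cong) auto
    then show ?thesis using k by (simp add: C_elem_def)
  qed
qed

section \<open>Substituting one element for all variables\<close>

lemma cyc_length_abs: "length (letters (rep_cyc_monomial (abs_cyc_monomial M))) = length (letters M)"
proof -
  have "cyc_equiv (rep_cyc_monomial (abs_cyc_monomial M)) M"
    using Quotient3_rep_abs[OF Quotient3_cyc_monomial, of M] equivp_reflp[OF equivp_cyc_equiv] by blast
  then show ?thesis by (auto simp: cyc_equiv_def plus_monomial_def)
qed

text \<open>The action on the trace ring of the endomorphism sending every variable to
  \<open>a\<close>. A word then matters only through its length, which is invariant under rotation,
  so any representative of the cyclic class may be used.\<close>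

definition subst_coeff :: "free_trace_algebra \<Rightarrow> trace_ring \<Rightarrow> trace_ring" where
  "subst_coeff a c = (\<Sum>m\<in>Poly_Mapping.keys c. const_tr (Poly_Mapping.lookup c m) *
     prod_mset (image_mset (\<lambda>y. trace_coeff (a ^ length (letters (rep_cyc_monomial y)))) m))"

definition subst_all :: "free_trace_algebra \<Rightarrow> free_trace_algebra \<Rightarrow> free_trace_algebra" where
  "subst_all a f = (\<Sum>M\<in>Poly_Mapping.keys f.
     Poly_Mapping.single 0 (subst_coeff a (Poly_Mapping.lookup f M)) * a ^ length (letters M))"

lemma subst_coeff_add: "subst_coeff a (c + c') = subst_coeff a c + subst_coeff a c'"
  unfolding subst_coeff_def
  by (rule setsum_keys_plus_distrib) (simp_all add: const_tr_add distrib_right)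

lemma subst_coeff_single: "subst_coeff a (Poly_Mapping.single m q) = const_tr q *
    prod_mset (image_mset (\<lambda>y. trace_coeff (a ^ length (letters (rep_cyc_monomial y)))) m)"
  by (simp add: subst_coeff_def)

lemma subst_coeff_zero [simp]: "subst_coeff a 0 = 0"
  by (simp add: subst_coeff_def)

lemma subst_coeff_const [simp]: "subst_coeff a (const_tr q) = const_tr q"
  using subst_coeff_single[of a "{#}" q] by (simp add: const_tr_def)

lemma subst_coeff_one [simp]: "subst_coeff a 1 = 1"
  using subst_coeff_const[of a 1] by simp

lemma subst_coeff_tr: "subst_coeff a (tr_monomial M) = trace_coeff (a ^ length (letters M))"
  by (simp add: tr_monomial_def subst_coeff_single cyc_length_abs)

lemma subst_coeff_mult: "subst_coeff a (c * c') = subst_coeff a c * subst_coeff a c'"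
proof -
  have *: "subst_coeff a (Poly_Mapping.single m q * c') = subst_coeff a (Poly_Mapping.single m q) * subst_coeff a c'" for m q
    by (rule additive_eqI[where F = "\<lambda>c'. subst_coeff a (Poly_Mapping.single m q * c')"
          and G = "\<lambda>c'. subst_coeff a (Poly_Mapping.single m q) * subst_coeff a c'"])
      (simp_all only: subst_coeff_add distrib_left, simp add: mult_single subst_coeff_single const_tr_mult mult_ac)
  show ?thesis
    by (rule additive_eqI[where F = "\<lambda>c. subst_coeff a (c * c')"
          and G = "\<lambda>c. subst_coeff a c * subst_coeff a c'"])
      (simp_all only: subst_coeff_add distrib_right *)
qed

lemma subst_coeff_uminus: "subst_coeff a (- c) = - subst_coeff a c"
  using subst_coeff_add[of a c "- c"] by (simp add: eq_neg_iff_add_eq_0 add.commute)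

lemma subst_coeff_sum: "subst_coeff a (sum f I) = (\<Sum>i\<in>I. subst_coeff a (f i))"
  by (induction I rule: infinite_finite_induct) (simp_all add: subst_coeff_add)

lemma subst_coeff_minus_power: "subst_coeff a ((- 1) ^ r * c) = (- 1) ^ r * subst_coeff a c"
  by (cases "even r") (simp_all add: subst_coeff_uminus)

lemma subst_coeff_esym: "subst_coeff a (esym p r) = esym (\<lambda>i. subst_coeff a (p i)) r"
proof (induction r rule: less_induct)
  case (less r)
  show ?case
  proof (cases r)
    case (Suc k)
    show ?thesis
      unfolding Suc esym.simps subst_coeff_mult subst_coeff_sum subst_coeff_const
    proof (intro arg_cong2[where f = "(*)"] refl sum.cong)
      fix i
      have "subst_coeff a (esym p (k - i)) = esym (\<lambda>i. subst_coeff a (p i)) (k - i)"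
        by (rule less) (simp add: Suc)
      moreover have "subst_coeff a ((- 1) ^ i) = (- 1) ^ i"
        using subst_coeff_minus_power[of a i 1] by simp
      ultimately show "subst_coeff a ((- 1) ^ i) = (- 1) ^ i"
        "subst_coeff a (esym p (k - i)) = esym (\<lambda>i. subst_coeff a (p i)) (k - i)"
        by simp_all
    qed
  qed simp
qed

lemma letters_zero [simp]: "letters 0 = []"
  by (simp add: zero_monomial_def)

lemma single_zero_central: "Poly_Mapping.single 0 c * f = f * (Poly_Mapping.single 0 c :: free_trace_algebra)"
  by (rule additive_eqI[where F = "\<lambda>f. Poly_Mapping.single 0 c * f" and G = "\<lambda>f. f * Poly_Mapping.single 0 c"])
    (simp_all add: distrib_left distrib_right mult_single mult.commute)

lemma subst_all_add: "subst_all a (f + g) = subst_all a f + subst_all a g"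
  unfolding subst_all_def
  by (rule setsum_keys_plus_distrib) (simp_all add: subst_coeff_add single_add distrib_right)

lemma subst_all_single: "subst_all a (Poly_Mapping.single M c) =
    Poly_Mapping.single 0 (subst_coeff a c) * a ^ length (letters M)"
  by (simp add: subst_all_def)

lemma subst_all_coeff: "subst_all a (Poly_Mapping.single 0 c) = Poly_Mapping.single 0 (subst_coeff a c)"
  by (simp add: subst_all_single)

lemma subst_all_mult: "subst_all a (f * g) = subst_all a f * subst_all a g"
proof -
  have mon: "subst_all a (Poly_Mapping.single M c * Poly_Mapping.single N c') =
      subst_all a (Poly_Mapping.single M c) * subst_all a (Poly_Mapping.single N c')" for M N c c'
  proof -
    have "Poly_Mapping.single 0 x * A * (Poly_Mapping.single 0 y * B) = Poly_Mapping.single 0 (x * y) * (A * B)"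
      for x y and A B :: free_trace_algebra
      by (metis (no_types, lifting) mult.assoc mult_single add.right_neutral single_zero_central)
    then show ?thesis
      by (simp add: mult_single subst_all_single plus_monomial_def power_add subst_coeff_mult)
  qed
  have *: "subst_all a (Poly_Mapping.single M c * g) = subst_all a (Poly_Mapping.single M c) * subst_all a g" for M c
    by (rule additive_eqI[where F = "\<lambda>g. subst_all a (Poly_Mapping.single M c * g)"
          and G = "\<lambda>g. subst_all a (Poly_Mapping.single M c) * subst_all a g"])
      (simp_all only: subst_all_add distrib_left mon)
  show ?thesis
    by (rule additive_eqI[where F = "\<lambda>f. subst_all a (f * g)" and G = "\<lambda>f. subst_all a f * subst_all a g"])
      (simp_all only: subst_all_add distrib_right *)
qed

lemma trace_coeff_scale: "trace_coeff (Poly_Mapping.single 0 c * f) = c * trace_coeff f"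
  by (rule additive_eqI[where F = "\<lambda>f. trace_coeff (Poly_Mapping.single 0 c * f)"])
    (simp_all add: distrib_left trace_coeff_add mult_single trace_coeff_single mult.assoc)

lemma trace_endomorphism_subst_all: "trace_endomorphism (subst_all a)"
  unfolding trace_endomorphism_def
proof (intro conjI allI)
  fix f
  show "subst_all a (formal_trace f) = formal_trace (subst_all a f)"
    unfolding formal_trace_eq
    by (rule additive_eqI[where F = "\<lambda>f. subst_all a (Poly_Mapping.single 0 (trace_coeff f))"])
      (simp_all add: trace_coeff_add single_add subst_all_add subst_all_coeff trace_coeff_single
        subst_coeff_mult subst_coeff_tr subst_all_single trace_coeff_scale)
qed (simp_all add: subst_all_add subst_all_mult subst_all_coeff)

lemma induced_endomorphism_single:
  assumes "trace_endomorphism g"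
  shows "induced_endomorphism n g (Poly_Mapping.single t c) =
     factor_elem 0 (g (Poly_Mapping.single 0 c))
     * prod_list (map (\<lambda>i. factor_elem i (g (Poly_Mapping.single (factors t i) 1))) [0..<n])
     * perm_elem (permutation t)"
  by (cases "c = 0") (simp_all add: induced_endomorphism_def trace_endomorphism_zero[OF assms])

lemma induced_endomorphism_sum:
  assumes "trace_endomorphism g"
  shows "induced_endomorphism n g (sum f I) = (\<Sum>i\<in>I. induced_endomorphism n g (f i))"
  by (induction I rule: infinite_finite_induct)
    (simp_all add: induced_endomorphism_add[OF assms], simp_all add: induced_endomorphism_def)

text \<open>Together with \<open>C_elem_eq_char_elem\<close> this computes the substitution
  instances of a generator. Both sides are expanded over the characteristic coefficients, the
  exponents and the permutations, and compared term by term.\<close>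

lemma induced_subst_char_elem:
  "induced_endomorphism n (subst_all a) (char_elem (var x) k n * antisymmetrizer n) =
   char_elem a k n * antisymmetrizer n"
proof -
  let ?g = "subst_all a" and ?p = "\<lambda>i. tr_monomial (var_power x i)"
  let ?c = "\<lambda>r. (- 1) ^ r * esym ?p r"
  note g = trace_endomorphism_subst_all[of a]
  have c: "subst_coeff a (?c r) = (- 1) ^ r * esym (\<lambda>i. trace_coeff (a ^ i)) r" for r
    by (simp add: subst_coeff_minus_power subst_coeff_esym subst_coeff_tr)
  have mon: "induced_endomorphism n ?g (coeff_elem c * (tensor_elem (\<lambda>j. var_power x (h j)) * (rat_elem s * perm_elem \<tau>))) =
      coeff_elem (subst_coeff a c) * (prod_list (map (\<lambda>j. factor_elem j a ^ h j) [0..<n]) * (rat_elem s * perm_elem \<tau>))"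
    for c h s \<tau>
  proof -
    have "coeff_elem c * (tensor_elem (\<lambda>j. var_power x (h j)) * (rat_elem s * perm_elem \<tau>)) =
        Poly_Mapping.single (TMon (\<lambda>j. var_power x (h j)) \<tau>) (c * const_tr s)"
      by (simp add: tensor_elem_def perm_elem_def coeff_elem_mult_single mult_single plus_tensor_monomial_def
          flip: zero_monomial_def)
    moreover have "?g (Poly_Mapping.single (var_power x e) 1) = a ^ e" for e
      by (simp add: subst_all_single)
    ultimately show ?thesis
      by (simp add: induced_endomorphism_single[OF g] subst_all_coeff factor_elem_coeff subst_coeff_mult
          coeff_elem_mult factor_elem_power mult.assoc
          coeff_elem_left_commute[of "prod_list (map (\<lambda>j. factor_elem j a ^ h j) [0..<n])"])
  qed
  have "char_elem (var x) k n * antisymmetrizer n =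
      (\<Sum>r\<le>k. \<Sum>h\<in>exponents (k - r) n. \<Sum>\<tau>\<in>sym_group n.
        coeff_elem (?c r) * (tensor_elem (\<lambda>j. var_power x (h j)) * (rat_elem (perm_sign \<tau>) * perm_elem \<tau>)))"
    unfolding char_elem_def trace_coeff_var_power complete_elem_eq_hsum[symmetric] sum_distrib_right mult.assoc
    unfolding complete_elem_def antisymmetrizer_def sum_product unfolding sum_distrib_left ..
  moreover have "char_elem a k n * antisymmetrizer n =
      (\<Sum>r\<le>k. \<Sum>h\<in>exponents (k - r) n. \<Sum>\<tau>\<in>sym_group n. coeff_elem (subst_coeff a (?c r)) *
        (prod_list (map (\<lambda>j. factor_elem j a ^ h j) [0..<n]) * (rat_elem (perm_sign \<tau>) * perm_elem \<tau>)))"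
    unfolding c char_elem_def hsum_exponents sum_distrib_right mult.assoc
    unfolding antisymmetrizer_def sum_product unfolding sum_distrib_left ..
  ultimately show ?thesis
    by (simp only: induced_endomorphism_sum[OF g] mon)
qed


section \<open>Polarization\<close>

lemma trace_antisym_add:
  "trace_antisym q (l @ (a + b) # m) = trace_antisym q (l @ a # m) + trace_antisym q (l @ b # m)"
  by (induction l) (simp_all add: factor_elem_add distrib_right distrib_left partial_trace_add)

lemma trace_antisym_of_nat:
  "trace_antisym q (l @ (of_nat k * a) # m) = of_nat k * trace_antisym q (l @ a # m)"
proof (induction k)
  case 0
  then show ?case using trace_antisym_add[of q l 0 0 m] by simp
qed (simp add: distrib_right trace_antisym_add)

lemma perm_elem_commute_TX:
  assumes "z \<in> TX n" and \<pi>: "\<And>i. i < n \<Longrightarrow> \<pi> \<langle>$\<rangle> i = i"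
  shows "perm_elem \<pi> * z = z * perm_elem \<pi>"
proof (rule additive_eqI[where F = "\<lambda>z. perm_elem \<pi> * z" and G = "\<lambda>z. z * perm_elem \<pi>"])
  fix t c assume "t \<in> Poly_Mapping.keys z"
  then have t: "t \<in> tensor_monomials n" using assms(1) by (auto simp: TX_iff)
  have \<pi>': "inverse \<pi> \<langle>$\<rangle> i = i" if "i < n" for i using \<pi>[OF that] by (simp add: apply_inverse_eq_iff)
  have ge: "n \<le> \<pi> \<langle>$\<rangle> i" "n \<le> inverse \<pi> \<langle>$\<rangle> i" if "n \<le> i" for i
    using that \<pi> \<pi>' by (metis apply_inj not_le)+
  have "TMon (\<lambda>_. 0) \<pi> + t = t + TMon (\<lambda>_. 0) \<pi>"
  proof (rule tensor_monomial_eqI)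
    fix i
    have "permutation t \<langle>$\<rangle> j = j" if "n \<le> j" for j using t that by (simp add: tensor_monomials_def sym_group_iff)
    moreover have "permutation t \<langle>$\<rangle> j < n" if "j < n" for j
      using t that by (simp add: tensor_monomials_def sym_group_less)
    ultimately show "permutation (TMon (\<lambda>_. 0) \<pi> + t) \<langle>$\<rangle> i = permutation (t + TMon (\<lambda>_. 0) \<pi>) \<langle>$\<rangle> i"
      by (cases "i < n") (simp_all add: permutation_plus apply_times \<pi> ge)
    show "factors (TMon (\<lambda>_. 0) \<pi> + t) i = factors (t + TMon (\<lambda>_. 0) \<pi>) i"
      using t by (cases "i < n") (simp_all add: factors_plus \<pi>' ge tensor_monomials_def)
  qed
  then show "perm_elem \<pi> * Poly_Mapping.single t c = Poly_Mapping.single t c * perm_elem \<pi>"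
    by (simp add: perm_elem_def mult_single)
qed (simp_all add: distrib_left distrib_right)

text \<open>Conjugation by the transposition of the two strands to be closed exchanges the
  arguments, fixes the inner element because two equal signs cancel, and exchanges the two partial
  traces, which commute.\<close>

lemma trace_antisym_swap:
  "length (l @ a # b # m) \<le> q \<Longrightarrow> trace_antisym q (l @ a # b # m) = trace_antisym q (l @ b # a # m)"
proof (induction l)
  case Nil
  define n where "n = q - Suc (Suc (length m))"
  define R where "R = trace_antisym q m"
  have n: "q - Suc (length m) = Suc n" "q - length m = Suc (Suc n)"
    using Nil by (simp_all add: n_def)
  define w where "w = perm_elem \<langle>n \<leftrightarrow> Suc n\<rangle>"
  have w: "\<langle>n \<leftrightarrow> Suc n\<rangle> \<in> sym_group (q - length m)" by (simp add: n swap_sym_group)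
  have R: "R \<in> TX (Suc (Suc n))" using Nil n trace_antisym_TX[of m q] by (simp add: R_def)
  have two: "trace_antisym q (a # b # m) = partial_trace n (partial_trace (Suc n)
      (factor_elem n a * factor_elem (Suc n) b * R))" for a b
    using free_at_factor[of n "Suc n" a]
    by (simp add: n n_def[symmetric] R_def partial_trace_left mult.assoc)
  have wRw: "w * R * w = R"
    using Nil w unfolding w_def R_def
    by (simp add: trace_antisym_left trace_antisym_right mult.assoc rat_elem_sign_cancel)
  let ?Z = "factor_elem n a * factor_elem (Suc n) b * R"
  have ww: "w * w = 1" by (simp add: w_def flip: perm_elem_mult)
  have "w * ?Z * w = factor_elem (Suc n) a * factor_elem n b * (w * R * w)"
    by (simp add: w_def mult.assoc[symmetric] perm_elem_factor_elem)
      (simp add: mult.assoc perm_elem_factor_elem)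
  also have "\<dots> = factor_elem n b * factor_elem (Suc n) a * R"
    using factor_elem_commute_free_at[OF free_at_factor[of n "Suc n" b], of a]
    by (simp add: wRw)
  finally have Z: "w * ?Z * w = factor_elem n b * factor_elem (Suc n) a * R" .
  have Zin: "?Z \<in> TX (Suc (Suc n))"
    by (intro twisted_carrier_mult factor_elem_TX R) simp_all
  have conj: "partial_trace (\<langle>n \<leftrightarrow> Suc n\<rangle> \<langle>$\<rangle> p) (w * z * w) = w * partial_trace p z * w" for p z
    using partial_trace_conjugate[of "\<langle>n \<leftrightarrow> Suc n\<rangle>" p z] by (simp add: w_def)
  have "trace_antisym q (b # a # m) = partial_trace n (partial_trace (Suc n) (w * ?Z * w))"
    by (simp only: two Z)
  also have "\<dots> = w * partial_trace (Suc n) (partial_trace n ?Z) * w"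
    using conj[of n ?Z] conj[of "Suc n" "partial_trace n ?Z"] by simp
  also have "partial_trace (Suc n) (partial_trace n ?Z) = partial_trace n (partial_trace (Suc n) ?Z)"
    by (rule partial_trace_commute)
  \<comment> \<open>With both strands closed, only strands below \<open>n\<close> are in use, and
    the transposition commutes with everything on them.\<close>
  also have "w * partial_trace n (partial_trace (Suc n) ?Z) * w = partial_trace n (partial_trace (Suc n) ?Z) * (w * w)"
    using perm_elem_commute_TX[OF partial_trace_TX[OF partial_trace_TX[OF Zin]], of "\<langle>n \<leftrightarrow> Suc n\<rangle>"]
    by (simp add: w_def mult.assoc)
  finally have "trace_antisym q (b # a # m) = partial_trace n (partial_trace (Suc n) ?Z)"
    by (simp only: ww mult_1_right)
  then show ?case by (simp only: append_Nil two)
qed simp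


text \<open>\<open>polar l m i\<close> is the coefficient of \<open>\<lambda>\<^sup>i\<close> in the value at \<open>l\<close> followed by \<open>m\<close> copies of \<open>b + \<lambda>c\<close>.\<close>

fun polar :: "nat \<Rightarrow> free_trace_algebra \<Rightarrow> free_trace_algebra \<Rightarrow> free_trace_algebra list \<Rightarrow> nat \<Rightarrow> nat \<Rightarrow> twisted_element" where
  "polar q b c l 0 i = (if i = 0 then trace_antisym q l else 0)"
| "polar q b c l (Suc m) i = polar q b c (l @ [b]) m i + (if i = 0 then 0 else polar q b c (l @ [c]) m (i - 1))"

lemma polar_above: "m < i \<Longrightarrow> polar q b c l m i = 0"
  by (induction m arbitrary: l i) simp_all

lemma trace_antisym_polar:
  "trace_antisym q (l @ replicate m (b + of_nat s * c)) = (\<Sum>i\<le>m. of_nat s ^ i * polar q b c l m i)"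
proof (induction m arbitrary: l)
  case (Suc m)
  let ?r = "replicate m (b + of_nat s * c)"
  have "trace_antisym q (l @ replicate (Suc m) (b + of_nat s * c)) =
      trace_antisym q ((l @ [b]) @ ?r) + of_nat s * trace_antisym q ((l @ [c]) @ ?r)"
    by (simp add: trace_antisym_add trace_antisym_of_nat)
  also have "\<dots> = (\<Sum>i\<le>Suc m. of_nat s ^ i * polar q b c (l @ [b]) m i) +
      (\<Sum>i\<le>m. of_nat s ^ Suc i * polar q b c (l @ [c]) m i)"
    unfolding Suc.IH by (simp add: polar_above sum_distrib_left mult.assoc)
  also have "\<dots> = (\<Sum>i\<le>Suc m. of_nat s ^ i * polar q b c l (Suc m) i)"
    unfolding sum.atMost_Suc_shift by (simp add: distrib_left sum.distrib add.assoc del: power_Suc)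
  finally show ?case .
qed simp

lemma polar_0: "polar q b c l m 0 = trace_antisym q (l @ replicate m b)"
  by (induction m arbitrary: l) simp_all

text \<open>Each of the \<open>m\<close> places can receive \<open>c\<close>, and by symmetry they
  all give the same value.\<close>

lemma polar_1:
  "length l + m \<le> q \<Longrightarrow> polar q b c l m (Suc 0) = of_nat m * trace_antisym q (l @ c # replicate (m - 1) b)"
proof (induction m arbitrary: l)
  case (Suc m)
  have "of_nat m * trace_antisym q (l @ b # c # replicate (m - 1) b) =
      of_nat m * trace_antisym q (l @ c # replicate m b)"
  proof (cases m)
    case (Suc m')
    then show ?thesis using Suc.prems trace_antisym_swap[of l b c "replicate m' b" q] by simp
  qed simp
  then show ?case using Suc by (simp add: polar_0 distrib_right add.commute)
qed simp

text \<open>The Vandermonde argument without determinants. For the polynomial P of degree at most m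
  + 1, the combination 2^(m+1) P(s) - P(2s) has no top term, and its i-th coefficient is multiplied
  by 2^(m+1) - 2^i, which is nonzero for i \<le> m.\<close>

lemma coefficients_in_subspace:
  assumes add: "\<And>a b. a \<in> S \<Longrightarrow> b \<in> S \<Longrightarrow> a + b \<in> S"
    and scale: "\<And>q a. a \<in> S \<Longrightarrow> rat_elem q * a \<in> S"
    and vals: "\<And>s::nat. (\<Sum>i\<le>m. of_nat s ^ i * v i) \<in> S"
    and i: "i \<le> m"
  shows "v i \<in> S"
  using vals i
proof (induction m arbitrary: v i)
  case 0
  then show ?case using 0(1)[of 1] by simp
next
  case (Suc m)
  have minus: "a - b \<in> S" if "a \<in> S" "b \<in> S" for a b
    using add[OF that(1) scale[OF that(2), of "- 1"]] by (simp add: const_tr_uminus coeff_elem_uminus)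
  have lower: "v i \<in> S" if "i \<le> m" for i
  proof -
    let ?q = "\<lambda>i. 2 ^ Suc m - 2 ^ i :: rat"
    have "(\<Sum>i\<le>m. of_nat s ^ i * (rat_elem (?q i) * v i)) \<in> S" for s
    proof -
      have "rat_elem (2 ^ Suc m) * (\<Sum>i\<le>Suc m. of_nat s ^ i * v i) - (\<Sum>i\<le>Suc m. of_nat (2 * s) ^ i * v i) =
          (\<Sum>i\<le>Suc m. of_nat s ^ i * (rat_elem (?q i) * v i))"
        unfolding sum_distrib_left sum_subtractf[symmetric]
      proof (intro sum.cong refl)
        fix i
        have two: "rat_elem (2 ^ k) = 2 ^ k" for k
          using rat_elem_of_nat[of "2 ^ k"] by simp
        have "of_nat (2 * s) ^ i = (of_nat (s ^ i * 2 ^ i) :: twisted_element)"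
          by (simp only: of_nat_power[symmetric] power_mult_distrib mult.commute)
        then have "of_nat (2 * s) ^ i * v i = of_nat s ^ i * (rat_elem (2 ^ i) * v i)"
          unfolding two by (simp add: mult.assoc)
        then show "rat_elem (2 ^ Suc m) * (of_nat s ^ i * v i) - of_nat (2 * s) ^ i * v i =
            of_nat s ^ i * (rat_elem (?q i) * v i)"
          by (simp only: const_tr_diff coeff_elem_diff left_diff_distrib right_diff_distrib
              coeff_elem_left_commute[of "of_nat s ^ i"])
      qed
      also have "\<dots> = (\<Sum>i\<le>m. of_nat s ^ i * (rat_elem (?q i) * v i))" by simp
      finally show ?thesis
        using minus[OF scale[OF Suc.prems(1)[of s], of "2 ^ Suc m"] Suc.prems(1)[of "2 * s"]] by (simp only:)
    qed
    then have "rat_elem (?q i) * v i \<in> S" using that by (rule Suc.IH)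
    then have "rat_elem (1 / ?q i) * (rat_elem (?q i) * v i) \<in> S" by (rule scale)
    moreover have "?q i \<noteq> 0"
      using that power_strict_increasing[of i "Suc m" "2 :: rat"] by simp
    ultimately show ?thesis by (simp flip: mult.assoc coeff_elem_mult const_tr_mult)
  qed
  have zero: "0 \<in> S" using scale[OF Suc.prems(1), of 0] by simp
  have "sum v I \<in> S" if "I \<subseteq> {..m}" for I
    using finite_subset[OF that] that by (induction I rule: finite_induct) (auto intro: add lower zero)
  then have "(\<Sum>i\<le>Suc m. v i) - (\<Sum>i\<le>m. v i) \<in> S"
    using Suc.prems(1)[of 1] by (intro minus) simp_all
  then have "v (Suc m) \<in> S" by simp
  then show ?case using lower Suc.prems(2) by (auto simp: le_Suc_eq)
qed

text \<open>Arguments are freed one at a time: those in \<open>l\<close> are already independent,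
  the others are equal to an arbitrary element, and the linear coefficient at b + s c turns one of
  them into \<open>c\<close>.\<close>

lemma trace_antisym_polarize:
  assumes add: "\<And>a b. a \<in> S \<Longrightarrow> b \<in> S \<Longrightarrow> a + b \<in> S"
    and scale: "\<And>q a. a \<in> S \<Longrightarrow> rat_elem q * a \<in> S"
    and diag: "\<And>a. trace_antisym q (replicate k a) \<in> S"
    and k: "k \<le> q" and l: "length l \<le> k"
  shows "trace_antisym q (l @ replicate (k - length l) b) \<in> S"
  using l
proof (induction l arbitrary: b rule: rev_induct)
  case Nil
  show ?case using diag by simp
next
  case (snoc c l)
  define m where "m = k - length l"
  have m: "m = Suc (m - 1)" "length l + m \<le> q" "k - length (l @ [c]) = m - 1"
    using snoc.prems k by (simp_all add: m_def)
  have "(\<Sum>i\<le>m. of_nat s ^ i * polar q b c l m i) \<in> S" for s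
    using snoc.IH[of "b + of_nat s * c"] snoc.prems by (simp add: m_def flip: trace_antisym_polar)
  then have "polar q b c l m 1 \<in> S"
    using m(1) by (intro coefficients_in_subspace[where S = S and m = m and v = "polar q b c l m" and i = 1] add scale) auto
  then have "rat_elem (of_nat m) * trace_antisym q (l @ c # replicate (m - 1) b) \<in> S"
    using polar_1[OF m(2), of b c] by (simp add: rat_elem_of_nat)
  then have "rat_elem (1 / of_nat m) * (rat_elem (of_nat m) * trace_antisym q (l @ c # replicate (m - 1) b)) \<in> S"
    by (rule scale)
  moreover have "of_nat m \<noteq> (0 :: rat)" using m(1) by (metis nat.distinct(1) of_nat_eq_0_iff)
  ultimately show ?case
    unfolding m(3) by (simp del: of_nat_eq_0_iff flip: mult.assoc coeff_elem_mult const_tr_mult)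
qed


section \<open>Consequences of the generating identities\<close>

lemma juxtapose_zero: "s \<in> tensor_monomials m \<Longrightarrow> juxtapose m s 0 = s"
  by (rule tensor_monomial_eqI)
    (auto simp: juxtapose_def zero_tensor_monomial_def tensor_monomials_def apply_times shift_perm.rep_eq)

text \<open>Tensoring with 1 on further strands is the inclusion of \<open>TX m\<close> into a
  larger \<open>TX n\<close> inside the common type. Condition (ii) on T-ideals therefore yields
  \<open>J m \<subseteq> J n\<close> for \<open>m \<le> n\<close>.\<close>

lemma outer_product_one:
  assumes "a \<in> TX m" shows "outer_product m a 1 = a"
proof -
  have mon: "outer_product m (Poly_Mapping.single s c) 1 = Poly_Mapping.single s c" if "s \<in> tensor_monomials m" for s c
    using outer_product_single[of m s c 0 1] that by (simp add: juxtapose_zero)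
  show ?thesis
    by (rule additive_eqI[where F = "\<lambda>a. outer_product m a 1" and G = "\<lambda>a. a"])
      (use assms in \<open>auto simp: TX_iff outer_product_add_left mon\<close>)
qed

lemma T_ideal_closed:
  assumes "T_ideal J"
  shows "a \<in> J n \<Longrightarrow> b \<in> J n \<Longrightarrow> a + b \<in> J n" "0 \<in> J n"
    "a \<in> J n \<Longrightarrow> z \<in> TX n \<Longrightarrow> z * a \<in> J n" "a \<in> J n \<Longrightarrow> z \<in> TX n \<Longrightarrow> a * z \<in> J n"
    "a \<in> J n \<Longrightarrow> a \<in> TX n" "a \<in> J m \<Longrightarrow> m \<le> n \<Longrightarrow> a \<in> J n"
proof -
  have *: "ideal (J n) (twisted_algebra n)" for n using assms by (simp add: T_ideal_def)
  interpret ideal "J n" "twisted_algebra n" by (rule *)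
  show "a \<in> J n \<Longrightarrow> b \<in> J n \<Longrightarrow> a + b \<in> J n" "0 \<in> J n"
    using additive_subgroup.a_closed[OF ideal.axioms(1)[OF *[of n]]]
      additive_subgroup.zero_closed[OF ideal.axioms(1)[OF *[of n]]]
    by (simp_all add: twisted_algebra_simps(2-))
  show "a \<in> J n \<Longrightarrow> z \<in> TX n \<Longrightarrow> z * a \<in> J n" "a \<in> J n \<Longrightarrow> z \<in> TX n \<Longrightarrow> a * z \<in> J n"
    using I_l_closed I_r_closed by (simp_all add: twisted_algebra_simps(2-))
  show "a \<in> J n \<Longrightarrow> a \<in> TX n" by (rule a_Hcarr)
  assume a: "a \<in> J m" "m \<le> n"
  have "a \<in> TX m"
    using a(1) additive_subgroup.a_Hcarr[OF ideal.axioms(1)[OF *[of m]]] by blast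
  moreover have "outer_product m a 1 \<in> J (m + (n - m))"
    using assms a(1) TX_one[of "n - m"] unfolding T_ideal_def by blast
  ultimately show "a \<in> J n" using a(2) by (simp add: outer_product_one)
qed

lemma trace_antisym_in_T_ideal:
  assumes J: "T_ideal J" and gen: "generators d x \<le> J" and l: "length l \<le> d + 1"
  shows "trace_antisym (d + 1) l \<in> J (d + 1 - length l)"
proof -
  define k where "k = length l"
  define n where "n = d + 1 - k"
  note closed = T_ideal_closed[OF J]
  have "trace_antisym (d + 1) (replicate k a) \<in> J n" for a
  proof -
    have "C_elem k d x \<in> generators d x n"
      using l by (auto simp: generators_def k_def n_def)
    then have "C_elem k d x \<in> J n" using gen by (auto simp: le_fun_def)
    then have "induced_endomorphism n (subst_all a) (C_elem k d x) \<in> J n"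
      using J trace_endomorphism_subst_all[of a] unfolding T_ideal_def by blast
    then have "char_elem a k n * antisymmetrizer n \<in> J n"
      using l by (simp add: C_elem_eq_char_elem k_def n_def induced_subst_char_elem)
    then have "rat_elem ((- 1) ^ k * fact k) * (char_elem a k n * antisymmetrizer n) \<in> J n"
      by (rule closed(3)) simp
    then show ?thesis using l by (simp add: trace_antisym_replicate k_def n_def)
  qed
  \<comment> \<open>Since \<open>k\<close> is the length of \<open>l\<close>, no copies are appended
    and \<open>undefined\<close> does not occur in the list.\<close>
  then have "trace_antisym (d + 1) (l @ replicate (k - length l) undefined) \<in> J n"
    using l by (intro trace_antisym_polarize closed(1) closed(3)) (auto simp: k_def)
  then show ?thesis by (simp add: k_def n_def)
qed

section \<open>The generators are tensor identities\<close>

text \<open>Among d + 1 column indices from a set of d values, two coincide. Multiplying by their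
  transposition keeps this entry and also changes its sign.\<close>

lemma antisymmetrizer_identity: "antisymmetrizer (Suc d) \<in> tensor_identities d (Suc d)"
  unfolding tensor_identities_iff
proof (intro conjI allI impI antisymmetrizer_TX)
  fix A I J assume A: "assignment d A" and J: "J \<in> multi_indices d (Suc d)"
  have "\<not> inj_on J {..<Suc d}"
  proof
    assume "inj_on J {..<Suc d}"
    then have "card {..<Suc d} \<le> card {..<d}"
      by (rule card_inj_on_le) (use multi_indices_less[OF J] in auto)
    then show False by simp
  qed
  then obtain i j where ij: "i < Suc d" "j < Suc d" "i \<noteq> j" "J i = J j" by (auto simp: inj_on_def)
  let ?s = "\<langle>i \<leftrightarrow> j\<rangle>"
  have "(\<lambda>k. J (inverse ?s \<langle>$\<rangle> k)) = J" using ij(4) by (auto simp: apply_swap)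
  then have "ev d (Suc d) A (antisymmetrizer (Suc d) * perm_elem ?s) I J = ev d (Suc d) A (antisymmetrizer (Suc d)) I J"
    by (simp only: ev_mult_perm)
  moreover have "antisymmetrizer (Suc d) * perm_elem ?s = - antisymmetrizer (Suc d)"
    using ij by (simp add: antisymmetrizer_right swap_sym_group perm_sign_swap const_tr_uminus coeff_elem_uminus)
  ultimately show "ev d (Suc d) A (antisymmetrizer (Suc d)) I J = 0" by (simp add: ev_uminus)
qed

lemma trace_antisym_identity:
  "length l \<le> Suc d \<Longrightarrow> trace_antisym (Suc d) l \<in> tensor_identities d (Suc d - length l)"
proof (induction l)
  case (Cons a l)
  then have eq: "Suc d - length l = Suc (d - length l)" by simp
  have "factor_elem (d - length l) a * trace_antisym (Suc d) l \<in> tensor_identities d (Suc (d - length l))"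
    using Cons by (intro tensor_identities_mult_left) (simp_all add: eq factor_elem_TX)
  then show ?case by (simp add: tensor_identities_partial_trace)
qed (simp add: antisymmetrizer_identity)

lemma generators_le_tensor_identities: "generators d x \<le> tensor_identities d"
proof (intro le_funI subsetI)
  fix n z assume "z \<in> generators d x n"
  then consider k where "k \<le> d + 1" "n = d + 1 - k" "z = C_elem k d x"
    | "n = 0" "z = coeff_elem (tr_monomial 0 - const_tr (of_nat d))"
    by (auto simp: generators_def split: if_splits)
  then show "z \<in> tensor_identities d n"
  proof cases
    case 1
    \<comment> \<open>The scalar from \<open>trace_antisym_replicate\<close>; it is nonzero in the
      rationals and can be divided out.\<close>
    let ?q = "(- 1) ^ k * fact k :: rat"
    have "rat_elem (1 / ?q) * trace_antisym (Suc d) (replicate k (var x)) \<in> tensor_identities d n"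
      using trace_antisym_identity[of "replicate k (var x)" d] 1
      by (intro tensor_identities_mult_left) simp_all
    moreover have "rat_elem (1 / ?q) * trace_antisym (Suc d) (replicate k (var x)) = z"
      using 1 by (simp add: C_elem_eq_char_elem trace_antisym_replicate mult.assoc[symmetric]
          flip: coeff_elem_mult const_tr_mult)
    ultimately show ?thesis by simp
  next
    case 2
    have "mat_trace (1\<^sub>m d) = of_nat d" by (simp add: mat_trace_def)
    then have "ev d n A z I J = 0" if "assignment d A" for A I J
      using ev_coeff_mult[of d n A "tr_monomial 0 - const_tr (of_nat d)" 1 I J] that 2
      by (simp add: eval_trace_ring_add[of d A "tr_monomial 0" "- const_tr (of_nat d)", simplified]
          eval_trace_ring_uminus eval_tr_monomial)
    then show ?thesis using 2 by (simp add: tensor_identities_iff)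
  qed
qed


section \<open>An ideal closed under partial traces\<close>

definition dim_elem :: "nat \<Rightarrow> trace_ring" where
  "dim_elem d = tr_monomial 0 - const_tr (of_nat d)"

abbreviation antisym_word :: "nat \<Rightarrow> monomial list \<Rightarrow> twisted_element" where
  "antisym_word d l \<equiv> trace_antisym (Suc d) (map (\<lambda>M. Poly_Mapping.single M 1) l)"

text \<open>An additive span is enough, as the coefficients \<open>c\<close> and \<open>c'\<close>
  absorb scalars and signs. The entries of a word are monomials, so that a partial trace which
  lengthens a word stays in the spanning set. The bound \<open>Suc d - length l \<le> n\<close> says
  that the open strands of the word fit among \<open>n\<close> strands.\<close>

definition core_ideal :: "nat \<Rightarrow> nat \<Rightarrow> twisted_element set" where
  "core_ideal d n = add_span
     ({Poly_Mapping.single s c * antisym_word d l * Poly_Mapping.single t c' | s t c c' l.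
         s \<in> tensor_monomials n \<and> t \<in> tensor_monomials n \<and> length l \<le> Suc d \<and> Suc d - length l \<le> n}
      \<union> {coeff_elem (dim_elem d) * Poly_Mapping.single t c | t c. t \<in> tensor_monomials n})"

lemma core_ideal_add: "a \<in> core_ideal d n \<Longrightarrow> b \<in> core_ideal d n \<Longrightarrow> a + b \<in> core_ideal d n"
  unfolding core_ideal_def by (rule add_span_add)

lemma core_ideal_zero: "0 \<in> core_ideal d n"
  unfolding core_ideal_def by (rule add_span.zero)

lemma core_ideal_sum: "(\<And>i. i \<in> I \<Longrightarrow> f i \<in> core_ideal d n) \<Longrightarrow> sum f I \<in> core_ideal d n"
  unfolding core_ideal_def by (rule add_span_sum)

lemma core_ideal_antisym_word:
  assumes a: "a \<in> TX n" and b: "b \<in> TX n" and l: "length l \<le> Suc d" "Suc d - length l \<le> n"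
  shows "a * antisym_word d l * b \<in> core_ideal d n"
proof -
  have "a * antisym_word d l * b = (\<Sum>s\<in>Poly_Mapping.keys a. \<Sum>t\<in>Poly_Mapping.keys b.
      Poly_Mapping.single s (Poly_Mapping.lookup a s) * antisym_word d l * Poly_Mapping.single t (Poly_Mapping.lookup b t))"
    by (subst poly_mapping_sum_singles[of a, symmetric], subst poly_mapping_sum_singles[of b, symmetric])
      (simp only: sum_distrib_right, simp only: sum_distrib_left)
  also have "\<dots> \<in> core_ideal d n"
    unfolding core_ideal_def
    by (intro add_span_sum add_span_base UnI1 CollectI exI conjI refl l)
      (use a b l in \<open>auto simp: TX_iff\<close>)
  finally show ?thesis .
qed

lemma core_ideal_dim_elem:
  assumes a: "a \<in> TX n"
  shows "coeff_elem (dim_elem d) * a \<in> core_ideal d n"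
proof -
  have "coeff_elem (dim_elem d) * a = (\<Sum>s\<in>Poly_Mapping.keys a.
      coeff_elem (dim_elem d) * Poly_Mapping.single s (Poly_Mapping.lookup a s))"
    by (subst poly_mapping_sum_singles[of a, symmetric]) (simp only: sum_distrib_left)
  also have "\<dots> \<in> core_ideal d n"
    unfolding core_ideal_def
    by (intro add_span_sum add_span_base UnI2 CollectI exI conjI refl) (use a in \<open>auto simp: TX_iff\<close>)
  finally show ?thesis .
qed

text \<open>The word case keeps both outer factors in the form of single terms, as needed for
  splitting them along the last strand.\<close>

lemma core_ideal_induct [consumes 1, case_names zero add word dim]:
  assumes "z \<in> core_ideal d n" "P 0" "\<And>a b. P a \<Longrightarrow> P b \<Longrightarrow> P (a + b)"
    "\<And>a b l. a \<in> TX n \<Longrightarrow> b \<in> TX n \<Longrightarrow> length l \<le> Suc d \<Longrightarrow> Suc d - length l \<le> n \<Longrightarrow>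
      (\<exists>s c. a = Poly_Mapping.single s c) \<Longrightarrow> (\<exists>s c. b = Poly_Mapping.single s c) \<Longrightarrow> P (a * antisym_word d l * b)"
    "\<And>a. a \<in> TX n \<Longrightarrow> P (coeff_elem (dim_elem d) * a)"
  shows "P z"
  using assms(1) unfolding core_ideal_def
proof (induction rule: add_span.induct)
  case (add x y)
  from add(1) consider (word) s t c c' l where "x = Poly_Mapping.single s c * antisym_word d l * Poly_Mapping.single t c'"
      "s \<in> tensor_monomials n" "t \<in> tensor_monomials n" "length l \<le> Suc d" "Suc d - length l \<le> n"
    | (dim) t c where "x = coeff_elem (dim_elem d) * Poly_Mapping.single t c" "t \<in> tensor_monomials n"
    by blast
  then have "P x"
  proof cases
    case word
    then show ?thesis by (simp only:) (rule assms(4), auto intro: twisted_carrier_single)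
  next
    case dim
    then show ?thesis by (simp only:) (rule assms(5), rule twisted_carrier_single)
  qed
  then show ?case using add by (intro assms(3))
qed (rule assms(2))

lemma core_ideal_mult:
  assumes "z \<in> core_ideal d n"
  shows "a \<in> TX n \<Longrightarrow> a * z \<in> core_ideal d n" "a \<in> TX n \<Longrightarrow> z * a \<in> core_ideal d n"
proof -
  show "a * z \<in> core_ideal d n" if a: "a \<in> TX n"
    using assms
  proof (induction rule: core_ideal_induct)
    case (word b c l)
    then show ?case using core_ideal_antisym_word[of "a * b" n c l d] a
      by (simp add: twisted_carrier_mult mult.assoc)
  next
    case (dim b)
    then show ?case using core_ideal_dim_elem[of "a * b" n d] a
      by (simp add: twisted_carrier_mult coeff_elem_left_commute[of a])
  qed (simp_all add: core_ideal_zero core_ideal_add distrib_left)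
  show "z * a \<in> core_ideal d n" if a: "a \<in> TX n"
    using assms
  proof (induction rule: core_ideal_induct)
    case (word b c l)
    then show ?case using core_ideal_antisym_word[of b n "c * a" l d] a
      by (simp add: twisted_carrier_mult mult.assoc)
  next
    case (dim b)
    then show ?case using core_ideal_dim_elem[of "b * a" n d] a
      by (simp add: twisted_carrier_mult mult.assoc)
  qed (simp_all add: core_ideal_zero core_ideal_add distrib_right)
qed

lemma core_ideal_subset:
  assumes J: "T_ideal J" and gen: "generators d x \<le> J"
  shows "core_ideal d n \<subseteq> J n"
proof
  note closed = T_ideal_closed[OF J]
  fix z assume "z \<in> core_ideal d n"
  then show "z \<in> J n"
  proof (induction rule: core_ideal_induct)
    case (word a b l)
    have "antisym_word d l \<in> J (Suc d - length l)"
      using trace_antisym_in_T_ideal[OF J gen, of "map (\<lambda>M. Poly_Mapping.single M 1) l"] word by simp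
    then have "antisym_word d l \<in> J n" using word(4) by (rule closed(6))
    then show ?case using word by (intro closed(3,4))
  next
    case (dim a)
    have "coeff_elem (dim_elem d) \<in> generators d x 0" by (simp add: generators_def dim_elem_def)
    then have "coeff_elem (dim_elem d) \<in> J 0" using le_funD[OF gen] by blast
    then have "coeff_elem (dim_elem d) \<in> J n" by (rule closed(6)) simp
    then show ?case using dim by (intro closed(4))
  qed (simp_all add: closed(1,2))
qed

text \<open>Strand \<open>n\<close> is joined to the word by a transposition with \<open>a\<close>
  on one side and with \<open>b\<close> on the other. If one of them misses the open strands of the
  word, the word can be pulled out of the partial trace on that side. If both meet open strands,
  closing makes the word longer by the letter \<open>M\<close>.\<close>

lemma core_ideal_partial_trace_word:
  assumes l: "length l \<le> Suc d" "Suc d - length l \<le> Suc n" and ab: "a \<le> n" "b \<le> n"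
  shows "partial_trace n (pos_elem n M * (perm_elem \<langle>a \<leftrightarrow> n\<rangle> * antisym_word d l * perm_elem \<langle>b \<leftrightarrow> n\<rangle>)) \<in> core_ideal d n"
proof -
  define R where "R = antisym_word d l"
  define q where "q = Suc d - length l"
  define P where "P p = pos_elem p M" for p
  have R: "R \<in> TX q" using l trace_antisym_TX[of "map (\<lambda>M. Poly_Mapping.single M 1) l" "Suc d"]
    by (simp add: R_def q_def)
  have RL: "perm_elem \<pi> * R = rat_elem (perm_sign \<pi>) * R" and RR: "R * perm_elem \<pi> = rat_elem (perm_sign \<pi>) * R"
    if "\<pi> \<in> sym_group q" for \<pi>
    using that l by (simp_all add: R_def q_def trace_antisym_left trace_antisym_right)
  have close: "partial_trace (q - 1) (P (q - 1) * R) = antisym_word d (M # l)" if "q > 0"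
    using that by (simp add: P_def R_def q_def factor_elem_single)
  have word: "x * antisym_word d (M # l) * y \<in> core_ideal d n" if "q > 0" "x \<in> TX n" "y \<in> TX n" for x y
    using that l by (intro core_ideal_antisym_word) (simp_all add: q_def)
  let ?wa = "perm_elem \<langle>a \<leftrightarrow> n\<rangle>" and ?wb = "perm_elem \<langle>b \<leftrightarrow> n\<rangle>"
  have w_TX: "?wa \<in> TX (Suc n)" "?wb \<in> TX (Suc n)"
    using ab by (auto intro!: perm_elem_TX swap_sym_group)
  have P_TX: "P n \<in> TX (Suc n)" by (simp add: P_def pos_elem_TX)
  consider "q = Suc n" | "q \<le> n" "q \<le> a" | "q \<le> n" "q \<le> b" | "q \<le> n" "a < q" "b < q"
    using l(2) unfolding q_def[symmetric] by (meson le_SucE not_le)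
  then have "partial_trace n (P n * (?wa * R * ?wb)) \<in> core_ideal d n"
  proof cases
    case 1
    \<comment> \<open>Here strand \<open>n\<close> is the last open strand of the word, and both
      transpositions turn into signs.\<close>
    then have w: "\<langle>a \<leftrightarrow> n\<rangle> \<in> sym_group q" "\<langle>b \<leftrightarrow> n\<rangle> \<in> sym_group q" using ab by (auto intro!: swap_sym_group)
    let ?c = "const_tr (perm_sign \<langle>a \<leftrightarrow> n\<rangle>) * const_tr (perm_sign \<langle>b \<leftrightarrow> n\<rangle>)"
    have "P n * (?wa * R * ?wb) = coeff_elem ?c * (P n * R)"
      using w by (simp add: RL RR mult.assoc coeff_elem_mult coeff_elem_left_commute[of "P n"])
    then have "partial_trace n (P n * (?wa * R * ?wb)) = coeff_elem ?c * antisym_word d (M # l) * 1"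
      using close 1 by (simp add: partial_trace_coeff)
    then show ?thesis using word[of "coeff_elem ?c" 1] 1 by simp
  next
    case 2
    have "?wa * R = R * ?wa" using 2 by (intro perm_elem_commute_TX[OF R]) auto
    then have waR: "?wa * (R * z) = R * (?wa * z)" for z by (simp only: mult.assoc[symmetric])
    have Rn: "R \<in> free_at n" using R 2 by (simp add: TX_iff_free_at)
    then have "P n * R = R * P n" unfolding P_def by (rule pos_elem_commute_free_at)
    then have PR: "P n * (R * z) = R * (P n * z)" for z by (simp only: mult.assoc[symmetric])
    have "P n * (?wa * R * ?wb) = R * (P n * (?wa * ?wb))"
      by (simp only: mult.assoc waR PR)
    then have "partial_trace n (P n * (?wa * R * ?wb)) = 1 * R * partial_trace n (P n * (?wa * ?wb))"
      by (simp add: partial_trace_left[OF Rn])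
    also have "\<dots> \<in> core_ideal d n"
      unfolding R_def using l 2
      by (intro core_ideal_antisym_word partial_trace_TX twisted_carrier_mult w_TX P_TX) (simp_all add: q_def)
    finally show ?thesis .
  next
    case 3
    have "?wb * R = R * ?wb" using 3 by (intro perm_elem_commute_TX[OF R]) auto
    then have "P n * (?wa * R * ?wb) = P n * (?wa * ?wb) * R"
      by (simp only: mult.assoc)
    moreover have "R \<in> free_at n" using R 3 by (simp add: TX_iff_free_at)
    ultimately have "partial_trace n (P n * (?wa * R * ?wb)) = partial_trace n (P n * (?wa * ?wb)) * R * 1"
      by (simp add: partial_trace_right)
    also have "\<dots> \<in> core_ideal d n"
      unfolding R_def using l 3
      by (intro core_ideal_antisym_word partial_trace_TX twisted_carrier_mult w_TX P_TX) (simp_all add: q_def)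
    finally show ?thesis .
  next
    case 4
    define p where "p = q - 1"
    have p: "p < n" "q = Suc p" using 4 by (simp_all add: p_def)
    let ?\<pi>a = "\<langle>a \<leftrightarrow> p\<rangle>" and ?\<pi>b = "\<langle>b \<leftrightarrow> p\<rangle>" and ?w = "\<langle>p \<leftrightarrow> n\<rangle>"
    have \<pi>: "?\<pi>a \<in> sym_group q" "?\<pi>b \<in> sym_group q" using 4 p by (auto intro!: swap_sym_group)
    \<comment> \<open>By antisymmetry of the word, both \<open>a\<close> and \<open>b\<close> can be
      moved to its last open strand \<open>p\<close>. What remains is conjugation by the
      transposition of \<open>p\<close> and \<open>n\<close>, which turns closing \<open>n\<close>
      into closing \<open>p\<close>.\<close>
    have "\<langle>c \<leftrightarrow> n\<rangle> = \<langle>c \<leftrightarrow> p\<rangle> * ?w * \<langle>c \<leftrightarrow> p\<rangle>" if "c < n" for c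
      using that p by (intro perm_eqI) (auto simp: apply_times apply_swap)
    then have wa: "?wa = perm_elem ?\<pi>a * perm_elem ?w * perm_elem ?\<pi>a"
      and wb: "?wb = perm_elem ?\<pi>b * perm_elem ?w * perm_elem ?\<pi>b"
      using 4 by (simp_all flip: perm_elem_mult)
    let ?c = "const_tr (perm_sign ?\<pi>a) * const_tr (perm_sign ?\<pi>b)"
    have free: "perm_elem ?\<pi>a \<in> free_at n" "perm_elem ?\<pi>b \<in> free_at n"
      using 4 p by (auto intro!: free_at_perm)
    have \<pi>_TX: "perm_elem ?\<pi>a \<in> TX n" "perm_elem ?\<pi>b \<in> TX n"
      using 4 p by (auto intro!: perm_elem_TX swap_sym_group)
    have "?wa * R * ?wb = perm_elem ?\<pi>a * perm_elem ?w * (perm_elem ?\<pi>a * R * perm_elem ?\<pi>b) * (perm_elem ?w * perm_elem ?\<pi>b)"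
      unfolding wa wb by (simp only: mult.assoc)
    also have "perm_elem ?\<pi>a * R * perm_elem ?\<pi>b = coeff_elem ?c * R"
      using \<pi> by (simp add: RL RR mult.assoc coeff_elem_mult)
    finally have "P n * (?wa * R * ?wb) = coeff_elem ?c * (P n * perm_elem ?\<pi>a * (perm_elem ?w * R * perm_elem ?w) * perm_elem ?\<pi>b)"
      by (simp only: mult.assoc coeff_elem_left_commute[of "perm_elem _"] coeff_elem_left_commute[of "P n"])
    also have "P n * perm_elem ?\<pi>a = perm_elem ?\<pi>a * P n"
      unfolding P_def by (rule pos_elem_commute_free_at[OF free(1)])
    finally have "partial_trace n (P n * (?wa * R * ?wb)) =
        coeff_elem ?c * (perm_elem ?\<pi>a * partial_trace n (P n * (perm_elem ?w * R * perm_elem ?w)) * perm_elem ?\<pi>b)"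
      by (simp only: partial_trace_coeff partial_trace_right[OF free(2)] mult.assoc partial_trace_left[OF free(1)])
        (simp only: mult.assoc[symmetric] partial_trace_right[OF free(2)])
    also have "P n * (perm_elem ?w * R * perm_elem ?w) = perm_elem ?w * (P p * R) * perm_elem (inverse ?w)"
      by (simp add: P_def perm_elem_pos_elem flip: mult.assoc)
    also have "partial_trace n \<dots> = perm_elem ?w * partial_trace p (P p * R) * perm_elem (inverse ?w)"
      using partial_trace_conjugate[of ?w p "P p * R"] by simp
    also have "\<dots> = antisym_word d (M # l)"
    proof -
      have "partial_trace p (P p * R) \<in> TX p"
        using R p by (intro partial_trace_TX twisted_carrier_mult) (simp_all add: P_def pos_elem_TX)
      then have "perm_elem ?w * partial_trace p (P p * R) = partial_trace p (P p * R) * perm_elem ?w"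
        using p by (intro perm_elem_commute_TX[of _ p]) auto
      then have "perm_elem ?w * partial_trace p (P p * R) * perm_elem (inverse ?w) = partial_trace p (P p * R)"
        by (simp only: mult.assoc perm_elem_inverse mult_1_right)
      then show ?thesis using close p by simp
    qed
    finally have "partial_trace n (P n * (?wa * R * ?wb)) =
        (coeff_elem ?c * perm_elem ?\<pi>a) * antisym_word d (M # l) * perm_elem ?\<pi>b"
      by (simp only: mult.assoc)
    then show ?thesis
      using word[OF _ twisted_carrier_mult[OF coeff_elem_TX \<pi>_TX(1)] \<pi>_TX(2)] p by simp
  qed
  then show ?thesis by (simp only: P_def R_def)
qed

text \<open>Coset decomposition for monomials: all of \<open>s\<close> except one monomial and one
  transposition can be made idle on strand \<open>n\<close>, and the idle part leaves the partial
  trace. Here \<open>a\<close> is the preimage of \<open>n\<close> under the permutation; in the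
  mirror image that follows, \<open>b\<close> is the image of \<open>n\<close>.\<close>

lemma tensor_monomial_split_left:
  assumes s: "s \<in> tensor_monomials (Suc n)"
  obtains s' M a where "s' \<in> tensor_monomials n" "a \<le> n"
    "s = s' + (pos_monomial n M + TMon (\<lambda>_. 0) \<langle>a \<leftrightarrow> n\<rangle>)"
proof -
  let ?\<sigma> = "permutation s"
  define a where "a = inverse ?\<sigma> \<langle>$\<rangle> n"
  have \<sigma>a: "?\<sigma> \<langle>$\<rangle> a = n" by (simp add: a_def)
  have an: "?\<sigma> \<langle>$\<rangle> n = n" if "a = n" using \<sigma>a that by simp
  have a: "a \<le> n" using inverse_less[OF s, of n] by (simp add: a_def)
  define s' where "s' = TMon ((factors s)(n := 0)) (?\<sigma> * \<langle>a \<leftrightarrow> n\<rangle>)"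
  have "s' \<in> tensor_monomials n"
    using s a \<sigma>a by (auto simp: tensor_monomials_iff fixes_pos_def s'_def apply_times apply_swap le_Suc_eq Suc_le_eq)
  moreover have "s = s' + (pos_monomial n (factors s n) + TMon (\<lambda>_. 0) \<langle>a \<leftrightarrow> n\<rangle>)"
    by (rule tensor_monomial_eqI)
      (auto simp: factors_plus permutation_plus s'_def pos_monomial_def apply_times apply_swap apply_inverse_eq_iff \<sigma>a dest: an)
  ultimately show ?thesis using that a by blast
qed

lemma tensor_monomial_split_right:
  assumes s: "s \<in> tensor_monomials (Suc n)"
  obtains s' M b where "s' \<in> tensor_monomials n" "b \<le> n"
    "s = TMon (\<lambda>_. 0) \<langle>b \<leftrightarrow> n\<rangle> + pos_monomial n M + s'"
proof -
  let ?\<sigma> = "permutation s"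
  define b where "b = ?\<sigma> \<langle>$\<rangle> n"
  have b: "b \<le> n" using s sym_group_less[of ?\<sigma> "Suc n" n] by (simp add: b_def tensor_monomials_def)
  define s' where "s' = TMon (\<lambda>i. if i = n then 0 else factors s (\<langle>b \<leftrightarrow> n\<rangle> \<langle>$\<rangle> i)) (\<langle>b \<leftrightarrow> n\<rangle> * ?\<sigma>)"
  have "s' \<in> tensor_monomials n"
    using s b by (auto simp: tensor_monomials_iff fixes_pos_def s'_def apply_times apply_swap le_Suc_eq Suc_le_eq b_def)
      (metis apply_inj le_neq_implies_less)+
  moreover have "s = TMon (\<lambda>_. 0) \<langle>b \<leftrightarrow> n\<rangle> + pos_monomial n (factors s b) + s'"
    by (rule tensor_monomial_eqI)
      (auto simp: factors_plus permutation_plus s'_def pos_monomial_def apply_times apply_swap)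
  ultimately show ?thesis using that b by blast
qed

lemma core_ideal_partial_trace:
  assumes "z \<in> core_ideal d (Suc n)"
  shows "partial_trace n z \<in> core_ideal d n"
  using assms
proof (induction rule: core_ideal_induct)
  case (word a b l)
  consider "a = 0 \<or> b = 0" | "a \<noteq> 0" "b \<noteq> 0" by blast
  then show ?case
  proof cases
    case 1
    then show ?thesis by (auto simp: core_ideal_zero)
  next
    case 2
    obtain s c t c' where a: "a = Poly_Mapping.single s c" and b: "b = Poly_Mapping.single t c'"
      using word(5,6) by blast
    have st: "s \<in> tensor_monomials (Suc n)" "t \<in> tensor_monomials (Suc n)"
    proof -
      have "c \<noteq> 0" "c' \<noteq> 0" using 2 a b by auto
      then show "s \<in> tensor_monomials (Suc n)" "t \<in> tensor_monomials (Suc n)"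
        using word(1,2) by (simp_all add: a b TX_iff)
    qed
    obtain s' M i where s: "s' \<in> tensor_monomials n" "i \<le> n" "s = s' + (pos_monomial n M + TMon (\<lambda>_. 0) \<langle>i \<leftrightarrow> n\<rangle>)"
      using tensor_monomial_split_left[OF st(1)] .
    obtain t' N j where t: "t' \<in> tensor_monomials n" "j \<le> n" "t = TMon (\<lambda>_. 0) \<langle>j \<leftrightarrow> n\<rangle> + pos_monomial n N + t'"
      using tensor_monomial_split_right[OF st(2)] .
    let ?wi = "perm_elem \<langle>i \<leftrightarrow> n\<rangle>" and ?wj = "perm_elem \<langle>j \<leftrightarrow> n\<rangle>"
    let ?s = "Poly_Mapping.single s' c" and ?t = "Poly_Mapping.single t' c'"
    have free: "?s \<in> free_at n" "?t \<in> free_at n"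
      using s(1) t(1) by (auto simp: tensor_monomials_iff intro: free_at_single)
    have a': "a = ?s * (pos_elem n M * ?wi)"
      by (simp add: a s(3) pos_elem_def perm_elem_def mult_single)
    have b': "b = ?wj * pos_elem n N * ?t"
      by (simp add: b t(3) pos_elem_def perm_elem_def mult_single)
    have "a * antisym_word d l * b = ?s * ((pos_elem n M * (?wi * antisym_word d l * ?wj)) * pos_elem n N) * ?t"
      unfolding a' b' by (simp only: mult.assoc)
    then have "partial_trace n (a * antisym_word d l * b) =
        ?s * partial_trace n ((pos_elem n M * (?wi * antisym_word d l * ?wj)) * pos_elem n N) * ?t"
      by (simp only: partial_trace_right[OF free(2)] partial_trace_left[OF free(1)])
    \<comment> \<open>Cyclicity of the partial trace brings \<open>N\<close> from the right end to
      the front, where it merges with \<open>M\<close>.\<close>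
    also have "partial_trace n ((pos_elem n M * (?wi * antisym_word d l * ?wj)) * pos_elem n N) =
        partial_trace n (pos_elem n (N + M) * (?wi * antisym_word d l * ?wj))"
      by (subst partial_trace_pos_commute[symmetric]) (simp only: pos_elem_plus mult.assoc)
    also have "?s * \<dots> * ?t \<in> core_ideal d n"
      using core_ideal_partial_trace_word[OF word(3,4) s(2) t(2)] s(1) t(1)
      by (intro core_ideal_mult twisted_carrier_single)
    finally show ?thesis .
  qed
next
  case (dim a)
  then show ?case by (simp add: partial_trace_coeff core_ideal_dim_elem partial_trace_TX)
qed (simp_all add: core_ideal_zero core_ideal_add partial_trace_add)

section \<open>The kernel of the symmetric group acting on tensors\<close>

definition perm_sum :: "nat \<Rightarrow> (nat perm \<Rightarrow> rat) \<Rightarrow> twisted_element" where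
  "perm_sum n f = (\<Sum>\<sigma>\<in>sym_group n. rat_elem (f \<sigma>) * perm_elem \<sigma>)"

lemma perm_sum_diff: "perm_sum n (\<lambda>\<sigma>. f \<sigma> - q * g \<sigma>) = perm_sum n f - rat_elem q * perm_sum n g"
  by (simp add: perm_sum_def const_tr_diff const_tr_mult coeff_elem_diff coeff_elem_mult
      left_diff_distrib sum_subtractf sum_distrib_left mult.assoc)

lemma ev_perm_sum:
  assumes I: "I \<in> multi_indices d n" and J: "J \<in> multi_indices d n"
  shows "ev d n A (perm_sum n f) I J = (\<Sum>\<sigma>\<in>sym_group n. if \<forall>i<n. I (\<sigma> \<langle>$\<rangle> i) = J i then f \<sigma> else 0)"
  unfolding perm_sum_def ev_sum
proof (rule sum.cong)
  fix \<sigma> assume \<sigma>: "\<sigma> \<in> sym_group n"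
  have "ev d n A (1 * perm_elem \<sigma>) I J = (\<Prod>i<n. 1\<^sub>m d $$ (I i, J (inverse \<sigma> \<langle>$\<rangle> i)))"
    unfolding ev_mult_perm by (rule ev_one)
  also have "\<dots> = (\<Prod>i<n. if I (\<sigma> \<langle>$\<rangle> i) = J i then 1 else 0)"
    by (rule prod.reindex_bij_witness[of _ "\<lambda>i. \<sigma> \<langle>$\<rangle> i" "\<lambda>i. inverse \<sigma> \<langle>$\<rangle> i"])
      (auto simp: sym_group_less[OF \<sigma>] sym_group_less[OF sym_group_inverse[OF \<sigma>]]
        multi_indices_less[OF I] multi_indices_less[OF J])
  also have "\<dots> = (if \<forall>i<n. I (\<sigma> \<langle>$\<rangle> i) = J i then 1 else 0)"
    by (auto intro!: prod.neutral prod_zero)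
  finally have e: "ev d n A (perm_elem \<sigma>) I J = (if \<forall>i<n. I (\<sigma> \<langle>$\<rangle> i) = J i then 1 else 0)"
    by (simp only: mult_1_left)
  have "q * (if P then 1 else 0) = (if P then q else 0)" for q :: rat and P by simp
  then show "ev d n A (rat_elem (f \<sigma>) * perm_elem \<sigma>) I J = (if \<forall>i<n. I (\<sigma> \<langle>$\<rangle> i) = J i then f \<sigma> else 0)"
    unfolding ev_coeff_mult eval_const_tr e .
qed simp

section \<open>Decreasing subsequences and the lexicographic order\<close>

definition decreasing_on :: "nat perm \<Rightarrow> nat set \<Rightarrow> bool" where
  "decreasing_on \<sigma> S \<longleftrightarrow> (\<forall>i\<in>S. \<forall>j\<in>S. i < j \<longrightarrow> \<sigma> \<langle>$\<rangle> j < \<sigma> \<langle>$\<rangle> i)"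

text \<open>The colour of \<open>i\<close> is the length of the longest decreasing subsequence ending at \<open>i\<close>.\<close>

lemma increasing_colouring:
  assumes no: "\<And>S. S \<subseteq> {..<n} \<Longrightarrow> card S = Suc d \<Longrightarrow> \<not> decreasing_on \<sigma> S"
  obtains c :: "nat \<Rightarrow> nat" where "\<And>i. i < n \<Longrightarrow> c i < d"
    "\<And>i j. i < j \<Longrightarrow> j < n \<Longrightarrow> c i = c j \<Longrightarrow> \<sigma> \<langle>$\<rangle> i < \<sigma> \<langle>$\<rangle> j"
proof -
  define F where "F i = {T. T \<subseteq> {..i} \<and> i \<in> T \<and> decreasing_on \<sigma> T}" for i
  \<comment> \<open>Lengths run from 1 to \<open>d\<close> for positions below \<open>n\<close>;
    subtracting 1 makes the colours usable as indices of basis vectors.\<close>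
  define c where "c i = Max (card ` F i) - 1" for i
  have fin: "finite (F i)" for i
    by (rule finite_subset[of _ "Pow {..i}"]) (auto simp: F_def)
  have single: "{i} \<in> F i" for i by (simp add: F_def decreasing_on_def)
  have small: "card T \<le> d" if T: "T \<in> F i" and i: "i < n" for T i
  proof (rule ccontr)
    assume "\<not> card T \<le> d"
    then obtain S where S: "S \<subseteq> T" "card S = Suc d"
      by (metis not_less_eq_eq obtain_subset_with_card_n)
    moreover have "S \<subseteq> {..<n}" using S(1) T i by (force simp: F_def)
    moreover have "decreasing_on \<sigma> S" using T S(1) unfolding F_def decreasing_on_def by blast
    ultimately show False using no[of S] by simp
  qed
  have Max_in: "Max (card ` F i) \<in> card ` F i" for i
    using fin single by (intro Max_in) auto
  have pos: "1 \<le> Max (card ` F i)" for i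
    using Max_ge[of "card ` F i" "card {i}"] fin single by (metis card_1_singleton_iff finite_imageI imageI One_nat_def)
  have "c i < d" if "i < n" for i
  proof -
    obtain T where "T \<in> F i" "card T = Max (card ` F i)" using Max_in[of i] by auto
    then show ?thesis using small[OF _ that, of T] pos[of i] by (simp add: c_def)
  qed
  moreover have "\<sigma> \<langle>$\<rangle> i < \<sigma> \<langle>$\<rangle> j" if ij: "i < j" "j < n" "c i = c j" for i j
  proof (rule ccontr)
    assume "\<not> \<sigma> \<langle>$\<rangle> i < \<sigma> \<langle>$\<rangle> j"
    then have less: "\<sigma> \<langle>$\<rangle> j < \<sigma> \<langle>$\<rangle> i" using ij(1) by (metis apply_inj less_imp_neq linorder_neqE_nat)
    obtain T where T: "T \<in> F i" "card T = Max (card ` F i)" using Max_in[of i] by auto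
    \<comment> \<open>A longest decreasing subsequence ending at \<open>i\<close> can be continued
      by \<open>j\<close>, so the colour would have to grow from \<open>i\<close> to
      \<open>j\<close>.\<close>
    have "insert j T \<in> F j"
      unfolding F_def
    proof (intro CollectI conjI)
      show "insert j T \<subseteq> {..j}" using T(1) ij(1) by (auto simp: F_def)
      show "decreasing_on \<sigma> (insert j T)"
        unfolding decreasing_on_def
      proof (intro ballI impI)
        fix a b assume ab: "a \<in> insert j T" "b \<in> insert j T" "a < b"
        have le: "x \<le> i" if "x \<in> T" for x using that T(1) by (auto simp: F_def)
        have dec: "\<sigma> \<langle>$\<rangle> y < \<sigma> \<langle>$\<rangle> x" if "x \<in> T" "y \<in> T" "x < y" for x y
          using that T(1) by (auto simp: F_def decreasing_on_def)
        have "i \<in> T" using T(1) by (simp add: F_def)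
        from ab le ij(1) have a: "a \<in> T" by fastforce
        have "\<sigma> \<langle>$\<rangle> i \<le> \<sigma> \<langle>$\<rangle> a" using le[OF a] dec[OF a \<open>i \<in> T\<close>] by (cases "a = i") auto
        then show "\<sigma> \<langle>$\<rangle> b < \<sigma> \<langle>$\<rangle> a"
          using ab(2,3) less dec[OF a] by auto
      qed
    qed simp
    then have "card (insert j T) \<le> Max (card ` F j)" using fin by (intro Max_ge) auto
    moreover have "finite T" "j \<notin> T" using T(1) ij(1) finite_subset[of T "{..i}"] by (auto simp: F_def)
    ultimately have "Suc (Max (card ` F i)) \<le> Max (card ` F j)" using T(2) by simp
    then show False using ij(3) pos[of i] by (simp add: c_def)
  qed
  ultimately show ?thesis using that by blast
qed

lemma perm_extending:
  assumes S: "S \<subseteq> {..<n}" "card S = m"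
  obtains \<pi> where "\<pi> \<in> sym_group n" "(\<lambda>i. \<pi> \<langle>$\<rangle> i) ` {..<m} = S"
proof -
  have fin: "finite S" using S(1) finite_subset by blast
  have m: "m \<le> n" using card_mono[OF _ S(1)] S(2) by simp
  obtain f where f: "bij_betw f {..<m} S"
    using finite_same_card_bij[OF _ fin, of "{..<m}"] S(2) by auto
  have "card {m..<n} = card ({..<n} - S)"
    using S fin by (simp add: card_Diff_subset)
  then obtain g where g: "bij_betw g {m..<n} ({..<n} - S)"
    using finite_same_card_bij[of "{m..<n}" "{..<n} - S"] by auto
  define h where "h i = (if i < m then f i else if i < n then g i else i)" for i
  have h: "bij_betw h {..<m} S" "bij_betw h {m..<n} ({..<n} - S)" "bij_betw h {n..} {n..}"
  proof -
    show "bij_betw h {..<m} S" using f by (subst bij_betw_cong[of _ h f]) (auto simp: h_def)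
    show "bij_betw h {m..<n} ({..<n} - S)" using g by (subst bij_betw_cong[of _ h g]) (auto simp: h_def)
    show "bij_betw h {n..} {n..}" using m by (subst bij_betw_cong[of _ h id]) (auto simp: h_def)
  qed
  have "bij_betw h ({..<m} \<union> {m..<n}) (S \<union> ({..<n} - S))"
    using h(1,2) by (rule bij_betw_combine) auto
  then have hn: "bij_betw h {..<n} {..<n}"
    using m S(1) by (simp add: ivl_disj_un Un_absorb1)
  have "bij_betw h ({..<n} \<union> {n..}) ({..<n} \<union> {n..})"
    using hn h(3) by (rule bij_betw_combine) auto
  moreover have "{..<n} \<union> {n..} = (UNIV :: nat set)" by auto
  ultimately have "bij h" by simp
  moreover have "{i. h i \<noteq> i} \<subseteq> {..<n}"
  proof
    fix i assume "i \<in> {i. h i \<noteq> i}"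
    then show "i \<in> {..<n}" using m by (cases "i < n") (auto simp: h_def)
  qed
  then have "finite {i. h i \<noteq> i}" by (rule finite_subset) simp
  ultimately have apply_h: "Perm h \<langle>$\<rangle> i = h i" for i by (simp add: Perm_inverse)
  show ?thesis
  proof (rule that)
    show "Perm h \<in> sym_group n" using m by (auto simp: sym_group_iff apply_h h_def)
    show "(\<lambda>i. Perm h \<langle>$\<rangle> i) ` {..<m} = S" using h(1) by (simp add: apply_h bij_betw_def)
  qed
qed

text \<open>The element is the antisymmetrizer over the letters in \<open>S\<close>, that is the
  conjugate by \<open>\<pi>\<close> of the one on the first d + 1 letters, multiplied on the left by
  \<open>\<sigma>\<close>. Its terms are the permutations that differ from \<open>\<sigma>\<close>
  only on \<open>S\<close>, and the identity contributes \<open>\<sigma>\<close> with coefficient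
  1.\<close>

lemma antisymmetrized_perm:
  assumes \<sigma>: "\<sigma> \<in> sym_group n" and S: "S \<subseteq> {..<n}" "card S = Suc d"
  obtains g where "perm_sum n g \<in> core_ideal d n" "g \<sigma> = 1"
    "\<And>\<rho> i. g \<rho> \<noteq> 0 \<Longrightarrow> i \<notin> S \<Longrightarrow> \<rho> \<langle>$\<rangle> i = \<sigma> \<langle>$\<rangle> i"
proof -
  obtain \<pi> where \<pi>: "\<pi> \<in> sym_group n" "(\<lambda>i. \<pi> \<langle>$\<rangle> i) ` {..<Suc d} = S"
    using perm_extending[OF S] .
  have d: "Suc d \<le> n" using card_mono[OF _ S(1)] S(2) by simp
  \<comment> \<open>The coordinate on the coset: it recovers \<tau> from \<rho> = \<sigma> \<pi>
    \<tau> \<pi>^-1.\<close>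
  let ?t = "\<lambda>\<rho>. inverse \<pi> * inverse \<sigma> * \<rho> * \<pi>"
  define H where "H = {\<rho> \<in> sym_group n. ?t \<rho> \<in> sym_group (Suc d)}"
  define g where "g \<rho> = (if \<rho> \<in> H then perm_sign (?t \<rho>) else 0)" for \<rho>
  have "perm_sum n g = (\<Sum>\<rho>\<in>H. rat_elem (perm_sign (?t \<rho>)) * perm_elem \<rho>)"
    unfolding perm_sum_def g_def
    by (rule sum.mono_neutral_cong_right) (auto simp: H_def finite_sym_group)
  also have "\<dots> = (\<Sum>\<tau>\<in>sym_group (Suc d). rat_elem (perm_sign \<tau>) * perm_elem (\<sigma> * \<pi> * \<tau> * inverse \<pi>))"
  proof (rule sum.reindex_bij_witness[of _ "\<lambda>\<tau>. \<sigma> * \<pi> * \<tau> * inverse \<pi>" ?t])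
    fix \<tau> assume \<tau>: "\<tau> \<in> sym_group (Suc d)"
    have t: "?t (\<sigma> * \<pi> * \<tau> * inverse \<pi>) = \<tau>" by (simp add: mult.assoc flip: mult.assoc[of "inverse _"])
    then show "?t (\<sigma> * \<pi> * \<tau> * inverse \<pi>) = \<tau>" .
    show "\<sigma> * \<pi> * \<tau> * inverse \<pi> \<in> H"
      using t \<tau> \<sigma> \<pi>(1) sym_group_mono[OF \<tau> d] by (simp add: H_def sym_group_times sym_group_inverse)
  next
    fix \<rho> assume \<rho>: "\<rho> \<in> H"
    show eq: "\<sigma> * \<pi> * ?t \<rho> * inverse \<pi> = \<rho>"
      by (simp add: perm_eq_iff apply_times)
    show "?t \<rho> \<in> sym_group (Suc d)" using \<rho> by (simp add: H_def)
    show "rat_elem (perm_sign (?t \<rho>)) * perm_elem (\<sigma> * \<pi> * ?t \<rho> * inverse \<pi>) = rat_elem (perm_sign (?t \<rho>)) * perm_elem \<rho>"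
      by (simp only: eq)
  qed
  also have "\<dots> = perm_elem (\<sigma> * \<pi>) * antisym_word d [] * perm_elem (inverse \<pi>)"
    by (simp add: antisymmetrizer_def sum_distrib_left sum_distrib_right perm_elem_mult mult.assoc
        coeff_elem_left_commute[of "perm_elem _"])
  also have "\<dots> \<in> core_ideal d n"
    using d \<sigma> \<pi>(1) by (intro core_ideal_antisym_word perm_elem_TX sym_group_times sym_group_inverse) simp_all
  finally have "perm_sum n g \<in> core_ideal d n" .
  moreover have "?t \<sigma> = 1" by (simp add: perm_eq_iff apply_times)
  then have "g \<sigma> = 1" using \<sigma> by (simp add: g_def H_def sym_group_one)
  moreover have "\<rho> \<langle>$\<rangle> i = \<sigma> \<langle>$\<rangle> i" if "g \<rho> \<noteq> 0" "i \<notin> S" for \<rho> i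
  proof -
    have "?t \<rho> \<in> sym_group (Suc d)" using that(1) by (auto simp: g_def H_def split: if_splits)
    moreover have "\<not> inverse \<pi> \<langle>$\<rangle> i < Suc d"
    proof
      assume "inverse \<pi> \<langle>$\<rangle> i < Suc d"
      then have "\<pi> \<langle>$\<rangle> (inverse \<pi> \<langle>$\<rangle> i) \<in> S" unfolding \<pi>(2)[symmetric] by (intro imageI) simp
      then show False using that(2) by simp
    qed
    ultimately have "?t \<rho> \<langle>$\<rangle> (inverse \<pi> \<langle>$\<rangle> i) = inverse \<pi> \<langle>$\<rangle> i" by (simp add: sym_group_iff)
    then show ?thesis by (simp add: apply_times apply_inverse_eq_iff)
  qed
  ultimately show ?thesis using that by blast
qed

text \<open>At the first difference \<open>i\<close>, the value of \<open>\<rho>\<close> is a value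
  of \<open>\<sigma>\<close> at some other place of \<open>S\<close>. Values at earlier places are
  already taken, so this place is later, and there \<open>\<sigma>\<close> is smaller.\<close>

lemma less_fun_of_decreasing:
  assumes dec: "decreasing_on \<sigma> S" and outside: "\<And>i. i \<notin> S \<Longrightarrow> \<rho> \<langle>$\<rangle> i = \<sigma> \<langle>$\<rangle> i" and ne: "\<rho> \<noteq> \<sigma>"
  shows "less_fun (apply \<rho>) (apply \<sigma>)"
proof -
  define i where "i = (LEAST i. \<rho> \<langle>$\<rangle> i \<noteq> \<sigma> \<langle>$\<rangle> i)"
  have "\<exists>i. \<rho> \<langle>$\<rangle> i \<noteq> \<sigma> \<langle>$\<rangle> i" using ne by (simp add: perm_eq_iff)
  then have i: "\<rho> \<langle>$\<rangle> i \<noteq> \<sigma> \<langle>$\<rangle> i" unfolding i_def by (rule LeastI_ex)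
  have before: "\<rho> \<langle>$\<rangle> j = \<sigma> \<langle>$\<rangle> j" if "j < i" for j
    using not_less_Least[of j "\<lambda>i. \<rho> \<langle>$\<rangle> i \<noteq> \<sigma> \<langle>$\<rangle> i"] that by (simp add: i_def)
  define j where "j = inverse \<sigma> \<langle>$\<rangle> (\<rho> \<langle>$\<rangle> i)"
  have j: "\<sigma> \<langle>$\<rangle> j = \<rho> \<langle>$\<rangle> i" by (simp add: j_def)
  have "j \<noteq> i" using i j by metis
  have "i \<in> S" using outside i by blast
  moreover have "j \<in> S" using outside j \<open>j \<noteq> i\<close> by (metis apply_inj)
  moreover have "i < j" using before j \<open>j \<noteq> i\<close> by (metis apply_inj linorder_neqE_nat)
  ultimately have "\<sigma> \<langle>$\<rangle> j < \<sigma> \<langle>$\<rangle> i" using dec by (simp add: decreasing_on_def)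
  then show ?thesis
    using j before by (intro less_funI exI[of _ i]) simp
qed

text \<open>
  The lexicographically largest permutation in the support of an element of the kernel has a decreasing
  subsequence of length \<open>d + 1\<close>: otherwise the tensor with the indices of an increasing colouring isolates
  its coefficient. Antisymmetrizing over the subsequence replaces it by smaller permutations.
\<close>

lemma perm_sum_identity:
  assumes f: "perm_sum n f \<in> tensor_identities d n"
  shows "perm_sum n f \<in> core_ideal d n"
proof -
  \<comment> \<open>Counting the lexicographically smaller permutations turns the descent in the
    support into an induction over natural numbers.\<close>
  define rank where "rank \<rho> = card {\<tau> \<in> sym_group n. less_fun (apply \<tau>) (apply \<rho>)}" for \<rho>
  have rank_less: "rank \<sigma> < rank \<rho>" if "less_fun (apply \<sigma>) (apply \<rho>)" "\<sigma> \<in> sym_group n" for \<sigma> \<rho>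
    unfolding rank_def
  proof (intro psubset_card_mono psubsetI)
    show "{\<tau> \<in> sym_group n. less_fun (apply \<tau>) (apply \<sigma>)} \<subseteq> {\<tau> \<in> sym_group n. less_fun (apply \<tau>) (apply \<rho>)}"
      using less_fun_trans that(1) by blast
    show "{\<tau> \<in> sym_group n. less_fun (apply \<tau>) (apply \<sigma>)} \<noteq> {\<tau> \<in> sym_group n. less_fun (apply \<tau>) (apply \<rho>)}"
      using less_fun_irrefl that by blast
  qed (simp add: finite_sym_group)
  have total: "less_fun (apply \<sigma>) (apply \<rho>) \<or> \<sigma> = \<rho> \<or> less_fun (apply \<rho>) (apply \<sigma>)" for \<sigma> \<rho> :: "nat perm"
  proof -
    have "{k. \<sigma> \<langle>$\<rangle> k \<noteq> \<rho> \<langle>$\<rangle> k} \<subseteq> affected \<sigma> \<union> affected \<rho>" by (auto simp: in_affected)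
    then have "finite {k. \<sigma> \<langle>$\<rangle> k \<noteq> \<rho> \<langle>$\<rangle> k}" by (rule finite_subset) simp
    from less_fun_trichotomy[OF this] show ?thesis by (auto simp: apply_inject)
  qed
  have "\<forall>\<sigma>\<in>sym_group n. f \<sigma> \<noteq> 0 \<longrightarrow> rank \<sigma> < r \<Longrightarrow> ?thesis" for r
    using f
  proof (induction r arbitrary: f)
    case 0
    then have "perm_sum n f = 0" by (auto simp: perm_sum_def intro!: sum.neutral)
    then show ?case by (simp add: core_ideal_zero)
  next
    case (Suc r)
    show ?case
    proof (cases "\<exists>\<sigma>\<in>sym_group n. f \<sigma> \<noteq> 0 \<and> rank \<sigma> = r")
      case False
      then show ?thesis using Suc by (intro Suc.IH) (auto simp: less_Suc_eq)
    next
      case True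
      then obtain \<sigma> where \<sigma>: "\<sigma> \<in> sym_group n" "f \<sigma> \<noteq> 0" "rank \<sigma> = r" by blast
      have below: "less_fun (apply \<rho>) (apply \<sigma>)" if "\<rho> \<in> sym_group n" "f \<rho> \<noteq> 0" "\<rho> \<noteq> \<sigma>" for \<rho>
        using total[of \<rho> \<sigma>] rank_less[of \<sigma> \<rho>] Suc.prems(1) that \<sigma> by fastforce
      have "\<exists>S. S \<subseteq> {..<n} \<and> card S = Suc d \<and> decreasing_on \<sigma> S"
      proof (rule ccontr)
        assume "\<nexists>S. S \<subseteq> {..<n} \<and> card S = Suc d \<and> decreasing_on \<sigma> S"
        then obtain c where c: "\<And>i. i < n \<Longrightarrow> c i < d"
          "\<And>i j. i < j \<Longrightarrow> j < n \<Longrightarrow> c i = c j \<Longrightarrow> \<sigma> \<langle>$\<rangle> i < \<sigma> \<langle>$\<rangle> j"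
          using increasing_colouring[of n d \<sigma>] by metis
        define J where "J = (\<lambda>i\<in>{..<n}. c i)"
        \<comment> \<open>\<open>J\<close> carries the colours and \<open>I\<close> is
          \<open>J\<close> transported by \<open>\<sigma>\<close>. At this entry
          \<open>\<sigma>\<close> contributes, and another \<rho> does so only if \<sigma>^-1 \<rho>
          preserves colours.\<close>
        define I where "I = (\<lambda>i. J (inverse \<sigma> \<langle>$\<rangle> i))"
        have J: "J \<in> multi_indices d n" using c(1) by (simp add: J_def multi_indices_def)
        have I: "I \<in> multi_indices d n"
          unfolding I_def using \<sigma>(1) by (intro multi_indices_perm[OF J] sym_group_inverse)
        have only: "\<rho> = \<sigma>" if \<rho>: "\<rho> \<in> sym_group n" "f \<rho> \<noteq> 0" "\<forall>i<n. I (\<rho> \<langle>$\<rangle> i) = J i" for \<rho>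
        proof (rule ccontr)
          assume "\<rho> \<noteq> \<sigma>"
          then obtain k where k: "\<rho> \<langle>$\<rangle> k < \<sigma> \<langle>$\<rangle> k" "\<And>j. j < k \<Longrightarrow> \<rho> \<langle>$\<rangle> j = \<sigma> \<langle>$\<rangle> j"
            using below[OF \<rho>(1,2)] by (auto elim: less_funE)
          have kn: "k < n" using k(1) \<rho>(1) \<sigma>(1) by (metis not_le order.irrefl sym_group_iff)
          \<comment> \<open>At the first difference \<open>k\<close>, the smaller value \<rho>(k) is
            taken by \<open>\<sigma>\<close> at a later place \<open>m\<close> of the same colour,
            although \<open>\<sigma>\<close> increases along each colour.\<close>
          define m where "m = inverse \<sigma> \<langle>$\<rangle> (\<rho> \<langle>$\<rangle> k)"
          have m: "\<sigma> \<langle>$\<rangle> m = \<rho> \<langle>$\<rangle> k" by (simp add: m_def)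
          have mn: "m < n" unfolding m_def
            by (intro sym_group_less[OF sym_group_inverse[OF \<sigma>(1)]] sym_group_less[OF \<rho>(1)] kn)
          have "J m = J k" using \<rho>(3) kn by (simp add: I_def m_def)
          then have "c k = c m" using kn mn by (simp add: J_def)
          moreover have "k < m"
            using k m by (metis apply_inj less_irrefl linorder_neqE_nat)
          ultimately show False using c(2)[of k m] mn m k(1) by simp
        qed
        \<comment> \<open>No variable occurs in a combination of permutations, so any assignment
          serves.\<close>
        have "ev d n (\<lambda>_. 0\<^sub>m d d) (perm_sum n f) I J = 0"
          using Suc.prems(2) I J by (simp add: tensor_identities_iff assignment_def)
        also have "ev d n (\<lambda>_. 0\<^sub>m d d) (perm_sum n f) I J = (\<Sum>\<rho>\<in>sym_group n. if \<rho> = \<sigma> then f \<sigma> else 0)"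
          unfolding ev_perm_sum[OF I J]
          by (intro sum.cong refl) (use only in \<open>auto simp: I_def\<close>)
        also have "\<dots> = f \<sigma>" using \<sigma>(1) by (simp add: finite_sym_group)
        finally show False using \<sigma>(2) by simp
      qed
      then obtain S where S: "S \<subseteq> {..<n}" "card S = Suc d" "decreasing_on \<sigma> S" by blast
      obtain g where g: "perm_sum n g \<in> core_ideal d n" "g \<sigma> = 1"
        "\<And>\<rho> i. g \<rho> \<noteq> 0 \<Longrightarrow> i \<notin> S \<Longrightarrow> \<rho> \<langle>$\<rangle> i = \<sigma> \<langle>$\<rangle> i"
        by (rule antisymmetrized_perm[OF \<sigma>(1) S(1,2)], rule that)
      have scaled: "rat_elem (f \<sigma>) * perm_sum n g \<in> core_ideal d n"
        using g(1) by (rule core_ideal_mult) simp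
      let ?f = "\<lambda>\<rho>. f \<rho> - f \<sigma> * g \<rho>"
      have "rat_elem (f \<sigma>) * perm_sum n g \<in> tensor_identities d n"
        using core_ideal_subset[OF T_ideal_tensor_identities generators_le_tensor_identities] scaled by blast
      then have "perm_sum n ?f \<in> tensor_identities d n"
        using Suc.prems(2) by (simp add: perm_sum_diff tensor_identities_diff)
      moreover have "\<forall>\<rho>\<in>sym_group n. ?f \<rho> \<noteq> 0 \<longrightarrow> rank \<rho> < r"
      proof (intro ballI impI)
        fix \<rho> assume \<rho>: "\<rho> \<in> sym_group n" "?f \<rho> \<noteq> 0"
        then have ne: "\<rho> \<noteq> \<sigma>" using g(2) by auto
        from \<rho>(2) consider "f \<rho> \<noteq> 0" | "g \<rho> \<noteq> 0" by fastforce
        then have "less_fun (apply \<rho>) (apply \<sigma>)"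
          using below[OF \<rho>(1) _ ne] less_fun_of_decreasing[OF S(3) g(3) ne] by cases auto
        then show "rank \<rho> < r" using rank_less \<rho>(1) \<sigma>(3) by blast
      qed
      ultimately have "perm_sum n ?f \<in> core_ideal d n" by (intro Suc.IH)
      then have "perm_sum n ?f + rat_elem (f \<sigma>) * perm_sum n g \<in> core_ideal d n"
        using scaled by (rule core_ideal_add)
      then show ?thesis by (simp add: perm_sum_diff)
    qed
  qed
  from this[of "Suc (Max (rank ` sym_group n))"] show ?thesis
    by (simp add: finite_sym_group less_Suc_eq_le)
qed

section \<open>The degree filtration\<close>

definition tensor_degree :: "nat \<Rightarrow> tensor_monomial \<Rightarrow> nat" where
  "tensor_degree n t = (\<Sum>i<n. length (letters (factors t i)))"

lemma tensor_degree_0: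
  assumes "t \<in> tensor_monomials n" "tensor_degree n t = 0"
  shows "t = TMon (\<lambda>_. 0) (permutation t)"
proof -
  have "factors t i = 0" for i
  proof (cases "i < n")
    case True
    then have "letters (factors t i) = []" using assms(2) by (simp add: tensor_degree_def)
    then show ?thesis by (cases "factors t i") (simp add: zero_monomial_def)
  next
    case False
    then show ?thesis using assms(1) by (simp add: tensor_monomials_def)
  qed
  then show ?thesis by (intro tensor_monomial_eqI) simp_all
qed

definition trace_degree :: "cyc_monomial multiset \<Rightarrow> nat" where
  "trace_degree m = (\<Sum>y\<in>#m. length (letters (rep_cyc_monomial y)))"

text \<open>The bound is strict, so that \<open>D = 0\<close> leaves only the zero element and
  \<open>Suc D\<close> stands for degree at most \<open>D\<close>.\<close>

definition degree_less :: "nat \<Rightarrow> nat \<Rightarrow> twisted_element set" where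
  "degree_less n D = add_span {Poly_Mapping.single t (Poly_Mapping.single m q) | t m q.
     t \<in> tensor_monomials n \<and> tensor_degree n t + trace_degree m < D}"

lemma degree_less_single:
  "t \<in> tensor_monomials n \<Longrightarrow> tensor_degree n t + trace_degree m < D \<Longrightarrow>
   Poly_Mapping.single t (Poly_Mapping.single m q) \<in> degree_less n D"
  unfolding degree_less_def by (rule add_span_base) blast

lemma degree_less_zero [simp]: "0 \<in> degree_less n D"
  unfolding degree_less_def by (rule add_span.zero)

lemma degree_less_add: "a \<in> degree_less n D \<Longrightarrow> b \<in> degree_less n D \<Longrightarrow> a + b \<in> degree_less n D"
  unfolding degree_less_def by (rule add_span_add)

lemma degree_less_induct [consumes 1, case_names zero add]:
  assumes "a \<in> degree_less n D" "P 0"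
    "\<And>t m q b. t \<in> tensor_monomials n \<Longrightarrow> tensor_degree n t + trace_degree m < D \<Longrightarrow> P b \<Longrightarrow>
       P (Poly_Mapping.single t (Poly_Mapping.single m q) + b)"
  shows "P a"
  using assms(1) unfolding degree_less_def
  by (induction rule: add_span.induct) (auto intro: assms(2,3))

lemma degree_less_0: "a \<in> degree_less n 0 \<Longrightarrow> a = 0"
  by (induction rule: degree_less_induct) auto

lemma degree_less_mono: "a \<in> degree_less n D \<Longrightarrow> D \<le> E \<Longrightarrow> a \<in> degree_less n E"
  by (induction rule: degree_less_induct) (auto intro!: degree_less_add degree_less_single)

lemma degree_less_TX: "a \<in> degree_less n D \<Longrightarrow> a \<in> TX n"
  by (induction rule: degree_less_induct) (auto intro!: TX_add twisted_carrier_single)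

lemma degree_less_exhaust:
  assumes "a \<in> TX n"
  obtains D where "a \<in> degree_less n D"
proof -
  have sum: "\<exists>D. sum f I \<in> degree_less n D" if "\<And>i. i \<in> I \<Longrightarrow> \<exists>D. f i \<in> degree_less n D"
    for f :: "'i \<Rightarrow> twisted_element" and I
    using that
  proof (induction I rule: infinite_finite_induct)
    case (insert i I)
    then obtain D E where "f i \<in> degree_less n D" "sum f I \<in> degree_less n E" by blast
    then have "f i + sum f I \<in> degree_less n (max D E)"
      by (auto intro!: degree_less_add intro: degree_less_mono)
    then show ?case using insert by auto
  qed auto
  have "\<exists>D. Poly_Mapping.single t c \<in> degree_less n D" if t: "t \<in> tensor_monomials n" for t c
  proof -
    have "Poly_Mapping.single t c = (\<Sum>m\<in>Poly_Mapping.keys c. Poly_Mapping.single t (Poly_Mapping.single m (Poly_Mapping.lookup c m)))"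
    proof -
      have "Poly_Mapping.single t (sum g S) = (\<Sum>m\<in>S. Poly_Mapping.single t (g m))" for g :: "cyc_monomial multiset \<Rightarrow> trace_ring" and S
        by (induction S rule: infinite_finite_induct) (simp_all add: single_add)
      from this[of "\<lambda>m. Poly_Mapping.single m (Poly_Mapping.lookup c m)" "Poly_Mapping.keys c"]
      show ?thesis by (simp only: poly_mapping_sum_singles)
    qed
    also have "\<exists>D. \<dots> \<in> degree_less n D"
      by (rule sum) (use degree_less_single[OF t] in blast)
    finally show ?thesis .
  qed
  then have "\<exists>D. (\<Sum>t\<in>Poly_Mapping.keys a. Poly_Mapping.single t (Poly_Mapping.lookup a t)) \<in> degree_less n D"
    using assms by (intro sum) (auto simp: TX_iff)
  then show ?thesis using that by (auto simp: poly_mapping_sum_singles)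
qed

lemma tensor_degree_plus:
  assumes s: "s \<in> tensor_monomials n"
  shows "tensor_degree n (s + t) = tensor_degree n s + tensor_degree n t"
proof -
  have \<sigma>: "permutation s \<in> sym_group n" using s by (simp add: tensor_monomials_def)
  have "(\<Sum>i<n. length (letters (factors t (inverse (permutation s) \<langle>$\<rangle> i)))) = tensor_degree n t"
    unfolding tensor_degree_def
    by (rule sum.reindex_bij_witness[of _ "\<lambda>i. permutation s \<langle>$\<rangle> i" "\<lambda>i. inverse (permutation s) \<langle>$\<rangle> i"])
      (auto simp: sym_group_less[OF \<sigma>] sym_group_less[OF sym_group_inverse[OF \<sigma>]])
  then show ?thesis
    by (simp add: tensor_degree_def factors_plus plus_monomial_def sum.distrib)
qed

lemma degree_less_mult:
  assumes "a \<in> degree_less n D" "b \<in> degree_less n E"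
  shows "a * b \<in> degree_less n (D + E - 1)"
  using assms(1)
proof (induction rule: degree_less_induct)
  case (add t m q x)
  have "Poly_Mapping.single t (Poly_Mapping.single m q) * b \<in> degree_less n (D + E - 1)"
    using assms(2)
  proof (induction rule: degree_less_induct)
    case (add t' m' q' y)
    then have "tensor_degree n (t + t') + trace_degree (m + m') < D + E - 1"
      using \<open>tensor_degree n t + trace_degree m < D\<close> tensor_degree_plus[OF \<open>t \<in> tensor_monomials n\<close>, of t']
      by (simp add: trace_degree_def)
    then have "Poly_Mapping.single (t + t') (Poly_Mapping.single (m + m') (q * q')) \<in> degree_less n (D + E - 1)"
      using add(1) \<open>t \<in> tensor_monomials n\<close> by (intro degree_less_single tensor_monomials_plus)
    then show ?case using add(3) by (simp add: distrib_left mult_single degree_less_add)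
  qed simp
  then show ?case using add(3) by (simp add: distrib_right degree_less_add)
qed simp

lemma degree_less_Suc: "a \<in> degree_less n D \<Longrightarrow> a \<in> degree_less (Suc n) D"
proof (induction rule: degree_less_induct)
  case (add t m q b)
  have "tensor_degree (Suc n) t = tensor_degree n t"
    using add(1) by (simp add: tensor_degree_def tensor_monomials_def)
  then show ?case
    using add tensor_monomials_mono[of n "Suc n"] by (intro degree_less_add degree_less_single) auto
qed simp

lemma degree_less_of_nat: "a \<in> degree_less n D \<Longrightarrow> of_nat k * a \<in> degree_less n D"
  by (induction k) (simp_all add: distrib_right degree_less_add)


section \<open>Cutting at a variable\<close>

text \<open>The algebraic derivative at 0 of a polynomial function. The polynomial is determined by
  its values because the rationals are infinite.\<close>

definition has_deriv :: "(rat \<Rightarrow> rat) \<Rightarrow> rat \<Rightarrow> bool" where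
  "has_deriv f L \<longleftrightarrow> (\<exists>p. (\<forall>s. f s = poly p s) \<and> coeff p 1 = L)"

lemma has_deriv_const: "has_deriv (\<lambda>_. c) 0"
  unfolding has_deriv_def by (rule exI[of _ "[:c:]"]) simp

lemma has_deriv_linear: "has_deriv (\<lambda>s. c + s * k) k"
  unfolding has_deriv_def by (rule exI[of _ "[:c, k:]"]) simp

lemma has_deriv_add: "has_deriv f L \<Longrightarrow> has_deriv g M \<Longrightarrow> has_deriv (\<lambda>s. f s + g s) (L + M)"
  unfolding has_deriv_def by (metis coeff_add poly_add)

lemma has_deriv_mult:
  assumes "has_deriv f L" "has_deriv g M"
  shows "has_deriv (\<lambda>s. f s * g s) (f 0 * M + L * g 0)"
proof -
  obtain p q where p: "\<And>s. f s = poly p s" "coeff p 1 = L" and q: "\<And>s. g s = poly q s" "coeff q 1 = M"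
    using assms unfolding has_deriv_def by blast
  have "coeff (p * q) 1 = f 0 * M + L * g 0"
    using p(2) q(2) by (simp add: p(1) q(1) coeff_mult poly_0_coeff_0)
  then show ?thesis
    unfolding has_deriv_def by (intro exI[of _ "p * q"]) (simp add: p(1) q(1))
qed

lemma has_deriv_sum:
  "(\<And>i. i \<in> I \<Longrightarrow> has_deriv (f i) (L i)) \<Longrightarrow> has_deriv (\<lambda>s. \<Sum>i\<in>I. f i s) (\<Sum>i\<in>I. L i)"
  by (induction I rule: infinite_finite_induct) (auto intro: has_deriv_const has_deriv_add)

lemma has_deriv_zero: "has_deriv (\<lambda>_. 0) L \<Longrightarrow> L = 0"
  unfolding has_deriv_def by (metis coeff_0 poly_all_0_iff_0)

definition perturb :: "(nat \<Rightarrow> rat mat) \<Rightarrow> nat \<Rightarrow> rat mat \<Rightarrow> rat \<Rightarrow> nat \<Rightarrow> rat mat" where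
  "perturb A y C s = A(y := A y + s \<cdot>\<^sub>m C)"

lemma perturb_assignment: "assignment d A \<Longrightarrow> C \<in> carrier_mat d d \<Longrightarrow> assignment d (perturb A y C s)"
  by (auto simp: assignment_def perturb_def)

lemma perturb_0: "assignment d A \<Longrightarrow> C \<in> carrier_mat d d \<Longrightarrow> perturb A y C 0 = A"
proof
  fix i assume "assignment d A" "C \<in> carrier_mat d d"
  then have "A y \<in> carrier_mat d d" "C \<in> carrier_mat d d" by (auto simp: assignment_def)
  then show "perturb A y C 0 i = A i"
    by (cases "i = y") (auto simp: perturb_def intro!: eq_matI)
qed

text \<open>The value of \<open>b\<close> with its last strand closed through the matrix
  \<open>C\<close>, that is the contraction over strand \<open>n\<close> after multiplying this
  strand on the left by \<open>C\<close>. It is the evaluation of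
  \<open>partial_trace n (pos_elem n (Mon [y]) * b)\<close> with \<open>C\<close> in place of the
  matrix of the inserted variable.\<close>

definition cut_eval :: "nat \<Rightarrow> nat \<Rightarrow> (nat \<Rightarrow> rat mat) \<Rightarrow> rat mat \<Rightarrow> twisted_element \<Rightarrow> tensor_operator" where
  "cut_eval d n A C b I J = (\<Sum>i<d. \<Sum>j<d. C $$ (i, j) * ev d (Suc n) A b (I(n := j)) (J(n := i)))"

lemma cut_eval_add: "cut_eval d n A C (a + b) I J = cut_eval d n A C a I J + cut_eval d n A C b I J"
  by (simp add: cut_eval_def ev_add distrib_left sum.distrib)

lemma cut_eval_zero [simp]: "cut_eval d n A C 0 I J = 0"
  by (simp add: cut_eval_def)

lemma sum_multi_indices_Suc:
  "(\<Sum>K\<in>multi_indices d (Suc n). f K) = (\<Sum>K\<in>multi_indices d n. \<Sum>k<d. f (K(n := k)))"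
  unfolding sum.cartesian_product
  by (rule sum.reindex_bij_witness[of _ "\<lambda>(K, k). K(n := k)" "\<lambda>K. (K(n := undefined), K n)"])
    (auto simp: multi_indices_def PiE_def extensional_def less_Suc_eq)

lemma ev_Suc:
  assumes a: "a \<in> TX n" and "i < d" "k < d"
  shows "ev d (Suc n) A a (I(n := k)) (J(n := i)) = (if k = i then ev d n A a I J else 0)"
proof (rule additive_eqI[where F = "\<lambda>a. ev d (Suc n) A a (I(n := k)) (J(n := i))"])
  fix t c assume "t \<in> Poly_Mapping.keys a"
  with a have t: "t \<in> tensor_monomials n" by (auto simp: TX_iff)
  have "inverse (permutation t) \<langle>$\<rangle> n = n" "factors t n = 0"
    using t by (auto simp: tensor_monomials_def apply_inverse_eq_iff sym_group_iff)
  moreover have "inverse (permutation t) \<langle>$\<rangle> m \<noteq> n" if "m < n" for m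
    using inverse_less[OF t that] by simp
  ultimately have "ev_mon d (Suc n) A t (I(n := k)) (J(n := i)) = ev_mon d n A t I J * 1\<^sub>m d $$ (k, i)"
    by (simp add: ev_mon_def)
  then show "ev d (Suc n) A (Poly_Mapping.single t c) (I(n := k)) (J(n := i)) =
      (if k = i then ev d n A (Poly_Mapping.single t c) I J else 0)"
    using assms(2,3) by (simp add: ev_single)
qed (simp_all add: ev_add)

lemma cut_eval_right:
  assumes A: "assignment d A" and b: "b \<in> TX (Suc n)" and a: "a \<in> TX n"
    and I: "I \<in> multi_indices d n" and J: "J \<in> multi_indices d n"
  shows "cut_eval d n A C (b * a) I J = (\<Sum>K\<in>multi_indices d n. cut_eval d n A C b I K * ev d n A a K J)"
proof -
  have "ev d (Suc n) A (b * a) (I(n := j)) (J(n := i)) =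
      (\<Sum>K\<in>multi_indices d n. ev d (Suc n) A b (I(n := j)) (K(n := i)) * ev d n A a K J)" if "i < d" "j < d" for i j
  proof -
    have "(\<Sum>k<d. ev d (Suc n) A b (I(n := j)) (K(n := k)) * ev d (Suc n) A a (K(n := k)) (J(n := i))) =
        ev d (Suc n) A b (I(n := j)) (K(n := i)) * ev d n A a K J" for K
    proof -
      have "(\<Sum>k<d. ev d (Suc n) A b (I(n := j)) (K(n := k)) * ev d (Suc n) A a (K(n := k)) (J(n := i))) =
        (\<Sum>k<d. if k = i then ev d (Suc n) A b (I(n := j)) (K(n := i)) * ev d n A a K J else 0)"
        by (rule sum.cong) (simp_all add: ev_Suc[OF a that(1)])
      then show ?thesis using that by simp
    qed
    then show ?thesis
      using that by (simp add: ev_mult[OF A b TX_mono[OF _ a]] multi_indices_extend I J sum_multi_indices_Suc)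
  qed
  then have "cut_eval d n A C (b * a) I J = (\<Sum>i<d. \<Sum>j<d. \<Sum>K\<in>multi_indices d n.
      C $$ (i, j) * ev d (Suc n) A b (I(n := j)) (K(n := i)) * ev d n A a K J)"
    unfolding cut_eval_def by (intro sum.cong refl) (simp add: sum_distrib_left mult.assoc)
  also have "\<dots> = (\<Sum>K\<in>multi_indices d n. \<Sum>i<d. \<Sum>j<d.
      C $$ (i, j) * ev d (Suc n) A b (I(n := j)) (K(n := i)) * ev d n A a K J)"
    by (subst sum.swap[of _ "{..<d}" "multi_indices d n"]) (intro sum.cong refl sum.swap)
  finally show ?thesis by (simp add: cut_eval_def sum_distrib_right)
qed

lemma cut_eval_left:
  assumes A: "assignment d A" and b: "b \<in> TX (Suc n)" and a: "a \<in> TX n"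
    and I: "I \<in> multi_indices d n" and J: "J \<in> multi_indices d n"
  shows "cut_eval d n A C (a * b) I J = (\<Sum>K\<in>multi_indices d n. ev d n A a I K * cut_eval d n A C b K J)"
proof -
  have "ev d (Suc n) A (a * b) (I(n := j)) (J(n := i)) =
      (\<Sum>K\<in>multi_indices d n. ev d n A a I K * ev d (Suc n) A b (K(n := j)) (J(n := i)))" if "i < d" "j < d" for i j
  proof -
    have "(\<Sum>k<d. ev d (Suc n) A a (I(n := j)) (K(n := k)) * ev d (Suc n) A b (K(n := k)) (J(n := i))) =
        ev d n A a I K * ev d (Suc n) A b (K(n := j)) (J(n := i))" for K
    proof -
      have "(\<Sum>k<d. ev d (Suc n) A a (I(n := j)) (K(n := k)) * ev d (Suc n) A b (K(n := k)) (J(n := i))) =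
        (\<Sum>k<d. if j = k then ev d n A a I K * ev d (Suc n) A b (K(n := j)) (J(n := i)) else 0)"
        by (rule sum.cong) (simp_all add: ev_Suc[OF a _ that(2)])
      then show ?thesis using that by simp
    qed
    then show ?thesis
      using that by (simp add: ev_mult[OF A TX_mono[OF _ a] b] multi_indices_extend I J sum_multi_indices_Suc)
  qed
  then have "cut_eval d n A C (a * b) I J = (\<Sum>i<d. \<Sum>j<d. \<Sum>K\<in>multi_indices d n.
      ev d n A a I K * (C $$ (i, j) * ev d (Suc n) A b (K(n := j)) (J(n := i))))"
    unfolding cut_eval_def by (intro sum.cong refl) (simp add: sum_distrib_left mult_ac)
  also have "\<dots> = (\<Sum>K\<in>multi_indices d n. \<Sum>i<d. \<Sum>j<d.
      ev d n A a I K * (C $$ (i, j) * ev d (Suc n) A b (K(n := j)) (J(n := i))))"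
    by (subst sum.swap[of _ "{..<d}" "multi_indices d n"]) (intro sum.cong refl sum.swap)
  finally show ?thesis by (simp add: cut_eval_def sum_distrib_left)
qed

text \<open>
  \<open>b \<in> \<T>(X,n+1)\<close> is \<open>a\<close> cut open at the occurrences of \<open>x\<^sub>y\<close>: closing \<open>b\<close> with \<open>x\<^sub>y\<close> counts these
  occurrences, and closing it with \<open>C\<close> is the derivative of \<open>a\<close> in the direction \<open>C\<close> of the variable \<open>x\<^sub>y\<close>.
\<close>

definition directional_cut :: "nat \<Rightarrow> nat \<Rightarrow> nat \<Rightarrow> twisted_element \<Rightarrow> twisted_element \<Rightarrow> bool" where
  "directional_cut d n y a b \<longleftrightarrow> (\<forall>A C I J. assignment d A \<longrightarrow> C \<in> carrier_mat d d \<longrightarrow>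
     I \<in> multi_indices d n \<longrightarrow> J \<in> multi_indices d n \<longrightarrow>
     has_deriv (\<lambda>s. ev d n (perturb A y C s) a I J) (cut_eval d n A C b I J))"

text \<open>The version for products of letters, traces and permutations, where the number
  \<open>e\<close> of occurrences of the variable is defined. A cut loses one letter, so
  \<open>b\<close> has degree below \<open>D\<close> while \<open>a\<close> has degree at most
  \<open>D\<close>; for \<open>D = 0\<close> it has to be 0.\<close>

definition is_cut :: "nat \<Rightarrow> nat \<Rightarrow> nat \<Rightarrow> nat \<Rightarrow> nat \<Rightarrow> twisted_element \<Rightarrow> twisted_element \<Rightarrow> bool" where
  "is_cut d n y e D a b \<longleftrightarrow> a \<in> degree_less n (Suc D) \<and> b \<in> degree_less (Suc n) D \<and>
     partial_trace n (pos_elem n (Mon [y]) * b) = of_nat e * a \<and> directional_cut d n y a b"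

lemma directional_cut_add:
  "directional_cut d n y a b \<Longrightarrow> directional_cut d n y a' b' \<Longrightarrow> directional_cut d n y (a + a') (b + b')"
  by (simp add: directional_cut_def ev_add cut_eval_add has_deriv_add)

lemma directional_cut_mult:
  assumes "directional_cut d n y a b" "directional_cut d n y a' b'"
    and TX: "a \<in> TX n" "b \<in> TX (Suc n)" "a' \<in> TX n" "b' \<in> TX (Suc n)"
  shows "directional_cut d n y (a * a') (b * a' + a * b')"
  unfolding directional_cut_def
proof (intro allI impI)
  fix A I J and C :: "rat mat"
  assume A: "assignment d A" and C: "C \<in> carrier_mat d d" and I: "I \<in> multi_indices d n" and J: "J \<in> multi_indices d n"
  have "has_deriv (\<lambda>s. \<Sum>K\<in>multi_indices d n. ev d n (perturb A y C s) a I K * ev d n (perturb A y C s) a' K J)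
      (\<Sum>K\<in>multi_indices d n. ev d n (perturb A y C 0) a I K * cut_eval d n A C b' K J +
        cut_eval d n A C b I K * ev d n (perturb A y C 0) a' K J)"
    using assms(1,2) A C I J by (intro has_deriv_sum has_deriv_mult) (auto simp: directional_cut_def)
  then show "has_deriv (\<lambda>s. ev d n (perturb A y C s) (a * a') I J) (cut_eval d n A C (b * a' + a * b') I J)"
    by (simp add: ev_mult[OF perturb_assignment[OF A C] TX(1,3) I J] perturb_0[OF A C] cut_eval_add
        cut_eval_left[OF A TX(4,1) I J] cut_eval_right[OF A TX(2,3) I J] sum.distrib add.commute)
qed

text \<open>Leibniz rule: a product is cut in one of its factors. The uncut factor is idle on the
  new strand and leaves the partial trace, so the numbers of occurrences add up.\<close>

lemma is_cut_mult:
  assumes "is_cut d n y e D a b" "is_cut d n y e' D' a' b'"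
  shows "is_cut d n y (e + e') (D + D') (a * a') (b * a' + a * b')"
proof -
  let ?Y = "pos_elem n (Mon [y])"
  have deg: "a \<in> degree_less n (Suc D)" "b \<in> degree_less (Suc n) D" "a' \<in> degree_less n (Suc D')" "b' \<in> degree_less (Suc n) D'"
    and tr: "partial_trace n (?Y * b) = of_nat e * a" "partial_trace n (?Y * b') = of_nat e' * a'"
    using assms by (auto simp: is_cut_def)
  note TX = deg[THEN degree_less_TX]
  have free: "a \<in> free_at n" "a' \<in> free_at n" using TX(1,3) by (auto simp: TX_iff_free_at)
  have "?Y * (b * a' + a * b') = ?Y * b * a' + a * (?Y * b')"
    using pos_elem_commute_free_at[OF free(1), of "Mon [y]"] by (simp add: distrib_left flip: mult.assoc)
  then have "partial_trace n (?Y * (b * a' + a * b')) = of_nat e * a * a' + a * (of_nat e' * a')"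
    by (simp only: partial_trace_add partial_trace_right[OF free(2)] partial_trace_left[OF free(1)] tr)
  also have "\<dots> = of_nat (e + e') * (a * a')"
    by (simp add: distrib_right mult.assoc) (metis mult.assoc mult_of_nat_commute)
  finally have "partial_trace n (?Y * (b * a' + a * b')) = of_nat (e + e') * (a * a')" .
  moreover have "a * a' \<in> degree_less n (Suc (D + D'))"
    using degree_less_mult[OF deg(1,3)] by simp
  moreover have "b * a' + a * b' \<in> degree_less (Suc n) (D + D')"
    using degree_less_mult[OF deg(2) degree_less_Suc[OF deg(3)]] degree_less_mult[OF degree_less_Suc[OF deg(1)] deg(4)]
    by (intro degree_less_add) simp_all
  ultimately show ?thesis
    using directional_cut_mult[OF _ _ TX(1,2,3,4)] assms by (simp add: is_cut_def)
qed

lemma is_cut_rat: "is_cut d n y 0 0 (rat_elem q) 0"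
proof -
  have "ev d n A (rat_elem q) I J = q * (\<Prod>i<n. 1\<^sub>m d $$ (I i, J i))" for A I J
    using ev_coeff_mult[of d n A "const_tr q" 1 I J] by (simp add: ev_one)
  moreover have "rat_elem q \<in> degree_less n (Suc 0)"
    unfolding coeff_elem_def const_tr_def
    using tensor_monomials_zero[of n]
    by (intro degree_less_single) (simp_all add: tensor_degree_def trace_degree_def, simp add: zero_tensor_monomial_def)
  ultimately show ?thesis
    by (simp add: is_cut_def directional_cut_def has_deriv_const)
qed

lemma perm_degree: "\<sigma> \<in> sym_group n \<Longrightarrow> perm_elem \<sigma> \<in> degree_less n (Suc 0)"
  unfolding perm_elem_def single_one[symmetric]
  by (rule degree_less_single) (simp_all add: tensor_monomials_def tensor_degree_def trace_degree_def)

lemma is_cut_perm: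
  assumes "\<sigma> \<in> sym_group n"
  shows "is_cut d n y 0 0 (perm_elem \<sigma>) 0"
proof -
  have "ev d n A (1 * perm_elem \<sigma>) I J = (\<Prod>i<n. 1\<^sub>m d $$ (I i, J (inverse \<sigma> \<langle>$\<rangle> i)))" for A I J
    unfolding ev_mult_perm by (rule ev_one)
  then show ?thesis
    using perm_degree[OF assms] by (simp add: is_cut_def directional_cut_def has_deriv_const)
qed

lemma pos_degree:
  assumes "p < n" shows "pos_elem p M \<in> degree_less n (Suc (length (letters M)))"
proof -
  have "pos_monomial p M \<in> tensor_monomials n"
    using assms by (auto simp: pos_monomial_def tensor_monomials_def sym_group_one)
  moreover have "tensor_degree n (pos_monomial p M) = (\<Sum>i<n. if i = p then length (letters M) else 0)"
    unfolding tensor_degree_def by (rule sum.cong) (auto simp: pos_monomial_def)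
  ultimately show ?thesis
    unfolding pos_elem_def single_one[symmetric] using assms
    by (intro degree_less_single) (simp_all add: trace_degree_def)
qed

lemma ev_pos_elem: "ev d n A (pos_elem p M) I J = (\<Prod>i<n. eval_monomial d A (if i = p then M else 0) $$ (I i, J i))"
proof -
  have "inverse (1 :: nat perm) \<langle>$\<rangle> i = i" for i by (simp add: apply_inverse_eq_iff)
  then show ?thesis by (simp add: pos_elem_def ev_single ev_mon_def pos_monomial_def)
qed

lemma eval_monomial_letter: "assignment d A \<Longrightarrow> eval_monomial d A (Mon [x]) = A x"
  using right_mult_one_mat[of "A x" d d] by (simp add: eval_monomial_def assignment_def)

text \<open>Cutting the single letter at position \<open>p\<close> leaves the transposition of
  \<open>p\<close> with the new strand: whatever is inserted there when closing ends up at position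
  \<open>p\<close>.\<close>

lemma is_cut_letter:
  assumes p: "p < n"
  shows "\<exists>b. is_cut d n y (count_list [x] y) 1 (pos_elem p (Mon [x])) b"
proof (cases "x = y")
  case False
  have "ev d n (perturb A y C s) (pos_elem p (Mon [x])) I J = ev d n A (pos_elem p (Mon [x])) I J"
    if "assignment d A" "C \<in> carrier_mat d d" for A C I J s
    using False that
    by (auto simp: ev_pos_elem eval_monomial_letter perturb_assignment perturb_def intro!: prod.cong)
      (simp add: eval_monomial_letter perturb_assignment[unfolded perturb_def])
  then show ?thesis
    using False pos_degree[OF p, of "Mon [x]"]
    by (intro exI[of _ 0]) (simp add: is_cut_def directional_cut_def has_deriv_const)
next
  case True
  have "directional_cut d n y (pos_elem p (Mon [y])) (perm_elem \<langle>p \<leftrightarrow> n\<rangle>)"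
    unfolding directional_cut_def
  proof (intro allI impI)
    fix A I J and C :: "rat mat"
    assume A: "assignment d A" and C: "C \<in> carrier_mat d d" and I: "I \<in> multi_indices d n" and J: "J \<in> multi_indices d n"
    let ?P = "\<Prod>i\<in>{..<n} - {p}. 1\<^sub>m d $$ (I i, J i) :: rat"
    have IJ: "I p < d" "J p < d" using multi_indices_less[OF I p] multi_indices_less[OF J p] .
    have AC: "A y \<in> carrier_mat d d" using A by (simp add: assignment_def)
    have "ev d n (perturb A y C s) (pos_elem p (Mon [y])) I J = ?P * A y $$ (I p, J p) + s * (?P * C $$ (I p, J p))" for s
    proof -
      have "(\<Prod>i\<in>{..<n} - {p}. eval_monomial d (perturb A y C s) (if i = p then Mon [y] else 0) $$ (I i, J i)) = ?P"
        by (rule prod.cong) auto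
      then show ?thesis
        using p IJ AC C
        by (simp add: ev_pos_elem prod.remove[of "{..<n}" p] eval_monomial_letter[OF perturb_assignment[OF A C]])
          (simp add: perturb_def distrib_left distrib_right mult_ac)
    qed
    moreover have "cut_eval d n A C (perm_elem \<langle>p \<leftrightarrow> n\<rangle>) I J = ?P * C $$ (I p, J p)"
    proof -
      have "ev d (Suc n) A (perm_elem \<langle>p \<leftrightarrow> n\<rangle>) (I(n := j)) (J(n := i)) = ?P * (if I p = i \<and> j = J p then 1 else 0)"
        if "i < d" "j < d" for i j
      proof -
        have "ev d (Suc n) A (1 * perm_elem \<langle>p \<leftrightarrow> n\<rangle>) (I(n := j)) (J(n := i)) =
            (\<Prod>k<Suc n. 1\<^sub>m d $$ ((I(n := j)) k, (J(n := i)) (\<langle>p \<leftrightarrow> n\<rangle> \<langle>$\<rangle> k)))"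
          unfolding ev_mult_perm ev_one by simp
        also have "\<dots> = (\<Prod>k\<in>{..<n} - {p}. 1\<^sub>m d $$ ((I(n := j)) k, (J(n := i)) (\<langle>p \<leftrightarrow> n\<rangle> \<langle>$\<rangle> k)))
            * 1\<^sub>m d $$ (I p, i) * 1\<^sub>m d $$ (j, J p)"
          using p by (simp add: prod.remove[of "{..<n}" p])
        also have "(\<Prod>k\<in>{..<n} - {p}. 1\<^sub>m d $$ ((I(n := j)) k, (J(n := i)) (\<langle>p \<leftrightarrow> n\<rangle> \<langle>$\<rangle> k))) = ?P"
          by (rule prod.cong) auto
        finally have e: "ev d (Suc n) A (perm_elem \<langle>p \<leftrightarrow> n\<rangle>) (I(n := j)) (J(n := i)) =
            ?P * 1\<^sub>m d $$ (I p, i) * 1\<^sub>m d $$ (j, J p)" by (simp only: mult_1_left)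
        show ?thesis unfolding e using that IJ by simp
      qed
      then have "cut_eval d n A C (perm_elem \<langle>p \<leftrightarrow> n\<rangle>) I J =
          (\<Sum>i<d. \<Sum>j<d. if I p = i then if j = J p then ?P * C $$ (i, j) else 0 else 0)"
        unfolding cut_eval_def by (intro sum.cong refl) simp
      also have "\<dots> = (\<Sum>i<d. if I p = i then ?P * C $$ (i, J p) else 0)"
        using IJ by (intro sum.cong refl) simp
      also have "\<dots> = ?P * C $$ (I p, J p)" using IJ by simp
      finally show ?thesis .
    qed
    ultimately show "has_deriv (\<lambda>s. ev d n (perturb A y C s) (pos_elem p (Mon [y])) I J) (cut_eval d n A C (perm_elem \<langle>p \<leftrightarrow> n\<rangle>) I J)"
      by (simp add: has_deriv_linear)
  qed
  moreover have "partial_trace n (pos_elem n (Mon [y]) * perm_elem \<langle>p \<leftrightarrow> n\<rangle>) = pos_elem p (Mon [y])"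
    using p by (intro partial_trace_pos_swap) simp
  ultimately show ?thesis
    using True p pos_degree[OF p, of "Mon [y]"] perm_degree[OF swap_sym_group, of p "Suc n" n]
    by (intro exI[of _ "perm_elem \<langle>p \<leftrightarrow> n\<rangle>"]) (simp add: is_cut_def)
qed

section \<open>Cutting words and traces\<close>

fun word_cuts :: "nat \<Rightarrow> nat list \<Rightarrow> (nat list \<times> nat list) list" where
  "word_cuts y [] = []"
| "word_cuts y (x # w) = (if x = y then [([], w)] else []) @ map (\<lambda>(u, v). (x # u, v)) (word_cuts y w)"

lemma word_cuts_split: "(u, v) \<in> set (word_cuts y w) \<Longrightarrow> w = u @ y # v"
  by (induction w arbitrary: u v) (auto split: if_splits)

lemma length_word_cuts: "length (word_cuts y w) = count_list w y"
  by (induction w) auto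

lemma eval_Cons: "assignment d A \<Longrightarrow> i < d \<Longrightarrow> j < d \<Longrightarrow>
    eval_monomial d A (Mon (x # w)) $$ (i, j) = (\<Sum>k<d. A x $$ (i, k) * eval_monomial d A (Mon w) $$ (k, j))"
  using eval_monomial_plus_entry[of d A i j "Mon [x]" "Mon w"]
  by (simp add: plus_monomial_def eval_monomial_letter)

lemma sum_mult_sum_list:
  "(\<Sum>k\<in>S. f k * sum_list (map (g k) cs)) = sum_list (map (\<lambda>c. \<Sum>k\<in>S. f k * g k c :: 'a::semiring_0) cs)"
  by (induction cs) (simp_all add: distrib_left sum.distrib)

text \<open>Product rule along the word: every factorization w = u y v contributes the product of
  the values of u and v with \<open>C\<close> in between.\<close>

lemma has_deriv_word:
  assumes A: "assignment d A" and C: "C \<in> carrier_mat d d"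
  shows "i < d \<Longrightarrow> j < d \<Longrightarrow> has_deriv (\<lambda>s. eval_monomial d (perturb A y C s) (Mon w) $$ (i, j))
    (\<Sum>(u, v)\<leftarrow>word_cuts y w. \<Sum>p<d. \<Sum>q<d.
      eval_monomial d A (Mon u) $$ (i, p) * (C $$ (p, q) * eval_monomial d A (Mon v) $$ (q, j)))"
proof (induction w arbitrary: i)
  case Nil
  have "Mon [] = 0" by (simp add: zero_monomial_def)
  then show ?case by (simp add: has_deriv_const)
next
  case (Cons x w)
  let ?E = "\<lambda>u. eval_monomial d A (Mon u)"
  let ?L = "\<lambda>i. \<Sum>(u, v)\<leftarrow>word_cuts y w. \<Sum>p<d. \<Sum>q<d. ?E u $$ (i, p) * (C $$ (p, q) * ?E v $$ (q, j))"
  have letter: "has_deriv (\<lambda>s. perturb A y C s x $$ (i, k)) (if x = y then C $$ (i, k) else 0)" if "k < d" for k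
  proof (cases "x = y")
    case True
    have "A y \<in> carrier_mat d d" using A by (simp add: assignment_def)
    then have "perturb A y C s x $$ (i, k) = A y $$ (i, k) + s * C $$ (i, k)" for s
      using True C that Cons.prems by (simp add: perturb_def)
    then show ?thesis using True by (simp add: has_deriv_linear)
  qed (simp add: perturb_def has_deriv_const)
  have "has_deriv (\<lambda>s. \<Sum>k<d. perturb A y C s x $$ (i, k) * eval_monomial d (perturb A y C s) (Mon w) $$ (k, j))
      (\<Sum>k<d. perturb A y C 0 x $$ (i, k) * ?L k +
        (if x = y then C $$ (i, k) else 0) * eval_monomial d (perturb A y C 0) (Mon w) $$ (k, j))"
    using Cons letter by (intro has_deriv_sum has_deriv_mult) auto
  moreover have "(\<Sum>k<d. A x $$ (i, k) * ?L k) = (\<Sum>(u, v)\<leftarrow>word_cuts y w. \<Sum>p<d. \<Sum>q<d.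
      ?E (x # u) $$ (i, p) * (C $$ (p, q) * ?E v $$ (q, j)))"
  proof -
    have "(\<Sum>k<d. A x $$ (i, k) * (\<Sum>p<d. \<Sum>q<d. ?E u $$ (k, p) * (C $$ (p, q) * ?E v $$ (q, j)))) =
        (\<Sum>p<d. \<Sum>q<d. ?E (x # u) $$ (i, p) * (C $$ (p, q) * ?E v $$ (q, j)))" for u v
    proof -
      have "(\<Sum>k<d. A x $$ (i, k) * (\<Sum>p<d. \<Sum>q<d. ?E u $$ (k, p) * (C $$ (p, q) * ?E v $$ (q, j)))) =
          (\<Sum>p<d. \<Sum>k<d. \<Sum>q<d. A x $$ (i, k) * ?E u $$ (k, p) * (C $$ (p, q) * ?E v $$ (q, j)))"
        by (subst sum.swap) (simp add: sum_distrib_left mult.assoc)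
      also have "\<dots> = (\<Sum>p<d. \<Sum>q<d. \<Sum>k<d. A x $$ (i, k) * ?E u $$ (k, p) * (C $$ (p, q) * ?E v $$ (q, j)))"
        by (intro sum.cong refl sum.swap)
      also have "\<dots> = (\<Sum>p<d. \<Sum>q<d. ?E (x # u) $$ (i, p) * (C $$ (p, q) * ?E v $$ (q, j)))"
        using Cons.prems by (intro sum.cong refl) (simp add: eval_Cons[OF A] sum_distrib_right)
      finally show ?thesis .
    qed
    then show ?thesis unfolding sum_mult_sum_list by (simp add: case_prod_unfold)
  qed
  moreover have "(\<Sum>p<d. \<Sum>q<d. 1\<^sub>m d $$ (i, p) * (C $$ (p, q) * ?E w $$ (q, j))) = (\<Sum>q<d. C $$ (i, q) * ?E w $$ (q, j))"
  proof -
    have "(\<Sum>p<d. \<Sum>q<d. 1\<^sub>m d $$ (i, p) * (C $$ (p, q) * ?E w $$ (q, j))) =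
        (\<Sum>p<d. if i = p then \<Sum>q<d. C $$ (p, q) * ?E w $$ (q, j) else 0)"
      using Cons.prems by (intro sum.cong refl) auto
    then show ?thesis using Cons.prems by simp
  qed
  moreover have "Mon [] = 0" by (simp add: zero_monomial_def)
  ultimately show ?case
    by (cases "x = y") (simp_all add: eval_Cons[OF perturb_assignment[OF A C]] Cons.prems perturb_0[OF A C]
        sum.distrib o_def case_prod_unfold add.commute)
qed


lemma sum_list_props:
  "(\<And>c. c \<in> set cs \<Longrightarrow> f c \<in> degree_less n D) \<Longrightarrow> sum_list (map f cs) \<in> degree_less n D"
  "partial_trace p (a * sum_list (map f cs)) = sum_list (map (\<lambda>c. partial_trace p (a * f c)) cs)"
  "cut_eval d n A C (sum_list (map f cs)) I J = sum_list (map (\<lambda>c. cut_eval d n A C (f c) I J) cs)"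
  by (induction cs) (simp_all add: degree_less_add distrib_left partial_trace_add cut_eval_add)

text \<open>A factorization u y v opens the trace to the monomial v u on the new strand, because
  tr(u C v) = tr(C v u). Closing each of these with the letter returns the same cyclic word.\<close>

lemma is_cut_trace:
  "\<exists>b. is_cut d n y (count_list (letters M) y) (length (letters M)) (coeff_elem (tr_monomial M)) b"
proof -
  define w where "w = letters M"
  have M: "M = Mon w" by (simp add: w_def)
  define f where "f c = pos_elem n (Mon (snd c @ fst c))" for c :: "nat list \<times> nat list"
  define b where "b = sum_list (map f (word_cuts y w))"
  have split: "w = fst c @ y # snd c" if "c \<in> set (word_cuts y w)" for c
    using that word_cuts_split[of "fst c" "snd c"] by simp
  have "b \<in> degree_less (Suc n) (length w)"
    unfolding b_def
  proof (rule sum_list_props)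
    fix c assume "c \<in> set (word_cuts y w)"
    from arg_cong[OF split[OF this], of length]
    show "f c \<in> degree_less (Suc n) (length w)"
      using pos_degree[of n "Suc n" "Mon (snd c @ fst c)"] by (simp add: f_def add.commute)
  qed
  moreover have "coeff_elem (tr_monomial M) \<in> degree_less n (Suc (length w))"
    unfolding coeff_elem_def tr_monomial_def
    using tensor_monomials_zero[of n]
    by (intro degree_less_single) (simp_all add: tensor_degree_def trace_degree_def cyc_length_abs M,
        simp add: zero_tensor_monomial_def)
  moreover have "partial_trace n (pos_elem n (Mon [y]) * b) = of_nat (count_list w y) * coeff_elem (tr_monomial M)"
  proof -
    have "partial_trace n (pos_elem n (Mon [y]) * f c) = coeff_elem (tr_monomial M)" if c: "c \<in> set (word_cuts y w)" for c
    proof -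
      have "Mon [y] + Mon (snd c @ fst c) = Mon (y # snd c) + Mon (fst c)" "M = Mon (fst c) + Mon (y # snd c)"
        using split[OF c] by (simp_all add: plus_monomial_def M)
      then show ?thesis
        by (simp add: f_def partial_trace_pos_elem tr_monomial_commute[of "Mon (y # snd c)"] flip: pos_elem_plus)
    qed
    then have "map (\<lambda>c. partial_trace n (pos_elem n (Mon [y]) * f c)) (word_cuts y w) =
        map (\<lambda>_. coeff_elem (tr_monomial M)) (word_cuts y w)" by simp
    then show ?thesis
      unfolding b_def sum_list_props(2) by (simp only: sum_list_triv length_word_cuts)
  qed
  moreover have "directional_cut d n y (coeff_elem (tr_monomial M)) b"
    unfolding directional_cut_def
  proof (intro allI impI)
    fix A I J and C :: "rat mat"
    assume A: "assignment d A" and C: "C \<in> carrier_mat d d" and I: "I \<in> multi_indices d n" and J: "J \<in> multi_indices d n"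
    let ?P = "\<Prod>i<n. 1\<^sub>m d $$ (I i, J i) :: rat"
    let ?E = "\<lambda>u. eval_monomial d A (Mon u)"
    let ?L = "\<lambda>i j. \<Sum>(u, v)\<leftarrow>word_cuts y w. \<Sum>p<d. \<Sum>q<d. ?E u $$ (i, p) * (C $$ (p, q) * ?E v $$ (q, j))"
    have ev: "ev d n A' (coeff_elem (tr_monomial M)) I J = ?P * (\<Sum>i<d. eval_monomial d A' M $$ (i, i))" if "assignment d A'" for A'
      using ev_coeff_mult[of d n A' "tr_monomial M" 1 I J] that
      by (simp add: ev_one eval_tr_monomial mat_trace_carrier[OF assignment_eval_carrier] mult.commute)
    have "has_deriv (\<lambda>s. ?P * (\<Sum>i<d. eval_monomial d (perturb A y C s) M $$ (i, i)))
        (?P * (\<Sum>i<d. ?L i i) + 0 * (\<Sum>i<d. eval_monomial d (perturb A y C 0) M $$ (i, i)))"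
      unfolding M by (intro has_deriv_mult has_deriv_const has_deriv_sum has_deriv_word[OF A C]) auto
    moreover have "cut_eval d n A C b I J = ?P * (\<Sum>i<d. ?L i i)"
    proof -
      have cut: "cut_eval d n A C (f c) I J = ?P * (\<Sum>i<d. \<Sum>p<d. \<Sum>q<d.
          ?E (fst c) $$ (i, p) * (C $$ (p, q) * ?E (snd c) $$ (q, i)))" for c
      proof -
        have "ev d (Suc n) A (f c) (I(n := j)) (J(n := i)) = ?P * ?E (snd c @ fst c) $$ (j, i)" for i j
        proof -
          have "(\<Prod>k<n. eval_monomial d A (if k = n then Mon (snd c @ fst c) else 0) $$ ((I(n := j)) k, (J(n := i)) k)) = ?P"
            by (rule prod.cong) auto
          then show ?thesis by (simp add: f_def ev_pos_elem)
        qed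
        then have "cut_eval d n A C (f c) I J = (\<Sum>p<d. \<Sum>q<d. C $$ (p, q) * (?P * ?E (snd c @ fst c) $$ (q, p)))"
          by (simp add: cut_eval_def)
        also have "\<dots> = (\<Sum>p<d. \<Sum>q<d. \<Sum>i<d. ?P * (?E (fst c) $$ (i, p) * (C $$ (p, q) * ?E (snd c) $$ (q, i))))"
        proof (intro sum.cong refl)
          fix p q assume "p \<in> {..<d}" "q \<in> {..<d}"
          then have "?E (snd c @ fst c) $$ (q, p) = (\<Sum>i<d. ?E (snd c) $$ (q, i) * ?E (fst c) $$ (i, p))"
            using eval_monomial_plus_entry[OF A, of q p "Mon (snd c)" "Mon (fst c)"] by (simp add: plus_monomial_def)
          then show "C $$ (p, q) * (?P * ?E (snd c @ fst c) $$ (q, p)) =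
              (\<Sum>i<d. ?P * (?E (fst c) $$ (i, p) * (C $$ (p, q) * ?E (snd c) $$ (q, i))))"
            by (simp add: sum_distrib_left mult_ac)
        qed
        also have "\<dots> = (\<Sum>p<d. \<Sum>i<d. \<Sum>q<d. ?P * (?E (fst c) $$ (i, p) * (C $$ (p, q) * ?E (snd c) $$ (q, i))))"
          by (intro sum.cong refl sum.swap)
        also have "\<dots> = (\<Sum>i<d. \<Sum>p<d. \<Sum>q<d. ?P * (?E (fst c) $$ (i, p) * (C $$ (p, q) * ?E (snd c) $$ (q, i))))"
          by (rule sum.swap)
        finally show ?thesis by (simp only: sum_distrib_left)
      qed
      \<comment> \<open>The factor 1 only brings the sum into the form to which
        \<open>sum_mult_sum_list\<close> applies.\<close>
      have "(\<Sum>i<d. 1 * ?L i i) = (\<Sum>(u, v)\<leftarrow>word_cuts y w. \<Sum>i<d. 1 * (\<Sum>p<d. \<Sum>q<d. ?E u $$ (i, p) * (C $$ (p, q) * ?E v $$ (q, i))))"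
        unfolding sum_mult_sum_list by (simp add: case_prod_unfold)
      then have "?P * (\<Sum>i<d. ?L i i) = (\<Sum>c\<leftarrow>word_cuts y w. ?P * (\<Sum>i<d. \<Sum>p<d. \<Sum>q<d.
          ?E (fst c) $$ (i, p) * (C $$ (p, q) * ?E (snd c) $$ (q, i))))"
        by (simp only: mult_1_left case_prod_unfold sum_list_const_mult)
      then show ?thesis unfolding b_def sum_list_props(3) cut ..
    qed
    ultimately show "has_deriv (\<lambda>s. ev d n (perturb A y C s) (coeff_elem (tr_monomial M)) I J) (cut_eval d n A C b I J)"
      by (simp add: ev[OF perturb_assignment[OF A C]])
  qed
  ultimately show ?thesis
    unfolding is_cut_def by (intro exI[of _ b]) (simp add: M)
qed

section \<open>Occurrences of a variable and the total degree\<close>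

definition tensor_count :: "nat \<Rightarrow> nat \<Rightarrow> tensor_monomial \<Rightarrow> nat" where
  "tensor_count y n t = (\<Sum>i<n. count_list (letters (factors t i)) y)"

definition trace_count :: "nat \<Rightarrow> cyc_monomial multiset \<Rightarrow> nat" where
  "trace_count y m = (\<Sum>c\<in>#m. count_list (letters (rep_cyc_monomial c)) y)"

text \<open>Letters are split off one at a time from the front of a nonempty factor, so that the
  Leibniz rule reduces the claim to single letters and permutations.\<close>

lemma is_cut_tensor:
  "t \<in> tensor_monomials n \<Longrightarrow>
   \<exists>b. is_cut d n y (tensor_count y n t) (tensor_degree n t) (Poly_Mapping.single t 1) b"
proof (induction "tensor_degree n t" arbitrary: t)
  case 0
  have t: "t = TMon (\<lambda>_. 0) (permutation t)" using 0 by (intro tensor_degree_0) simp_all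
  then have "Poly_Mapping.single t 1 = perm_elem (permutation t)" by (simp add: perm_elem_def)
  moreover have "tensor_count y n t = 0" by (subst t) (simp add: tensor_count_def)
  ultimately show ?case
    using is_cut_perm[of "permutation t" n d y] 0 by (auto simp: tensor_monomials_def)
next
  case (Suc D)
  have "\<exists>p<n. letters (factors t p) \<noteq> []"
  proof (rule ccontr)
    assume "\<not> (\<exists>p<n. letters (factors t p) \<noteq> [])"
    then have "tensor_degree n t = 0" by (simp add: tensor_degree_def)
    then show False using Suc(2) by simp
  qed
  then obtain p x w where p: "p < n" "letters (factors t p) = x # w" by (meson neq_Nil_conv)
  define t' where "t' = TMon ((factors t)(p := Mon w)) (permutation t)"
  have t': "t' \<in> tensor_monomials n" using Suc.prems p(1) by (auto simp: t'_def tensor_monomials_def)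
  have fp: "factors t p = Mon (x # w)" using p(2) by (metis monomial.collapse)
  have split: "(\<Sum>i<n. g (letters (factors t i))) = g (x # w) + (\<Sum>i\<in>{..<n} - {p}. g (letters (factors t i)))"
    "(\<Sum>i<n. g (letters (factors t' i))) = g w + (\<Sum>i\<in>{..<n} - {p}. g (letters (factors t i)))" for g :: "nat list \<Rightarrow> nat"
  proof -
    have "(\<Sum>i\<in>{..<n} - {p}. g (letters (factors t' i))) = (\<Sum>i\<in>{..<n} - {p}. g (letters (factors t i)))"
      by (rule sum.cong) (auto simp: t'_def)
    then show "(\<Sum>i<n. g (letters (factors t i))) = g (x # w) + (\<Sum>i\<in>{..<n} - {p}. g (letters (factors t i)))"
      "(\<Sum>i<n. g (letters (factors t' i))) = g w + (\<Sum>i\<in>{..<n} - {p}. g (letters (factors t i)))"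
      using p(1) by (simp_all add: sum.remove[of "{..<n}" p] p(2)) (simp add: t'_def)
  qed
  have deg: "tensor_degree n t = 1 + tensor_degree n t'"
    unfolding tensor_degree_def split by simp
  have count: "tensor_count y n t = count_list [x] y + tensor_count y n t'"
    unfolding tensor_count_def split[where g = "\<lambda>w. count_list w y"] by simp
  have "t = pos_monomial p (Mon [x]) + t'"
  proof (rule tensor_monomial_eqI)
    fix i
    have "inverse (1 :: nat perm) \<langle>$\<rangle> i = i" by (simp add: apply_inverse_eq_iff)
    then show "factors t i = factors (pos_monomial p (Mon [x]) + t') i"
      by (simp add: factors_plus pos_monomial_def t'_def fp plus_monomial_def)
    show "permutation t \<langle>$\<rangle> i = permutation (pos_monomial p (Mon [x]) + t') \<langle>$\<rangle> i"
      by (simp add: permutation_plus pos_monomial_def t'_def)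
  qed
  then have eq: "Poly_Mapping.single t 1 = pos_elem p (Mon [x]) * Poly_Mapping.single t' 1"
    by (simp add: pos_elem_def mult_single)
  obtain b where "is_cut d n y (tensor_count y n t') (tensor_degree n t') (Poly_Mapping.single t' 1) b"
    using Suc(1)[OF _ t'] Suc(2) deg by auto
  moreover obtain c where "is_cut d n y (count_list [x] y) 1 (pos_elem p (Mon [x])) c"
    using is_cut_letter[OF p(1)] by blast
  ultimately show ?case
    unfolding eq deg count using is_cut_mult by blast
qed

lemma is_cut_trace_monomial:
  "\<exists>b. is_cut d n y (trace_count y m) (trace_degree m) (coeff_elem (Poly_Mapping.single m 1)) b"
proof (induction m)
  case empty
  show ?case using is_cut_rat[of d n y 1] by (auto simp: trace_count_def trace_degree_def)
next
  case (add c m)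
  have "abs_cyc_monomial (rep_cyc_monomial c) = c"
    by (rule Quotient3_abs_rep[OF Quotient3_cyc_monomial])
  then have "coeff_elem (Poly_Mapping.single (add_mset c m) 1) =
      coeff_elem (tr_monomial (rep_cyc_monomial c)) * coeff_elem (Poly_Mapping.single m 1)"
    by (simp add: tr_monomial_def mult_single flip: coeff_elem_mult)
  then show ?case
    using add.IH is_cut_trace[of d n y "rep_cyc_monomial c"] is_cut_mult
    by (simp add: trace_count_def trace_degree_def) blast
qed

lemma is_cut_basis:
  assumes "t \<in> tensor_monomials n"
  shows "\<exists>b. is_cut d n y (tensor_count y n t + trace_count y m) (tensor_degree n t + trace_degree m)
    (Poly_Mapping.single t (Poly_Mapping.single m q)) b"
proof -
  have eq: "Poly_Mapping.single t (Poly_Mapping.single m q) =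
      rat_elem q * (Poly_Mapping.single t 1 * coeff_elem (Poly_Mapping.single m 1))"
    by (simp add: const_tr_def mult_single coeff_elem_mult_single flip: coeff_elem_commute)
  obtain b c where "is_cut d n y (tensor_count y n t) (tensor_degree n t) (Poly_Mapping.single t 1) b"
    "is_cut d n y (trace_count y m) (trace_degree m) (coeff_elem (Poly_Mapping.single m 1)) c"
    using is_cut_tensor[OF assms] is_cut_trace_monomial by blast
  from is_cut_mult[OF is_cut_rat[of d n y q] is_cut_mult[OF this]]
  show ?thesis unfolding eq by auto
qed

lemma sum_counts:
  assumes "\<And>i. i < n \<Longrightarrow> set (letters (factors t i)) \<subseteq> {..<L}"
    "\<And>c. c \<in># m \<Longrightarrow> set (letters (rep_cyc_monomial c)) \<subseteq> {..<L}"
  shows "(\<Sum>y<L. tensor_count y n t + trace_count y m) = tensor_degree n t + trace_degree m"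
proof -
  have "(\<Sum>y<L. tensor_count y n t) = (\<Sum>i<n. \<Sum>y<L. count_list (letters (factors t i)) y)"
    unfolding tensor_count_def by (rule sum.swap)
  also have "\<dots> = tensor_degree n t"
    unfolding tensor_degree_def using assms(1) by (intro sum.cong refl sum_count_set) auto
  finally have 1: "(\<Sum>y<L. tensor_count y n t) = tensor_degree n t" .
  have 2: "(\<Sum>y<L. trace_count y m) = trace_degree m"
    using assms(2)
  proof (induction m)
    case (add c m)
    then show ?case
      by (simp add: trace_count_def trace_degree_def sum.distrib sum_count_set)
  qed (simp add: trace_count_def trace_degree_def)
  show ?thesis by (simp add: sum.distrib 1 2)
qed

text \<open>Euler's formula for elements that need not be homogeneous: closing all cuts multiplies
  each term by its own degree, so \<open>of_nat D * a\<close> is recovered only up to terms of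
  degree below \<open>D\<close>. The number \<open>L\<close> of variables is asserted for all large
  values because the summands of \<open>a\<close> need a common one.\<close>

lemma cuts_exist:
  assumes "a \<in> degree_less n (Suc D)"
  shows "\<exists>L\<^sub>0. \<forall>L\<ge>L\<^sub>0. \<exists>b. (\<forall>y. b y \<in> degree_less (Suc n) D \<and> directional_cut d n y a (b y)) \<and>
    of_nat D * a - (\<Sum>y<L. partial_trace n (pos_elem n (Mon [y]) * b y)) \<in> degree_less n D"
  using assms
proof (induction rule: degree_less_induct)
  case zero
  show ?case by (intro exI[of _ 0] allI impI exI[of _ "\<lambda>_. 0"]) (simp add: directional_cut_def has_deriv_const)
next
  case (add t m q a)
  let ?x = "Poly_Mapping.single t (Poly_Mapping.single m q)"
  let ?deg = "tensor_degree n t + trace_degree m"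
  from add(3) obtain L1 where L1: "\<And>L. L \<ge> L1 \<Longrightarrow> \<exists>b. (\<forall>y. b y \<in> degree_less (Suc n) D \<and> directional_cut d n y a (b y)) \<and>
    of_nat D * a - (\<Sum>y<L. partial_trace n (pos_elem n (Mon [y]) * b y)) \<in> degree_less n D" by blast
  define S where "S = (\<Union>i<n. set (letters (factors t i))) \<union> (\<Union>c\<in>set_mset m. set (letters (rep_cyc_monomial c)))"
  have "finite S" by (simp add: S_def)
  then obtain L2 where L2: "S \<subseteq> {..<L2}" using finite_nat_iff_bounded by blast
  have "\<forall>y. \<exists>b. is_cut d n y (tensor_count y n t + trace_count y m) ?deg ?x b"
    using is_cut_basis[OF add(1)] by blast
  then obtain c where c: "\<And>y. is_cut d n y (tensor_count y n t + trace_count y m) ?deg ?x (c y)" by metis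
  show ?case
  proof (intro exI[of _ "max L1 L2"] allI impI)
    fix L assume L: "max L1 L2 \<le> L"
    then obtain b where b: "\<And>y. b y \<in> degree_less (Suc n) D" "\<And>y. directional_cut d n y a (b y)"
      "of_nat D * a - (\<Sum>y<L. partial_trace n (pos_elem n (Mon [y]) * b y)) \<in> degree_less n D"
      using L1[of L] by auto
    have "S \<subseteq> {..<L}" using L2 L by (meson lessThan_subset_iff max.boundedE subset_trans)
    then have "(\<Sum>y<L. tensor_count y n t + trace_count y m) = ?deg"
      by (intro sum_counts) (auto simp: S_def)
    moreover have "(\<Sum>y<L. partial_trace n (pos_elem n (Mon [y]) * c y)) =
        of_nat (\<Sum>y<L. tensor_count y n t + trace_count y m) * ?x"
      unfolding of_nat_sum sum_distrib_right using c by (intro sum.cong refl) (simp add: is_cut_def)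
    ultimately have closed: "(\<Sum>y<L. partial_trace n (pos_elem n (Mon [y]) * c y)) = of_nat ?deg * ?x" by simp
    \<comment> \<open>The difference vanishes for a term of top degree; for a lower term its degree
      is already below \<open>D\<close>.\<close>
    have "of_nat D * ?x - of_nat ?deg * ?x \<in> degree_less n D"
    proof (cases "?deg = D")
      case False
      then have "?deg < D" using add(2) by simp
      then have "of_nat (D - ?deg) * ?x \<in> degree_less n D"
        using add(1) by (intro degree_less_of_nat degree_less_single)
      then show ?thesis using \<open>?deg < D\<close> by (simp only: of_nat_diff less_imp_le left_diff_distrib)
    qed simp
    then have "(of_nat D * ?x - of_nat ?deg * ?x) +
        (of_nat D * a - (\<Sum>y<L. partial_trace n (pos_elem n (Mon [y]) * b y))) \<in> degree_less n D"
      using b(3) by (rule degree_less_add)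
    also have "(of_nat D * ?x - of_nat ?deg * ?x) + (of_nat D * a - (\<Sum>y<L. partial_trace n (pos_elem n (Mon [y]) * b y))) =
        of_nat D * (?x + a) - (\<Sum>y<L. partial_trace n (pos_elem n (Mon [y]) * (c y + b y)))"
      unfolding closed[symmetric] by (simp add: distrib_left partial_trace_add sum.distrib)
    finally have "of_nat D * (?x + a) - (\<Sum>y<L. partial_trace n (pos_elem n (Mon [y]) * (c y + b y))) \<in> degree_less n D" .
    moreover have "c y + b y \<in> degree_less (Suc n) D \<and> directional_cut d n y (?x + a) (c y + b y)" for y
    proof
      have "c y \<in> degree_less (Suc n) D"
        using c[of y] add(2) by (auto simp: is_cut_def intro: degree_less_mono)
      then show "c y + b y \<in> degree_less (Suc n) D" using b(1) by (rule degree_less_add)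
      show "directional_cut d n y (?x + a) (c y + b y)"
        using c[of y] b(2) by (intro directional_cut_add) (simp add: is_cut_def)
    qed
    ultimately show "\<exists>b. (\<forall>y. b y \<in> degree_less (Suc n) D \<and> directional_cut d n y (?x + a) (b y)) \<and>
        of_nat D * (?x + a) - (\<Sum>y<L. partial_trace n (pos_elem n (Mon [y]) * b y)) \<in> degree_less n D"
      by (intro exI[of _ "\<lambda>y. c y + b y"]) blast
  qed
qed

text \<open>An identity vanishes along every line in the direction \<open>C\<close>, hence so does
  its derivative, the closing of \<open>b\<close> with \<open>C\<close>. As \<open>C\<close> is
  arbitrary, every entry of \<open>b\<close> is zero.\<close>

lemma cut_identity:
  assumes a: "a \<in> tensor_identities d n" and b: "b \<in> TX (Suc n)" and cut: "directional_cut d n y a b"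
  shows "b \<in> tensor_identities d (Suc n)"
  unfolding tensor_identities_iff
proof (intro conjI allI impI b)
  fix A I J assume A: "assignment d A" and I: "I \<in> multi_indices d (Suc n)" and J: "J \<in> multi_indices d (Suc n)"
  define I' where "I' = I(n := undefined)"
  define J' where "J' = J(n := undefined)"
  have IJ: "I' \<in> multi_indices d n" "J' \<in> multi_indices d n" "I n < d" "J n < d"
    using I J by (auto simp: I'_def J'_def multi_indices_def PiE_def extensional_def less_Suc_eq)
  \<comment> \<open>The elementary matrix with its 1 at row \<open>J n\<close> and column
    \<open>I n\<close>: closing \<open>b\<close> with it reads off the entry whose last indices are
    \<open>I n\<close> and \<open>J n\<close>.\<close>
  define C where "C = mat d d (\<lambda>(i, j). if i = J n \<and> j = I n then 1 else 0 :: rat)"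
  have C: "C \<in> carrier_mat d d" by (simp add: C_def)
  have "has_deriv (\<lambda>s. ev d n (perturb A y C s) a I' J') (cut_eval d n A C b I' J')"
    using cut A C IJ by (simp add: directional_cut_def)
  then have zero: "cut_eval d n A C b I' J' = 0"
    using a IJ perturb_assignment[OF A C] by (intro has_deriv_zero) (simp add: tensor_identities_iff)
  have "cut_eval d n A C b I' J' = (\<Sum>i<d. \<Sum>j<d. if J n = i then if I n = j then
      ev d (Suc n) A b (I'(n := j)) (J'(n := i)) else 0 else 0)"
    unfolding cut_eval_def by (intro sum.cong refl) (auto simp: C_def)
  also have "\<dots> = (\<Sum>i<d. if J n = i then ev d (Suc n) A b (I'(n := I n)) (J'(n := i)) else 0)"
    using IJ by (intro sum.cong refl) simp
  also have "\<dots> = ev d (Suc n) A b I J" using IJ by (simp add: I'_def J'_def)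
  finally show "ev d (Suc n) A b I J = 0" using zero by simp
qed


section \<open>Completeness of the generating identities\<close>

lemma dim_elem_power:
  "z \<in> TX n \<Longrightarrow> coeff_elem (tr_monomial 0 ^ k) * z - rat_elem (of_nat d ^ k) * z \<in> core_ideal d n"
proof (induction k)
  case (Suc k)
  let ?t = "tr_monomial 0" and ?d = "const_tr (of_nat d)"
  have "coeff_elem (?t ^ Suc k) * z - rat_elem (of_nat d ^ Suc k) * z =
      coeff_elem (dim_elem d) * (coeff_elem (?t ^ k) * z) +
      coeff_elem ?d * (coeff_elem (?t ^ k) * z - rat_elem (of_nat d ^ k) * z)"
    by (simp add: dim_elem_def coeff_elem_diff left_diff_distrib right_diff_distrib coeff_elem_mult const_tr_mult mult.assoc)
  also have "\<dots> \<in> core_ideal d n"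
    using Suc by (intro core_ideal_add core_ideal_dim_elem core_ideal_mult twisted_carrier_mult coeff_elem_TX)
  finally show ?case .
qed (simp add: core_ideal_zero)

text \<open>In degree zero the only trace indeterminate left is tr(1), and its powers become
  rational numbers modulo tr(1) - d.\<close>

lemma degree_zero_reduce:
  assumes "a \<in> degree_less n (Suc 0)"
  shows "\<exists>f. a - perm_sum n f \<in> core_ideal d n"
  using assms
proof (induction rule: degree_less_induct)
  case zero
  show ?case by (intro exI[of _ "\<lambda>_. 0"]) (simp add: perm_sum_def core_ideal_zero)
next
  case (add t m q a)
  obtain f where f: "a - perm_sum n f \<in> core_ideal d n" using add(3) by blast
  let ?\<sigma> = "permutation t" and ?k = "size m"
  have "trace_degree m = 0" "tensor_degree n t = 0" using add(2) by simp_all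
  then have t: "t = TMon (\<lambda>_. 0) ?\<sigma>" using add(1) by (intro tensor_degree_0)
  have "Poly_Mapping.single m 1 = tr_monomial 0 ^ ?k"
    using \<open>trace_degree m = 0\<close>
  proof (induction m)
    case (add c m)
    have "letters (rep_cyc_monomial c) = []" "trace_degree m = 0" using add.prems by (simp_all add: trace_degree_def)
    then have "rep_cyc_monomial c = 0" by (cases "rep_cyc_monomial c") (simp add: zero_monomial_def)
    then have "abs_cyc_monomial 0 = c"
      using Quotient3_abs_rep[OF Quotient3_cyc_monomial, of c] by simp
    then have "Poly_Mapping.single (add_mset c m) 1 = tr_monomial 0 * Poly_Mapping.single m 1"
      by (simp add: tr_monomial_def mult_single)
    then show ?case by (simp only: add.IH[OF \<open>trace_degree m = 0\<close>] size_add_mset power_Suc)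
  qed simp
  then have x: "Poly_Mapping.single t (Poly_Mapping.single m q) =
      rat_elem q * (coeff_elem (tr_monomial 0 ^ ?k) * perm_elem ?\<sigma>)"
    using t by (simp add: perm_elem_def coeff_elem_mult_single const_tr_def mult_single flip: \<open>Poly_Mapping.single m 1 = _\<close>)
  have \<sigma>: "?\<sigma> \<in> sym_group n" using add(1) by (simp add: tensor_monomials_def)
  \<comment> \<open>The doubled minus sign and the scalar factor give the shape to which
    \<open>perm_sum_diff\<close> applies.\<close>
  let ?g = "\<lambda>\<rho>. f \<rho> - (- q * of_nat d ^ ?k) * (if \<rho> = ?\<sigma> then 1 else 0)"
  have "perm_sum n (\<lambda>\<rho>. if \<rho> = ?\<sigma> then 1 else 0) = (\<Sum>\<rho>\<in>sym_group n. if \<rho> = ?\<sigma> then perm_elem ?\<sigma> else 0)"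
    unfolding perm_sum_def by (intro sum.cong refl) auto
  also have "\<dots> = perm_elem ?\<sigma>" using \<sigma> by (simp add: finite_sym_group)
  finally have "perm_sum n ?g = perm_sum n f + rat_elem q * (rat_elem (of_nat d ^ ?k) * perm_elem ?\<sigma>)"
    unfolding perm_sum_diff by (simp add: const_tr_uminus coeff_elem_uminus const_tr_mult coeff_elem_mult mult.assoc)
  then have "Poly_Mapping.single t (Poly_Mapping.single m q) + a - perm_sum n ?g =
      rat_elem q * (coeff_elem (tr_monomial 0 ^ ?k) * perm_elem ?\<sigma> - rat_elem (of_nat d ^ ?k) * perm_elem ?\<sigma>) +
      (a - perm_sum n f)"
    by (simp add: x right_diff_distrib)
  also have "\<dots> \<in> core_ideal d n"
    using f \<sigma> by (intro core_ideal_add core_ideal_mult dim_elem_power perm_elem_TX coeff_elem_TX)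
  finally show ?case by blast
qed

lemma tensor_identities_subset_core_ideal: "tensor_identities d n \<subseteq> core_ideal d n"
proof -
  have core: "core_ideal d m \<subseteq> tensor_identities d m" for m
    by (rule core_ideal_subset[OF T_ideal_tensor_identities generators_le_tensor_identities])
  have "a \<in> core_ideal d n" if "a \<in> degree_less n D" "a \<in> tensor_identities d n" for a D
    using that
  proof (induction D arbitrary: n a)
    case 0
    then show ?case using degree_less_0 core_ideal_zero by blast
  next
    case (Suc D)
    show ?case
    proof (cases "D = 0")
      case True
      then obtain f where f: "a - perm_sum n f \<in> core_ideal d n" using degree_zero_reduce Suc.prems(1) by blast
      then have "a - perm_sum n f \<in> tensor_identities d n" using core by blast
      from tensor_identities_diff[OF Suc.prems(2) this]
      have "perm_sum n f \<in> tensor_identities d n" by simp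
      then have "perm_sum n f \<in> core_ideal d n" by (rule perm_sum_identity)
      with f have "(a - perm_sum n f) + perm_sum n f \<in> core_ideal d n" by (rule core_ideal_add)
      then show ?thesis by simp
    next
      case False
      obtain L b where b: "\<And>y. b y \<in> degree_less (Suc n) D" "\<And>y. directional_cut d n y a (b y)"
        "of_nat D * a - (\<Sum>y<L. partial_trace n (pos_elem n (Mon [y]) * b y)) \<in> degree_less n D"
        using cuts_exist[OF Suc.prems(1), of d] by blast
      let ?e = "\<Sum>y<L. partial_trace n (pos_elem n (Mon [y]) * b y)"
      \<comment> \<open>The induction is on \<open>D\<close> with \<open>n\<close> arbitrary: the
        cuts have one more strand but lower degree.\<close>
      have "b y \<in> core_ideal d (Suc n)" for y
        using b by (intro Suc.IH cut_identity[OF Suc.prems(2)] degree_less_TX)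
      then have e: "?e \<in> core_ideal d n"
        by (intro core_ideal_sum core_ideal_partial_trace core_ideal_mult pos_elem_TX) simp_all
      \<comment> \<open>The remainder has lower degree and is again an identity, since
        \<open>core_ideal\<close> consists of identities.\<close>
      have "of_nat D * a - ?e \<in> tensor_identities d n"
        using Suc.prems(2) e core by (intro tensor_identities_diff tensor_identities_mult_left TX_of_nat) auto
      with b(3) have "of_nat D * a - ?e \<in> core_ideal d n" by (rule Suc.IH)
      from core_ideal_add[OF this e] have "rat_elem (of_nat D) * a \<in> core_ideal d n" by (simp add: rat_elem_of_nat)
      then have "rat_elem (1 / of_nat D) * (rat_elem (of_nat D) * a) \<in> core_ideal d n"
        by (rule core_ideal_mult) simp
      then show ?thesis using False by (simp flip: mult.assoc coeff_elem_mult const_tr_mult)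
    qed
  qed
  moreover have "a \<in> TX n" if "a \<in> tensor_identities d n" for a using that by (simp add: tensor_identities_iff)
  ultimately show ?thesis using degree_less_exhaust by (metis subsetI)
qed

theorem theorem3p8:
  fixes d x :: nat
  assumes "1 \<le> d"
  shows "tensor_identities d = T_ideal_generated (generators d x)"
proof (rule antisym)
  show "tensor_identities d \<le> T_ideal_generated (generators d x)"
    unfolding T_ideal_generated_def
  proof (rule Inf_greatest)
    fix J assume "J \<in> {J. T_ideal J \<and> generators d x \<le> J}"
    then show "tensor_identities d \<le> J"
      using tensor_identities_subset_core_ideal core_ideal_subset by (blast intro: le_funI)
  qed
  show "T_ideal_generated (generators d x) \<le> tensor_identities d"
    unfolding T_ideal_generated_def
    by (rule Inf_lower) (simp add: T_ideal_tensor_identities generators_le_tensor_identities)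
qed

end
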